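(* Let $H$ be a finite-dimensional cotriangular pointed Hopf algebra over $\mathbb{C}$. Then $H$ is generated, as an algebra, by its grouplike and skew primitive elements.
   Context: A finite-dimensional Hopf algebra $H$ is cotriangular if its dual Hopf algebra $H^*$ is equipped with a triangular structure, i.e. a universal $R$-matrix $R\in H^*\otimes H^*$ with $R_{21}R=1\otimes 1$. $H$ is pointed if all its simple comodules are $1$-dimensional. An element $x\in H$ is skew primitive if $\Delta(x)=x\otimes a+b\otimes x$ for some grouplike elements $a,b\in H$. *)

theory Defs
  imports Complex_Main "HOL-Library.Poly_Mapping"
begin

section \<open>Complex vector spaces\<close>

class complex_vector = ab_group_add +
  fixes scaleC :: "complex \<Rightarrow> 'a \<Rightarrow> 'a"  (infixr \<open>*\<^sub>C\<close> 75)
  assumes scaleC_add_right: "a *\<^sub>C (x + y) = a *\<^sub>C x + a *\<^sub>C y"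
    and scaleC_add_left: "(a + b) *\<^sub>C x = a *\<^sub>C x + b *\<^sub>C x"
    and scaleC_scaleC: "a *\<^sub>C (b *\<^sub>C x) = (a * b) *\<^sub>C x"
    and scaleC_one: "1 *\<^sub>C x = x"

global_interpretation complex_vector:
  vector_space "scaleC :: complex \<Rightarrow> 'a \<Rightarrow> 'a::complex_vector"
  defines csubspace = complex_vector.subspace
    and cspan = complex_vector.span
    and cdim = complex_vector.dim
  by unfold_locales (rule scaleC_add_right scaleC_add_left scaleC_scaleC scaleC_one)+

abbreviation clinear :: "('a::complex_vector \<Rightarrow> 'b::complex_vector) \<Rightarrow> bool"
  where "clinear \<equiv> Vector_Spaces.linear scaleC scaleC"

definition cbilinear ::
    "('a::complex_vector \<Rightarrow> 'b::complex_vector \<Rightarrow> 'c::complex_vector) \<Rightarrow> bool"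
  where "cbilinear \<beta> \<longleftrightarrow> (\<forall>b. clinear (\<lambda>a. \<beta> a b)) \<and> (\<forall>a. clinear (\<beta> a))"

instantiation complex :: complex_vector
begin
definition scaleC_complex :: "complex \<Rightarrow> complex \<Rightarrow> complex"
  where [simp]: "scaleC_complex c z = c * z"
instance by standard (auto simp: algebra_simps)
end

instantiation poly_mapping :: (type, complex_vector) complex_vector
begin
lift_definition scaleC_poly_mapping :: "complex \<Rightarrow> ('a \<Rightarrow>\<^sub>0 'b) \<Rightarrow> 'a \<Rightarrow>\<^sub>0 'b"
  is "\<lambda>c p k. c *\<^sub>C p k"
  by (erule finite_subset[rotated]) auto
instance
  by standard (transfer, simp add: fun_eq_iff scaleC_add_right scaleC_add_left scaleC_scaleC
      scaleC_one)+
end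

lemma clinearI:
  assumes "\<And>x y. f (x + y) = f x + f y" "\<And>c x. f (c *\<^sub>C x) = c *\<^sub>C f x"
  shows "clinear f"
  using assms by unfold_locales auto

lemma clinear_add: "clinear f \<Longrightarrow> f (x + y) = f x + f y"
  and clinear_scaleC: "clinear f \<Longrightarrow> f (c *\<^sub>C x) = c *\<^sub>C f x"
  by (simp_all add: Vector_Spaces.linear_iff)

lemma clinear_sum: "clinear f \<Longrightarrow> f (\<Sum>i\<in>I. g i) = (\<Sum>i\<in>I. f (g i))"
proof -
  assume "clinear f"
  then interpret Vector_Spaces.linear scaleC scaleC f .
  show ?thesis by (rule sum)
qed

section \<open>Tensor products\<close>

text \<open>
  The tensor product is the free vector space on \<open>'a \<times> 'b\<close> modulo the span of the bilinearity
  relations.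
\<close>

definition tensor_relators :: "('a::complex_vector \<times> 'b::complex_vector \<Rightarrow>\<^sub>0 complex) set"
  where "tensor_relators =
    {Poly_Mapping.single (a + a', b) 1 - Poly_Mapping.single (a, b) 1
        - Poly_Mapping.single (a', b) 1 | a a' b. True} \<union>
    {Poly_Mapping.single (a, b + b') 1 - Poly_Mapping.single (a, b) 1
        - Poly_Mapping.single (a, b') 1 | a b b'. True} \<union>
    {Poly_Mapping.single (c *\<^sub>C a, b) 1 - c *\<^sub>C Poly_Mapping.single (a, b) 1 | c a b. True} \<union>
    {Poly_Mapping.single (a, c *\<^sub>C b) 1 - c *\<^sub>C Poly_Mapping.single (a, b) 1 | c a b. True}"

definition tensor_rel ::
    "('a::complex_vector \<times> 'b::complex_vector \<Rightarrow>\<^sub>0 complex) \<Rightarrow> ('a \<times> 'b \<Rightarrow>\<^sub>0 complex) \<Rightarrow> bool"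
  where "tensor_rel p q \<longleftrightarrow> p - q \<in> cspan tensor_relators"

lemma equivp_tensor_rel:
  "equivp (tensor_rel ::
    ('a::complex_vector \<times> 'b::complex_vector \<Rightarrow>\<^sub>0 complex) \<Rightarrow> ('a \<times> 'b \<Rightarrow>\<^sub>0 complex) \<Rightarrow> bool)"
proof (rule equivpI)
  show "reflp (tensor_rel :: ('a \<times> 'b \<Rightarrow>\<^sub>0 complex) \<Rightarrow> _)"
    by (simp add: reflp_def tensor_rel_def complex_vector.span_zero)
  show "symp (tensor_rel :: ('a \<times> 'b \<Rightarrow>\<^sub>0 complex) \<Rightarrow> _)"
  proof (rule sympI)
    fix p q :: "'a \<times> 'b \<Rightarrow>\<^sub>0 complex"
    assume "tensor_rel p q"
    then have "- (p - q) \<in> cspan tensor_relators"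
      unfolding tensor_rel_def by (rule complex_vector.span_neg)
    then show "tensor_rel q p" by (simp add: tensor_rel_def)
  qed
  show "transp (tensor_rel :: ('a \<times> 'b \<Rightarrow>\<^sub>0 complex) \<Rightarrow> _)"
  proof (rule transpI)
    fix p q r :: "'a \<times> 'b \<Rightarrow>\<^sub>0 complex"
    assume "tensor_rel p q" "tensor_rel q r"
    then have "(p - q) + (q - r) \<in> cspan tensor_relators"
      unfolding tensor_rel_def by (rule complex_vector.span_add)
    then show "tensor_rel p r" by (simp add: tensor_rel_def)
  qed
qed

quotient_type (overloaded) ('a, 'b) tensor (infixr \<open>\<otimes>\<close> 20) =
  "'a::complex_vector \<times> 'b::complex_vector \<Rightarrow>\<^sub>0 complex" / tensor_rel
  by (rule equivp_tensor_rel)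

instantiation tensor :: (complex_vector, complex_vector) complex_vector
begin

lift_definition zero_tensor :: "'a \<otimes> 'b" is 0 .

lift_definition plus_tensor :: "'a \<otimes> 'b \<Rightarrow> 'a \<otimes> 'b \<Rightarrow> 'a \<otimes> 'b" is "(+)"
  unfolding tensor_rel_def by (simp only: add_diff_add complex_vector.span_add)

lift_definition uminus_tensor :: "'a \<otimes> 'b \<Rightarrow> 'a \<otimes> 'b" is uminus
proof -
  fix p q :: "'a \<times> 'b \<Rightarrow>\<^sub>0 complex"
  assume "tensor_rel p q"
  then have "- (p - q) \<in> cspan tensor_relators"
    unfolding tensor_rel_def by (rule complex_vector.span_neg)
  then show "tensor_rel (- p) (- q)" by (simp add: tensor_rel_def)
qed

lift_definition minus_tensor :: "'a \<otimes> 'b \<Rightarrow> 'a \<otimes> 'b \<Rightarrow> 'a \<otimes> 'b" is "(-)"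
proof -
  fix p q p' q' :: "'a \<times> 'b \<Rightarrow>\<^sub>0 complex"
  assume "tensor_rel p q" "tensor_rel p' q'"
  then have "(p - q) - (p' - q') \<in> cspan tensor_relators"
    unfolding tensor_rel_def by (rule complex_vector.span_diff)
  then show "tensor_rel (p - p') (q - q')" by (simp add: tensor_rel_def algebra_simps)
qed

lift_definition scaleC_tensor :: "complex \<Rightarrow> 'a \<otimes> 'b \<Rightarrow> 'a \<otimes> 'b" is scaleC
proof -
  fix c and p q :: "'a \<times> 'b \<Rightarrow>\<^sub>0 complex"
  assume "tensor_rel p q"
  then have "c *\<^sub>C (p - q) \<in> cspan tensor_relators"
    unfolding tensor_rel_def by (rule complex_vector.span_scale)
  then show "tensor_rel (c *\<^sub>C p) (c *\<^sub>C q)"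
    by (simp add: tensor_rel_def complex_vector.scale_right_diff_distrib)
qed

instance
proof
  fix x y z :: "'a \<otimes> 'b" and a b :: complex
  have *: "p = q \<Longrightarrow> tensor_rel p q" for p q :: "'a \<times> 'b \<Rightarrow>\<^sub>0 complex"
    by (simp add: tensor_rel_def complex_vector.span_zero)
  show "x + y + z = x + (y + z)" by transfer (rule *, simp add: add.assoc)
  show "x + y = y + x" by transfer (rule *, simp add: add.commute)
  show "0 + x = x" by transfer (rule *, simp)
  show "- x + x = 0" by transfer (rule *, simp)
  show "x - y = x + - y" by transfer (rule *, simp)
  show "a *\<^sub>C (x + y) = a *\<^sub>C x + a *\<^sub>C y" by transfer (rule *, rule scaleC_add_right)
  show "(a + b) *\<^sub>C x = a *\<^sub>C x + b *\<^sub>C x" by transfer (rule *, rule scaleC_add_left)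
  show "a *\<^sub>C (b *\<^sub>C x) = (a * b) *\<^sub>C x" by transfer (rule *, rule scaleC_scaleC)
  show "1 *\<^sub>C x = x" by transfer (rule *, rule scaleC_one)
qed

end

lift_definition tensor_prod ::
    "'a::complex_vector \<Rightarrow> 'b::complex_vector \<Rightarrow> 'a \<otimes> 'b"  (infixr \<open>\<otimes>\<close> 78)
  is "\<lambda>a b. Poly_Mapping.single (a, b) 1" .

lemma clinear_tensor_prod_left:
  "clinear (\<lambda>a. (a :: 'a::complex_vector) \<otimes> (b :: 'b::complex_vector))"
proof (rule clinearI)
  fix x y :: 'a and c
  show "(x + y) \<otimes> b = x \<otimes> b + y \<otimes> b"
    by transfer (simp only: tensor_rel_def diff_diff_add[symmetric], rule complex_vector.span_base,
        unfold tensor_relators_def, blast)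
  show "(c *\<^sub>C x) \<otimes> b = c *\<^sub>C (x \<otimes> b)"
    by transfer (simp only: tensor_rel_def, rule complex_vector.span_base,
        unfold tensor_relators_def, blast)
qed

lemma clinear_tensor_prod_right:
  "clinear (\<lambda>b. (a :: 'a::complex_vector) \<otimes> (b :: 'b::complex_vector))"
proof (rule clinearI)
  fix x y :: 'b and c
  show "a \<otimes> (x + y) = a \<otimes> x + a \<otimes> y"
    by transfer (simp only: tensor_rel_def diff_diff_add[symmetric], rule complex_vector.span_base,
        unfold tensor_relators_def, blast)
  show "a \<otimes> (c *\<^sub>C x) = c *\<^sub>C (a \<otimes> x)"
    by transfer (simp only: tensor_rel_def, rule complex_vector.span_base,
        unfold tensor_relators_def, blast)
qed

lemma clinear_eq_on_tensors:
  assumes f: "clinear f" and g: "clinear g" and eq: "\<And>a b. f (a \<otimes> b) = g (a \<otimes> b)"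
  shows "f t = g t"
proof -
  have "f (abs_tensor p) = g (abs_tensor p)" for p
  proof (induction p rule: update_induct)
    case const
    have "f 0 = 0" "g 0 = 0"
      using clinear_scaleC[OF f, of 0 0] clinear_scaleC[OF g, of 0 0] by simp_all
    then show ?case by (simp add: zero_tensor_def)
  next
    case (update p k c)
    obtain a b where k: "k = (a, b)" by fastforce
    have "Poly_Mapping.update k c p = p + c *\<^sub>C Poly_Mapping.single (a, b) 1"
      using update.hyps(1)
      by (intro poly_mapping_eqI) (auto simp: lookup_update lookup_add scaleC_poly_mapping.rep_eq
          k lookup_single in_keys_iff when_def)
    then have "abs_tensor (Poly_Mapping.update k c p) = abs_tensor p + c *\<^sub>C (a \<otimes> b)"
      by (simp add: plus_tensor.abs_eq scaleC_tensor.abs_eq tensor_prod.abs_eq)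
    then show ?case
      by (simp add: clinear_add[OF f] clinear_add[OF g] clinear_scaleC[OF f] clinear_scaleC[OF g]
          eq update.IH)
  qed
  moreover obtain p where "t = abs_tensor p"
    by (metis Quotient3_abs_rep Quotient3_tensor)
  ultimately show ?thesis by simp
qed

definition free_lift ::
    "('a::complex_vector \<Rightarrow> 'b::complex_vector \<Rightarrow> 'c::complex_vector)
      \<Rightarrow> ('a \<times> 'b \<Rightarrow>\<^sub>0 complex) \<Rightarrow> 'c"
  where "free_lift \<beta> p =
    (\<Sum>k\<in>Poly_Mapping.keys p. Poly_Mapping.lookup p k *\<^sub>C \<beta> (fst k) (snd k))"

text \<open>
  The linear map on the tensor product induced by a bilinear map \<open>\<beta>\<close>; see
  \<open>tensor_lift_tensor_prod\<close> and \<open>clinear_tensor_lift\<close> below.  It is meaningful only for bilinear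
  \<open>\<beta>\<close>, when the choice of the representative is immaterial.
\<close>

definition tensor_lift ::
    "('a::complex_vector \<Rightarrow> 'b::complex_vector \<Rightarrow> 'c::complex_vector) \<Rightarrow> 'a \<otimes> 'b \<Rightarrow> 'c"
  where "tensor_lift \<beta> t = free_lift \<beta> (rep_tensor t)"

lemma free_lift_superset:
  assumes "finite K" "Poly_Mapping.keys p \<subseteq> K"
  shows "free_lift \<beta> p = (\<Sum>k\<in>K. Poly_Mapping.lookup p k *\<^sub>C \<beta> (fst k) (snd k))"
  unfolding free_lift_def using assms
  by (intro sum.mono_neutral_left) (auto simp: in_keys_iff)

lemma clinear_free_lift: "clinear (free_lift \<beta>)"
proof (rule clinearI)
  fix p q :: "'a \<times> 'b \<Rightarrow>\<^sub>0 complex"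
  let ?K = "Poly_Mapping.keys p \<union> Poly_Mapping.keys q"
  have "free_lift \<beta> (p + q) =
      (\<Sum>k\<in>?K. Poly_Mapping.lookup (p + q) k *\<^sub>C \<beta> (fst k) (snd k))"
    by (rule free_lift_superset) (simp_all add: Poly_Mapping.keys_add)
  also have "\<dots> = free_lift \<beta> p + free_lift \<beta> q"
    by (simp add: free_lift_superset[of ?K p] free_lift_superset[of ?K q] lookup_add
        scaleC_add_left sum.distrib)
  finally show "free_lift \<beta> (p + q) = free_lift \<beta> p + free_lift \<beta> q" .
next
  fix c and p :: "'a \<times> 'b \<Rightarrow>\<^sub>0 complex"
  have "free_lift \<beta> (c *\<^sub>C p) =
      (\<Sum>k\<in>Poly_Mapping.keys p. Poly_Mapping.lookup (c *\<^sub>C p) k *\<^sub>C \<beta> (fst k) (snd k))"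
    by (rule free_lift_superset) (auto simp: in_keys_iff scaleC_poly_mapping.rep_eq)
  then show "free_lift \<beta> (c *\<^sub>C p) = c *\<^sub>C free_lift \<beta> p"
    by (simp add: free_lift_def complex_vector.scale_sum_right scaleC_poly_mapping.rep_eq
        scaleC_scaleC)
qed

lemma free_lift_single [simp]: "free_lift \<beta> (Poly_Mapping.single (a, b) c) = c *\<^sub>C \<beta> a b"
  by (simp add: free_lift_def)

lemma free_lift_diff: "free_lift \<beta> (p - q) = free_lift \<beta> p - free_lift \<beta> q"
proof -
  interpret Vector_Spaces.linear scaleC scaleC "free_lift \<beta>" by (rule clinear_free_lift)
  show ?thesis by (rule diff)
qed

lemma free_lift_tensor_rel:
  assumes \<beta>: "cbilinear \<beta>" and "tensor_rel p q"
  shows "free_lift \<beta> p = free_lift \<beta> q"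
proof -
  have l: "clinear (\<lambda>a. \<beta> a b)" and r: "clinear (\<beta> a)" for a b
    using \<beta> by (auto simp: cbilinear_def)
  have "p - q \<in> cspan tensor_relators" using assms(2) by (simp add: tensor_rel_def)
  then have "free_lift \<beta> (p - q) = 0"
  proof (rule complex_vector.span_induct)
    show "csubspace {x. free_lift \<beta> x = 0}"
      by (rule complex_vector.subspaceI)
        (use clinear_add[OF clinear_free_lift, of \<beta>] clinear_scaleC[OF clinear_free_lift, of \<beta>]
          free_lift_diff[of \<beta> 0 0] in auto)
  next
    fix x :: "'a \<times> 'b \<Rightarrow>\<^sub>0 complex"
    assume "x \<in> tensor_relators"
    then show "free_lift \<beta> x = 0"
      by (auto simp: tensor_relators_def free_lift_diff clinear_scaleC[OF clinear_free_lift]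
          clinear_add[OF l] clinear_add[OF r] clinear_scaleC[OF l] clinear_scaleC[OF r]
          complex_vector.scale_one)
  qed
  then show ?thesis by (simp add: free_lift_diff)
qed

lemma tensor_lift_abs:
  assumes "cbilinear \<beta>"
  shows "tensor_lift \<beta> (abs_tensor p) = free_lift \<beta> p"
  unfolding tensor_lift_def
  by (rule free_lift_tensor_rel[OF assms])
    (metis Quotient3_rep_abs Quotient3_tensor equivp_reflp equivp_tensor_rel)

lemma tensor_lift_tensor_prod:
  assumes "cbilinear \<beta>"
  shows "tensor_lift \<beta> (a \<otimes> b) = \<beta> a b"
  by (simp add: tensor_prod.abs_eq tensor_lift_abs[OF assms] complex_vector.scale_one)

lemma clinear_tensor_lift:
  assumes "cbilinear \<beta>"
  shows "clinear (tensor_lift \<beta>)"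
proof (rule clinearI)
  fix s t :: "'a \<otimes> 'b"
  obtain p q where "s = abs_tensor p" "t = abs_tensor q"
    by (metis Quotient3_abs_rep Quotient3_tensor)
  then show "tensor_lift \<beta> (s + t) = tensor_lift \<beta> s + tensor_lift \<beta> t"
    by (simp add: plus_tensor.abs_eq tensor_lift_abs[OF assms] clinear_add[OF clinear_free_lift])
next
  fix c and s :: "'a \<otimes> 'b"
  obtain p where "s = abs_tensor p"
    by (metis Quotient3_abs_rep Quotient3_tensor)
  then show "tensor_lift \<beta> (c *\<^sub>C s) = c *\<^sub>C tensor_lift \<beta> s"
    by (simp add: scaleC_tensor.abs_eq tensor_lift_abs[OF assms]
        clinear_scaleC[OF clinear_free_lift])
qed

definition tensor_map ::
    "('a::complex_vector \<Rightarrow> 'c::complex_vector) \<Rightarrow> ('b::complex_vector \<Rightarrow> 'd::complex_vector)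
      \<Rightarrow> 'a \<otimes> 'b \<Rightarrow> 'c \<otimes> 'd"
  where "tensor_map f g = tensor_lift (\<lambda>a b. f a \<otimes> g b)"

definition tensor_swap :: "'a::complex_vector \<otimes> 'b::complex_vector \<Rightarrow> 'b \<otimes> 'a"
  where "tensor_swap = tensor_lift (\<lambda>a b. b \<otimes> a)"

definition tensor_assoc ::
    "('a::complex_vector \<otimes> 'b::complex_vector) \<otimes> 'c::complex_vector \<Rightarrow> 'a \<otimes> ('b \<otimes> 'c)"
  where "tensor_assoc = tensor_lift (\<lambda>t c. tensor_lift (\<lambda>a b. a \<otimes> (b \<otimes> c)) t)"

definition tensor_mult ::
    "('a::complex_vector \<Rightarrow> 'a \<Rightarrow> 'a) \<Rightarrow> ('b::complex_vector \<Rightarrow> 'b \<Rightarrow> 'b)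
      \<Rightarrow> 'a \<otimes> 'b \<Rightarrow> 'a \<otimes> 'b \<Rightarrow> 'a \<otimes> 'b"
  where "tensor_mult m n s t =
    tensor_lift (\<lambda>a b. tensor_lift (\<lambda>a' b'. m a a' \<otimes> n b b') t) s"

definition subspace_tensor ::
    "'a::complex_vector set \<Rightarrow> 'b::complex_vector set \<Rightarrow> ('a \<otimes> 'b) set"
  where "subspace_tensor V W = cspan {v \<otimes> w | v w. v \<in> V \<and> w \<in> W}"

section \<open>Hopf algebras\<close>

record (overloaded) ('a::complex_vector) hopf =
  mult :: "'a \<Rightarrow> 'a \<Rightarrow> 'a"
  unit :: 'a
  comult :: "'a \<Rightarrow> 'a \<otimes> 'a"
  counit :: "'a \<Rightarrow> complex"
  antipode :: "'a \<Rightarrow> 'a"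

abbreviation mult2 :: "'a::complex_vector hopf \<Rightarrow> 'a \<otimes> 'a \<Rightarrow> 'a \<otimes> 'a \<Rightarrow> 'a \<otimes> 'a"
  where "mult2 H \<equiv> tensor_mult (mult H) (mult H)"

abbreviation mult3 ::
    "'a::complex_vector hopf \<Rightarrow> 'a \<otimes> ('a \<otimes> 'a) \<Rightarrow> 'a \<otimes> ('a \<otimes> 'a) \<Rightarrow> 'a \<otimes> ('a \<otimes> 'a)"
  where "mult3 H \<equiv> tensor_mult (mult H) (mult2 H)"

definition convolution ::
    "'a::complex_vector hopf \<Rightarrow> ('a \<Rightarrow> 'a) \<Rightarrow> ('a \<Rightarrow> 'a) \<Rightarrow> 'a \<Rightarrow> 'a"
  where "convolution H f g x = tensor_lift (\<lambda>a b. mult H (f a) (g b)) (comult H x)"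

locale hopf_algebra =
  fixes H :: "'a::complex_vector hopf"
  assumes mult_bilinear: "cbilinear (mult H)"
    and mult_assoc: "mult H (mult H x y) z = mult H x (mult H y z)"
    and mult_unit_left: "mult H (unit H) x = x"
    and mult_unit_right: "mult H x (unit H) = x"
    and comult_linear: "clinear (comult H)"
    and counit_linear: "clinear (counit H)"
    and coassoc: "tensor_assoc (tensor_map (comult H) id (comult H x)) =
                  tensor_map id (comult H) (comult H x)"
    and counit_left: "tensor_lift (\<lambda>a b. counit H a *\<^sub>C b) (comult H x) = x"
    and counit_right: "tensor_lift (\<lambda>a b. counit H b *\<^sub>C a) (comult H x) = x"
    and comult_mult: "comult H (mult H x y) = mult2 H (comult H x) (comult H y)"
    and comult_unit: "comult H (unit H) = unit H \<otimes> unit H"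
    and counit_mult: "counit H (mult H x y) = counit H x * counit H y"
    and counit_unit: "counit H (unit H) = 1"
    and antipode_linear: "clinear (antipode H)"
    and antipode_left: "convolution H (antipode H) id x = counit H x *\<^sub>C unit H"
    and antipode_right: "convolution H id (antipode H) x = counit H x *\<^sub>C unit H"

definition grouplike :: "'a::complex_vector hopf \<Rightarrow> 'a \<Rightarrow> bool"
  where "grouplike H g \<longleftrightarrow> g \<noteq> 0 \<and> comult H g = g \<otimes> g"

definition skew_primitive :: "'a::complex_vector hopf \<Rightarrow> 'a \<Rightarrow> bool"
  where "skew_primitive H x \<longleftrightarrow>
    (\<exists>a b. grouplike H a \<and> grouplike H b \<and> comult H x = x \<otimes> a + b \<otimes> x)"

definition subalgebra :: "'a::complex_vector hopf \<Rightarrow> 'a set \<Rightarrow> bool"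
  where "subalgebra H A \<longleftrightarrow>
    csubspace A \<and> unit H \<in> A \<and> (\<forall>x\<in>A. \<forall>y\<in>A. mult H x y \<in> A)"

section \<open>Comodules and pointedness\<close>

text \<open>
  A right comodule is carried by a subspace \<open>V\<close> of an ambient space \<open>'v\<close>.  The coaction is taken
  to be a linear map on all of \<open>'v\<close>, so that \<open>tensor_map \<rho> id\<close> makes sense, but only its
  restriction to \<open>V\<close> is constrained; every linear map on \<open>V\<close> extends to \<open>'v\<close>.
\<close>

definition comodule ::
    "'a::complex_vector hopf \<Rightarrow> 'v::complex_vector set \<Rightarrow> ('v \<Rightarrow> 'v \<otimes> 'a) \<Rightarrow> bool"
  where "comodule H V \<rho> \<longleftrightarrow>
    csubspace V \<and> clinear \<rho> \<and>
    (\<forall>v\<in>V. \<rho> v \<in> subspace_tensor V UNIV \<and>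
      tensor_assoc (tensor_map \<rho> id (\<rho> v)) = tensor_map id (comult H) (\<rho> v) \<and>
      tensor_lift (\<lambda>w h. counit H h *\<^sub>C w) (\<rho> v) = v)"

definition simple_comodule ::
    "'a::complex_vector hopf \<Rightarrow> 'v::complex_vector set \<Rightarrow> ('v \<Rightarrow> 'v \<otimes> 'a) \<Rightarrow> bool"
  where "simple_comodule H V \<rho> \<longleftrightarrow>
    comodule H V \<rho> \<and> V \<noteq> {0} \<and>
    (\<forall>W. W \<subseteq> V \<and> comodule H W \<rho> \<longrightarrow> W = {0} \<or> W = V)"

text \<open>
  Types cannot be quantified inside a formula, so the comodules range over the subspaces of the
  fixed space \<open>nat \<Rightarrow>\<^sub>0 complex\<close> of countable dimension.  Simple comodules are
  finite-dimensional, hence each of them is isomorphic to one of these.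
\<close>

definition pointed :: "'a::complex_vector hopf \<Rightarrow> bool"
  where "pointed H \<longleftrightarrow>
    (\<forall>(V :: (nat \<Rightarrow>\<^sub>0 complex) set) \<rho>. simple_comodule H V \<rho> \<longrightarrow> cdim V = 1)"

section \<open>The dual Hopf algebra\<close>

typedef (overloaded) 'a dual = "{f :: 'a::complex_vector \<Rightarrow> complex. clinear f}"
  morphisms dual_apply to_dual
  by (rule exI[of _ "\<lambda>_. 0"]) (simp add: clinearI)

setup_lifting type_definition_dual

instantiation dual :: (complex_vector) complex_vector
begin
lift_definition zero_dual :: "'a dual" is "\<lambda>_. 0" by (simp add: clinearI)
lift_definition plus_dual :: "'a dual \<Rightarrow> 'a dual \<Rightarrow> 'a dual" is "\<lambda>f g x. f x + g x"
  by (simp add: Vector_Spaces.linear_iff algebra_simps)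
lift_definition uminus_dual :: "'a dual \<Rightarrow> 'a dual" is "\<lambda>f x. - f x"
  by (simp add: Vector_Spaces.linear_iff algebra_simps)
lift_definition minus_dual :: "'a dual \<Rightarrow> 'a dual \<Rightarrow> 'a dual" is "\<lambda>f g x. f x - g x"
  by (simp add: Vector_Spaces.linear_iff algebra_simps)
lift_definition scaleC_dual :: "complex \<Rightarrow> 'a dual \<Rightarrow> 'a dual" is "\<lambda>c f x. c * f x"
  by (simp add: Vector_Spaces.linear_iff algebra_simps)
instance by standard (transfer, simp add: fun_eq_iff algebra_simps)+
end

lemma dual_apply_sum: "dual_apply (\<Sum>i\<in>I. f i) x = (\<Sum>i\<in>I. dual_apply (f i) x)"
  by (induction I rule: infinite_finite_induct) (simp_all add: zero_dual.rep_eq plus_dual.rep_eq)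

definition dual_pairing2 ::
    "'a::complex_vector dual \<otimes> 'b::complex_vector dual \<Rightarrow> 'a \<Rightarrow> 'b \<Rightarrow> complex"
  where "dual_pairing2 t x y = tensor_lift (\<lambda>f g. dual_apply f x * dual_apply g y) t"

lemma cbilinear_dual_pairing:
  "cbilinear (\<lambda>f g. dual_apply f x * dual_apply g y)"
  by (simp add: cbilinear_def clinearI plus_dual.rep_eq scaleC_dual.rep_eq algebra_simps)

text \<open>
  For finite-dimensional \<open>V\<close> and \<open>W\<close> the pairing identifies \<open>V* \<otimes> W*\<close> with the bilinear forms on
  \<open>V \<times> W\<close>.  This makes the definite description in \<open>dual_hopf\<close> well-defined.
\<close>

lemma dual_pairing2_ex1:
  fixes \<phi> :: "'a::complex_vector \<Rightarrow> 'b::complex_vector \<Rightarrow> complex"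
  assumes "finite_dimensional_vector_space scaleC (A :: 'a set)"
    and "finite_dimensional_vector_space scaleC (B :: 'b set)"
    and "cbilinear \<phi>"
  shows "\<exists>!t. \<forall>x y. dual_pairing2 t x y = \<phi> x y"
proof -
  interpret A: finite_dimensional_vector_space scaleC A by fact
  interpret B: finite_dimensional_vector_space scaleC B by fact
  note fin = A.finite_Basis B.finite_Basis
  have spans: "cspan A = UNIV" "cspan B = UNIV"
    using A.span_Basis B.span_Basis by (simp_all add: cspan_def)
  define \<alpha> where "\<alpha> a = to_dual (\<lambda>x. complex_vector.representation A x a)" for a
  define \<beta> where "\<beta> b = to_dual (\<lambda>x. complex_vector.representation B x b)" for b
  have \<alpha>: "dual_apply (\<alpha> a) x = complex_vector.representation A x a" for a x
    unfolding \<alpha>_def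
    by (subst to_dual_inverse) (auto intro!: clinearI simp: A.independent_Basis spans
        complex_vector.representation_add complex_vector.representation_scale)
  have \<beta>: "dual_apply (\<beta> b) y = complex_vector.representation B y b" for b y
    unfolding \<beta>_def
    by (subst to_dual_inverse) (auto intro!: clinearI simp: B.independent_Basis spans
        complex_vector.representation_add complex_vector.representation_scale)
  have A: "(\<Sum>a\<in>A. dual_apply (\<alpha> a) x *\<^sub>C a) = x" for x
    by (simp add: \<alpha> complex_vector.sum_representation_eq A.independent_Basis spans fin)
  have B: "(\<Sum>b\<in>B. dual_apply (\<beta> b) y *\<^sub>C b) = y" for y
    by (simp add: \<beta> complex_vector.sum_representation_eq B.independent_Basis spans fin)
  define E where "E \<psi> = (\<Sum>a\<in>A. \<Sum>b\<in>B. \<psi> a b *\<^sub>C (\<alpha> a \<otimes> \<beta> b))"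
    for \<psi> :: "'a \<Rightarrow> 'b \<Rightarrow> complex"
  have pair: "clinear (\<lambda>t. dual_pairing2 t x y)" for x :: 'a and y :: 'b
    unfolding dual_pairing2_def by (rule clinear_tensor_lift[OF cbilinear_dual_pairing])
  have pair_prod: "dual_pairing2 (f \<otimes> g) x y = dual_apply f x * dual_apply g y"
    for f g and x :: 'a and y :: 'b
    unfolding dual_pairing2_def by (rule tensor_lift_tensor_prod[OF cbilinear_dual_pairing])
  have ex: "dual_pairing2 (E \<phi>) x y = \<phi> x y" for x y
  proof -
    have l: "clinear (\<lambda>a. \<phi> a b)" and r: "clinear (\<phi> a)" for a b
      using assms(3) by (auto simp: cbilinear_def)
    have "\<phi> x y = \<phi> (\<Sum>a\<in>A. dual_apply (\<alpha> a) x *\<^sub>C a) (\<Sum>b\<in>B. dual_apply (\<beta> b) y *\<^sub>C b)"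
      by (simp only: A B)
    also have "\<dots> = (\<Sum>a\<in>A. \<Sum>b\<in>B. dual_apply (\<alpha> a) x * (dual_apply (\<beta> b) y * \<phi> a b))"
      by (simp add: clinear_sum[OF l] clinear_sum[OF r] clinear_scaleC[OF l] clinear_scaleC[OF r]
          sum_distrib_left sum.swap[of _ B A] mult.left_commute)
    also have "\<dots> = dual_pairing2 (E \<phi>) x y"
      by (simp add: E_def clinear_sum[OF pair] clinear_scaleC[OF pair] pair_prod mult_ac)
    finally show ?thesis ..
  qed
  have uniq: "t = E (dual_pairing2 t)" for t
  proof (rule clinear_eq_on_tensors[where f = "\<lambda>t. t" and g = "\<lambda>t. E (dual_pairing2 t)"])
    show "clinear (\<lambda>t. t)" by (rule clinearI) simp_all
    show "clinear (\<lambda>t. E (dual_pairing2 t))"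
      by (rule clinearI) (simp_all add: E_def clinear_add[OF pair] clinear_scaleC[OF pair]
          scaleC_add_left sum.distrib complex_vector.scale_sum_right scaleC_scaleC)
  next
    fix f :: "'a dual" and g :: "'b dual"
    have l: "clinear (dual_apply f)" and r: "clinear (dual_apply g)"
      using dual_apply by auto
    have "f = (\<Sum>a\<in>A. dual_apply f a *\<^sub>C \<alpha> a)"
    proof (rule dual_apply_inject[THEN iffD1], rule ext)
      fix x
      have "dual_apply f x = dual_apply f (\<Sum>a\<in>A. dual_apply (\<alpha> a) x *\<^sub>C a)"
        by (simp only: A)
      also have "\<dots> = dual_apply (\<Sum>a\<in>A. dual_apply f a *\<^sub>C \<alpha> a) x"
        by (simp add: clinear_sum[OF l] clinear_scaleC[OF l] dual_apply_sum scaleC_dual.rep_eq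
            mult.commute)
      finally show "dual_apply f x = dual_apply (\<Sum>a\<in>A. dual_apply f a *\<^sub>C \<alpha> a) x" .
    qed
    moreover have "g = (\<Sum>b\<in>B. dual_apply g b *\<^sub>C \<beta> b)"
    proof (rule dual_apply_inject[THEN iffD1], rule ext)
      fix y
      have "dual_apply g y = dual_apply g (\<Sum>b\<in>B. dual_apply (\<beta> b) y *\<^sub>C b)"
        by (simp only: B)
      also have "\<dots> = dual_apply (\<Sum>b\<in>B. dual_apply g b *\<^sub>C \<beta> b) y"
        by (simp add: clinear_sum[OF r] clinear_scaleC[OF r] dual_apply_sum scaleC_dual.rep_eq
            mult.commute)
      finally show "dual_apply g y = dual_apply (\<Sum>b\<in>B. dual_apply g b *\<^sub>C \<beta> b) y" .
    qed
    ultimately have "f \<otimes> g =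
        (\<Sum>a\<in>A. dual_apply f a *\<^sub>C \<alpha> a) \<otimes> (\<Sum>b\<in>B. dual_apply g b *\<^sub>C \<beta> b)"
      by (rule arg_cong2)
    also have "\<dots> = E (dual_pairing2 (f \<otimes> g))"
      by (simp add: E_def pair_prod clinear_sum[OF clinear_tensor_prod_left]
          clinear_sum[OF clinear_tensor_prod_right] clinear_scaleC[OF clinear_tensor_prod_left]
          clinear_scaleC[OF clinear_tensor_prod_right] complex_vector.scale_sum_right
          scaleC_scaleC sum.swap[of _ B A] mult.commute)
    finally show "f \<otimes> g = E (dual_pairing2 (f \<otimes> g))" .
  qed
  show ?thesis
  proof (rule ex1I[of _ "E \<phi>"])
    fix t assume "\<forall>x y. dual_pairing2 t x y = \<phi> x y"
    then have "dual_pairing2 t = \<phi>" by (intro ext) simp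
    then show "t = E \<phi>" using uniq[of t] by simp
  qed (simp add: ex)
qed

text \<open>
  The dual Hopf algebra of a finite-dimensional Hopf algebra: every structure map is the transpose
  of the corresponding one of \<open>H\<close>, without any flip of tensor factors, so that
  \<open>\<langle>f g, x\<rangle> = \<langle>f \<otimes> g, \<Delta> x\<rangle>\<close> and \<open>\<langle>\<Delta> f, x \<otimes> y\<rangle> = \<langle>f, x y\<rangle>\<close>.
\<close>

definition dual_hopf :: "'a::complex_vector hopf \<Rightarrow> 'a dual hopf"
  where "dual_hopf H = \<lparr>
    mult = (\<lambda>f g. to_dual (\<lambda>x.
      tensor_lift (\<lambda>a b. dual_apply f a * dual_apply g b) (comult H x))),
    unit = to_dual (counit H),
    comult = (\<lambda>f. THE t. \<forall>x y. dual_pairing2 t x y = dual_apply f (mult H x y)),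
    counit = (\<lambda>f. dual_apply f (unit H)),
    antipode = (\<lambda>f. to_dual (\<lambda>x. dual_apply f (antipode H x)))\<rparr>"

section \<open>Triangular structures\<close>

definition leg12 :: "'a::complex_vector hopf \<Rightarrow> 'a \<otimes> 'a \<Rightarrow> 'a \<otimes> ('a \<otimes> 'a)"
  where "leg12 A = tensor_lift (\<lambda>a b. a \<otimes> (b \<otimes> unit A))"

definition leg13 :: "'a::complex_vector hopf \<Rightarrow> 'a \<otimes> 'a \<Rightarrow> 'a \<otimes> ('a \<otimes> 'a)"
  where "leg13 A = tensor_lift (\<lambda>a b. a \<otimes> (unit A \<otimes> b))"

definition leg23 :: "'a::complex_vector hopf \<Rightarrow> 'a \<otimes> 'a \<Rightarrow> 'a \<otimes> ('a \<otimes> 'a)"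
  where "leg23 A = tensor_lift (\<lambda>a b. unit A \<otimes> (a \<otimes> b))"

definition universal_R_matrix :: "'a::complex_vector hopf \<Rightarrow> 'a \<otimes> 'a \<Rightarrow> bool"
  where "universal_R_matrix A R \<longleftrightarrow>
    (\<exists>R'. mult2 A R R' = unit A \<otimes> unit A \<and> mult2 A R' R = unit A \<otimes> unit A) \<and>
    (\<forall>a. mult2 A R (comult A a) = mult2 A (tensor_swap (comult A a)) R) \<and>
    tensor_assoc (tensor_map (comult A) id R) = mult3 A (leg13 A R) (leg23 A R) \<and>
    tensor_map id (comult A) R = mult3 A (leg13 A R) (leg12 A R)"

definition triangular_structure :: "'a::complex_vector hopf \<Rightarrow> 'a \<otimes> 'a \<Rightarrow> bool"
  where "triangular_structure A R \<longleftrightarrow>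
    universal_R_matrix A R \<and> mult2 A (tensor_swap R) R = unit A \<otimes> unit A"

definition cotriangular :: "'a::complex_vector hopf \<Rightarrow> bool"
  where "cotriangular H \<longleftrightarrow> (\<exists>R. triangular_structure (dual_hopf H) R)"

end

theory Submission
  imports Defs
begin

text \<open>
  Let \<open>A\<close> be the dual of \<open>H\<close> and \<open>J\<close> the ideal of functionals that vanish on the grouplike
  elements.  Pointedness makes \<open>J\<close> nilpotent.  The associated graded algebra of the \<open>J\<close>-adic
  filtration is a bosonization of a Hopf algebra that the \<open>R\<close>-matrix makes braided cocommutative.
  In characteristic 0 a nonzero primitive element of even type is not nilpotent, so the elements of
  degree one are odd and supercommute, the braided commutators being primitive and even.
  Hence \<open>\<theta> a = \<Sum>\<^sub>i f\<^sub>i \<partial>\<^sub>i a\<close>, where \<open>\<partial>\<^sub>i a = a(v\<^sub>i \<cdot> _)\<close> for skew primitive \<open>v\<^sub>i\<close> dual to the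
  \<open>f\<^sub>i\<close> of degree one, is a derivation of the graded algebra and acts on degree \<open>m\<close> as
  multiplication by \<open>m\<close>.  If \<open>a\<close> vanishes on a subalgebra that contains the
  grouplike and skew primitive elements, then so do the \<open>\<partial>\<^sub>i a\<close>; thus if the annihilator of the
  subalgebra lies in \<open>J\<^sup>m\<close>, it lies in \<open>J\<^sup>m\<^sup>+\<^sup>1\<close>, and by induction it is zero.
\<close>

section \<open>Multilinear algebra\<close>

text \<open>The obstacle is a loss of one degree. A functional \<open>f\<close> of degree one and
  type \<open>p\<close> satisfies \<open>c \<star> f = f \<star> Lt p c\<close> only modulo
  \<open>Jp 2\<close>, whereas the Leibniz rule for the Euler operator needs it modulo
  \<open>Jp 3\<close> when \<open>c\<close> lies in \<open>J\<close>. The missing degree is exactly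
  braided commutativity of elements of degree one. That commutativity rests on one principle
  (\<open>no_primitive\<close>): if \<open>u\<close> has coproduct
  \<open>u \<otimes> \<epsilon> + c \<otimes> u\<close> up to higher degree and \<open>c\<close>
  commutes with \<open>u\<close>, then the powers of \<open>u\<close> expand with ordinary binomial
  coefficients, so in characteristic 0 none of them drops out of its degree, against nilpotency of
  \<open>J\<close>. The signs come from the bicharacter \<open>r\<close> that the R-matrix induces
  on grouplike elements: \<open>r p p\<close> squares to 1, the value 1 is excluded in degree one by
  the principle, and two types of value -1 multiply to one of value 1, so that the principle applies
  again to the braided commutator. Neither the graded algebra nor a bosonization is constructed;
  every equation in them is a congruence modulo a power of \<open>J\<close>.\<close>

named_theorems lin

lemma lin_id [lin]: "clinear (\<lambda>x. x)"
  by (rule clinearI) simp_all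

lemma clinear_zero: "clinear f \<Longrightarrow> f 0 = 0"
  using clinear_scaleC[of f 0 0] by simp

lemma clinear_diff: "clinear f \<Longrightarrow> f (x - y) = f x - f y"
  using clinear_add[of f "x - y" y] by (simp add: algebra_simps)

lemma lin_comp: "clinear f \<Longrightarrow> clinear g \<Longrightarrow> clinear (\<lambda>x. f (g x))"
  by (rule clinearI) (simp_all add: clinear_add clinear_scaleC)

lemma lin_add [lin]: "clinear f \<Longrightarrow> clinear g \<Longrightarrow> clinear (\<lambda>x. f x + g x)"
  by (rule clinearI) (simp_all add: clinear_add clinear_scaleC scaleC_add_right)

lemma lin_diff [lin]: "clinear f \<Longrightarrow> clinear g \<Longrightarrow> clinear (\<lambda>x. f x - g x)"
  by (rule clinearI)
    (simp_all add: clinear_add clinear_scaleC complex_vector.scale_right_diff_distrib)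

lemma lin_zero [lin]: "clinear (\<lambda>x. 0)"
  by (rule clinearI) simp_all

lemma lin_sum [lin]: "(\<And>i. i \<in> I \<Longrightarrow> clinear (f i)) \<Longrightarrow> clinear (\<lambda>x. \<Sum>i\<in>I. f i x)"
  by (rule clinearI)
    (simp_all add: clinear_add clinear_scaleC sum.distrib complex_vector.scale_sum_right)

lemma lin_scale [lin]: "clinear f \<Longrightarrow> clinear (\<lambda>x. c *\<^sub>C f x)"
  by (rule clinearI) (simp_all add: clinear_add clinear_scaleC scaleC_add_right mult.commute)

lemma lin_scale_left [lin]: "clinear f \<Longrightarrow> clinear (\<lambda>x. f x *\<^sub>C v)"
  by (rule clinearI) (simp_all add: clinear_add clinear_scaleC scaleC_add_left)

lemma lin_mult_left [lin]: "clinear f \<Longrightarrow> clinear (\<lambda>x. f x * (c :: complex))"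
  by (rule clinearI) (simp_all add: clinear_add clinear_scaleC algebra_simps)

lemma lin_mult_right [lin]: "clinear f \<Longrightarrow> clinear (\<lambda>x. (c :: complex) * f x)"
  by (rule clinearI) (simp_all add: clinear_add clinear_scaleC algebra_simps)

lemma lin_tensor_left [lin]: "clinear f \<Longrightarrow> clinear (\<lambda>x. f x \<otimes> b)"
  by (rule lin_comp[OF clinear_tensor_prod_left])

lemma lin_tensor_right [lin]: "clinear f \<Longrightarrow> clinear (\<lambda>x. b \<otimes> f x)"
  by (rule lin_comp[OF clinear_tensor_prod_right])

lemma clinear_dual_apply: "clinear (dual_apply a)"
  using dual_apply by auto

lemma lin_dual_arg [lin]: "clinear f \<Longrightarrow> clinear (\<lambda>x. dual_apply a (f x))"
  by (rule lin_comp[OF clinear_dual_apply])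

lemma lin_dual_fun [lin]: "clinear f \<Longrightarrow> clinear (\<lambda>x. dual_apply (f x) y)"
  by (rule clinearI) (simp_all add: clinear_add clinear_scaleC plus_dual.rep_eq scaleC_dual.rep_eq)

lemma cbilinearI:
  "(\<And>b. clinear (\<lambda>a. \<beta> a b)) \<Longrightarrow> (\<And>a. clinear (\<lambda>b. \<beta> a b)) \<Longrightarrow> cbilinear \<beta>"
  by (simp add: cbilinear_def)

lemma lin_lift [lin]: "cbilinear \<beta> \<Longrightarrow> clinear f \<Longrightarrow> clinear (\<lambda>x. tensor_lift \<beta> (f x))"
  by (rule lin_comp[OF clinear_tensor_lift])

text \<open>Serves slices of a fixed tensor at a varying vector or functional. Linearity is tested
  on pure tensors, since elsewhere \<open>tensor_lift\<close> is computed through a chosen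
  representative.\<close>

lemma lin_lift_param [lin]:
  assumes F: "\<And>x. cbilinear (F x)" and l: "\<And>a b. clinear (\<lambda>x. F x a b)"
  shows "clinear (\<lambda>x. tensor_lift (F x) t)"
proof (rule clinearI)
  fix x y
  show "tensor_lift (F (x + y)) t = tensor_lift (F x) t + tensor_lift (F y) t"
    by (rule clinear_eq_on_tensors[where t = t])
      (intro lin F, intro lin F, simp only: tensor_lift_tensor_prod[OF F],
        rule clinear_add[OF l])
next
  fix c x
  show "tensor_lift (F (c *\<^sub>C x)) t = c *\<^sub>C tensor_lift (F x) t"
    by (rule clinear_eq_on_tensors[where t = t])
      (intro lin F, intro lin F, simp only: tensor_lift_tensor_prod[OF F],
        rule clinear_scaleC[OF l])
qed

lemma bil_tensor [lin]: "clinear f \<Longrightarrow> clinear g \<Longrightarrow> cbilinear (\<lambda>a b. f a \<otimes> g b)"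
  by (intro cbilinearI lin)

lemma clinear_eq_on_tensors2:
  assumes "\<And>s. clinear (\<lambda>t. f s t)" "\<And>s. clinear (\<lambda>t. g s t)"
    and "\<And>t. clinear (\<lambda>s. f s t)" "\<And>t. clinear (\<lambda>s. g s t)"
    and "\<And>a b c d. f (a \<otimes> b) (c \<otimes> d) = g (a \<otimes> b) (c \<otimes> d)"
  shows "f s t = g s t"
proof -
  have "f (a \<otimes> b) t = g (a \<otimes> b) t" for a b
    using assms(1,2,5) by (rule clinear_eq_on_tensors)
  then show ?thesis by (rule clinear_eq_on_tensors[OF assms(3,4)])
qed

lemma tensor_map_prod [simp]:
  "clinear f \<Longrightarrow> clinear g \<Longrightarrow> tensor_map f g (a \<otimes> b) = f a \<otimes> g b"
  unfolding tensor_map_def by (subst tensor_lift_tensor_prod) (auto intro!: lin)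

lemma lin_tensor_map [lin]:
  "clinear f \<Longrightarrow> clinear g \<Longrightarrow> clinear h \<Longrightarrow> clinear (\<lambda>x. tensor_map f g (h x))"
  unfolding tensor_map_def by (intro lin)

lemma tensor_swap_prod [simp]: "tensor_swap (a \<otimes> b) = b \<otimes> a"
  unfolding tensor_swap_def by (subst tensor_lift_tensor_prod) (auto intro!: lin cbilinearI)

lemma lin_tensor_swap [lin]: "clinear h \<Longrightarrow> clinear (\<lambda>x. tensor_swap (h x))"
  unfolding tensor_swap_def by (intro lin cbilinearI)

lemma cbilinear_tensor_assoc:
  "cbilinear (\<lambda>t c. tensor_lift (\<lambda>a b. a \<otimes> (b \<otimes> c)) t)"
  by (intro cbilinearI lin)

lemma lin_tensor_assoc [lin]: "clinear h \<Longrightarrow> clinear (\<lambda>x. tensor_assoc (h x))"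
  unfolding tensor_assoc_def by (intro lin cbilinear_tensor_assoc)

lemma tensor_assoc_prod [simp]: "tensor_assoc ((a \<otimes> b) \<otimes> c) = a \<otimes> (b \<otimes> c)"
  unfolding tensor_assoc_def
  by (simp add: tensor_lift_tensor_prod[OF cbilinear_tensor_assoc])
    (subst tensor_lift_tensor_prod, auto intro!: lin cbilinearI)

lemma lin_cbilinear_left: "cbilinear \<beta> \<Longrightarrow> clinear f \<Longrightarrow> clinear (\<lambda>x. \<beta> (f x) b)"
  using lin_comp[of "\<lambda>a. \<beta> a b" f] by (simp add: cbilinear_def)

lemma lin_cbilinear_right: "cbilinear \<beta> \<Longrightarrow> clinear f \<Longrightarrow> clinear (\<lambda>x. \<beta> a (f x))"
  using lin_comp[of "\<beta> a" f] by (simp add: cbilinear_def)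

context
  fixes m :: "'a::complex_vector \<Rightarrow> 'a \<Rightarrow> 'a" and n :: "'b::complex_vector \<Rightarrow> 'b \<Rightarrow> 'b"
  assumes m: "cbilinear m" and n: "cbilinear n"
begin

lemma tensor_mult_inner: "cbilinear (\<lambda>a' b'. m a a' \<otimes> n b b')"
  by (intro cbilinearI lin lin_cbilinear_right[OF m] lin_cbilinear_right[OF n])

lemma tensor_mult_outer: "cbilinear (\<lambda>a b. tensor_lift (\<lambda>a' b'. m a a' \<otimes> n b b') t)"
  by (intro cbilinearI lin lin_cbilinear_left[OF m] lin_cbilinear_left[OF n] tensor_mult_inner)

lemma cbilinear_tensor_mult: "cbilinear (tensor_mult m n)"
  unfolding tensor_mult_def
  by (intro cbilinearI lin tensor_mult_outer tensor_mult_inner)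

lemma tensor_mult_prod: "tensor_mult m n (a \<otimes> b) (c \<otimes> d) = m a c \<otimes> n b d"
  unfolding tensor_mult_def
  by (subst tensor_lift_tensor_prod[OF tensor_mult_outer])
    (rule tensor_lift_tensor_prod[OF tensor_mult_inner])

end

lemma tensor_lift_comp:
  assumes "cbilinear \<beta>" "clinear f"
  shows "f (tensor_lift \<beta> t) = tensor_lift (\<lambda>a b. f (\<beta> a b)) t"
proof -
  have bil: "cbilinear (\<lambda>a b. f (\<beta> a b))"
    by (intro cbilinearI lin_comp[OF assms(2)] lin_cbilinear_left[OF assms(1)]
        lin_cbilinear_right[OF assms(1)] lin)
  show ?thesis
    by (rule clinear_eq_on_tensors[where t = t])
      (auto intro!: lin assms bil lin_comp[OF assms(2)]
        simp: tensor_lift_tensor_prod[OF bil] tensor_lift_tensor_prod[OF assms(1)])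
qed

text \<open>The functional is the coordinate of \<open>w\<close> in a basis that extends
  \<open>w\<close> together with a basis of \<open>N\<close>; this works in any dimension.\<close>

lemma clinear_separate:
  assumes N: "csubspace N" and w: "w \<notin> N"
  obtains f :: "'v::complex_vector dual"
  where "\<And>n. n \<in> N \<Longrightarrow> dual_apply f n = 0" "dual_apply f w = 1"
proof -
  obtain C where C: "C \<subseteq> N" "\<not> complex_vector.dependent C" "N \<subseteq> cspan C"
    using complex_vector.maximal_independent_subset[of N] by (metis cspan_def)
  have spanC: "cspan C = N"
    using C N complex_vector.span_minimal by (metis subset_antisym cspan_def csubspace_def)
  have ind: "\<not> complex_vector.dependent (insert w C)"
    using C(2) w spanC by (simp add: complex_vector.independent_insertI cspan_def)
  define Y where "Y = complex_vector.extend_basis (insert w C)"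
  have Y: "insert w C \<subseteq> Y" "\<not> complex_vector.dependent Y" "cspan Y = UNIV"
    using complex_vector.extend_basis_superset[OF ind] complex_vector.independent_extend_basis[OF ind]
      complex_vector.span_extend_basis[OF ind] by (auto simp: Y_def cspan_def)
  have lin: "clinear (\<lambda>x. complex_vector.representation Y x w)"
    using Y by (intro clinearI)
      (auto simp: complex_vector.representation_add complex_vector.representation_scale)
  define f where "f = to_dual (\<lambda>x. complex_vector.representation Y x w)"
  have f: "dual_apply f x = complex_vector.representation Y x w" for x
    unfolding f_def using lin by (simp add: to_dual_inverse)
  show ?thesis
  proof
    show "dual_apply f w = 1"
      unfolding f using Y by (simp add: complex_vector.representation_basis)
    fix n assume "n \<in> N"
    then have "n \<in> cspan C" by (simp add: spanC)
    then show "dual_apply f n = 0"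
    proof (induction rule: complex_vector.span_induct)
      case base
      show ?case
        by (rule complex_vector.subspaceI)
          (auto simp: clinear_zero[OF clinear_dual_apply] clinear_add[OF clinear_dual_apply]
            clinear_scaleC[OF clinear_dual_apply])
    next
      case (step x)
      then have "x \<in> Y" "x \<noteq> w" using Y w C(1) by auto
      then show ?case unfolding f using Y by (simp add: complex_vector.representation_basis)
    qed
  qed
qed

lemma dual_eqI: "(\<And>x. dual_apply f x = dual_apply g x) \<Longrightarrow> f = g"
  by (simp add: dual_apply_inject[symmetric] fun_eq_iff)

lemma dual_separates: "(\<And>f. dual_apply f x = dual_apply f y) \<Longrightarrow> x = y"
proof (rule ccontr)
  assume eq: "\<And>f. dual_apply f x = dual_apply f y" and "x \<noteq> y"
  then have "x - y \<notin> {0}" by simp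
  then obtain f where "dual_apply f (x - y) = 1"
    using clinear_separate[of "{0}" "x - y"] complex_vector.subspace_single_0 by metis
  then show False using eq[of f] by (simp add: clinear_diff[OF clinear_dual_apply])
qed

section \<open>The dual Hopf algebra\<close>

lemma ex_dual_basis:
  assumes "\<exists>B :: 'a::complex_vector set. finite_dimensional_vector_space scaleC B"
  obtains B :: "'a::complex_vector set" and c :: "'a \<Rightarrow> 'a dual"
  where "finite B" "\<And>x. x = (\<Sum>b\<in>B. dual_apply (c b) x *\<^sub>C b)"
proof -
  obtain B :: "'a set" where B: "finite_dimensional_vector_space scaleC B"
    using assms ..
  interpret B: finite_dimensional_vector_space scaleC B by fact
  have span: "cspan B = UNIV" using B.span_Basis by (simp add: cspan_def)
  define c where "c b = to_dual (\<lambda>x. complex_vector.representation B x b)" for b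
  have c: "dual_apply (c b) x = complex_vector.representation B x b" for b x
    unfolding c_def
    by (subst to_dual_inverse) (auto intro!: clinearI simp: B.independent_Basis span
        complex_vector.representation_add complex_vector.representation_scale)
  have "x = (\<Sum>b\<in>B. dual_apply (c b) x *\<^sub>C b)" for x
    by (simp add: c complex_vector.sum_representation_eq B.independent_Basis span B.finite_Basis)
  with B.finite_Basis show thesis by (rule that)
qed

locale fd_hopf_algebra = hopf_algebra H for H :: "'a::complex_vector hopf" +
  assumes finite_dim: "\<exists>B :: 'a set. finite_dimensional_vector_space scaleC B"
begin

abbreviation ev :: "'a dual \<Rightarrow> 'a \<Rightarrow> complex"  (infixl \<open>\<bullet>\<close> 80)
  where "f \<bullet> x \<equiv> dual_apply f x"

abbreviation times :: "'a \<Rightarrow> 'a \<Rightarrow> 'a"  (infixl \<open>\<odot>\<close> 76)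
  where "x \<odot> y \<equiv> mult H x y"

abbreviation \<Delta> :: "'a \<Rightarrow> 'a \<otimes> 'a" where "\<Delta> \<equiv> comult H"

definition star :: "'a dual \<Rightarrow> 'a dual \<Rightarrow> 'a dual"  (infixl \<open>\<star>\<close> 75)
  where "f \<star> g = mult (dual_hopf H) f g"

definition one_dual :: "'a dual"  (\<open>\<epsilon>\<close>)
  where "\<epsilon> = unit (dual_hopf H)"

abbreviation \<Delta>' :: "'a dual \<Rightarrow> 'a dual \<otimes> 'a dual" where "\<Delta>' \<equiv> comult (dual_hopf H)"

abbreviation star2 :: "'a dual \<otimes> 'a dual \<Rightarrow> 'a dual \<otimes> 'a dual \<Rightarrow> 'a dual \<otimes> 'a dual"
    (infixl \<open>\<star>\<star>\<close> 75)
  where "S \<star>\<star> T \<equiv> tensor_mult star star S T"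

lemma mult_dual_hopf: "mult (dual_hopf H) = star"
  by (simp add: star_def fun_eq_iff)

lemma lin_ev2: "cbilinear (\<lambda>a b. f \<bullet> a * g \<bullet> b)"
  by (intro cbilinearI lin)

lemma lin_\<Delta> [lin]: "clinear f \<Longrightarrow> clinear (\<lambda>x. \<Delta> (f x))"
  by (rule lin_comp[OF comult_linear])

lemma lin_times_left [lin]: "clinear f \<Longrightarrow> clinear (\<lambda>x. f x \<odot> y)"
  by (rule lin_cbilinear_left[OF mult_bilinear])

lemma lin_times_right [lin]: "clinear f \<Longrightarrow> clinear (\<lambda>x. y \<odot> f x)"
  by (rule lin_cbilinear_right[OF mult_bilinear])

lemma star_apply: "(f \<star> g) \<bullet> x = tensor_lift (\<lambda>a b. f \<bullet> a * g \<bullet> b) (\<Delta> x)"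
  unfolding star_def dual_hopf_def
  by (simp, subst to_dual_inverse) (auto intro!: lin lin_ev2)

lemma one_apply [simp]: "\<epsilon> \<bullet> x = counit H x"
  unfolding one_dual_def dual_hopf_def by (simp add: to_dual_inverse counit_linear)

lemma cbilinear_star: "cbilinear star"
proof (rule cbilinearI)
  show "clinear (\<lambda>f. f \<star> g)" for g
  proof -
    have l: "clinear (\<lambda>f. tensor_lift (\<lambda>a b. f \<bullet> a * g \<bullet> b) (\<Delta> x))" for x
      by (intro lin cbilinearI)
    show ?thesis
      by (rule clinearI; rule dual_eqI)
        (simp_all only: star_apply plus_dual.rep_eq[of "_ \<star> _"] scaleC_dual.rep_eq[of _ "_ \<star> _"]
          clinear_add[OF l] clinear_scaleC[OF l] scaleC_complex_def)
  qed
  show "clinear (\<lambda>g. f \<star> g)" for f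
  proof -
    have l: "clinear (\<lambda>g. tensor_lift (\<lambda>a b. f \<bullet> a * g \<bullet> b) (\<Delta> x))" for x
      by (intro lin cbilinearI)
    show ?thesis
      by (rule clinearI; rule dual_eqI)
        (simp_all only: star_apply plus_dual.rep_eq[of "_ \<star> _"] scaleC_dual.rep_eq[of _ "_ \<star> _"]
          clinear_add[OF l] clinear_scaleC[OF l] scaleC_complex_def)
  qed
qed

lemma lin_star_left [lin]: "clinear h \<Longrightarrow> clinear (\<lambda>x. h x \<star> g)"
  by (rule lin_cbilinear_left[OF cbilinear_star])

lemma lin_star_right [lin]: "clinear h \<Longrightarrow> clinear (\<lambda>x. g \<star> h x)"
  by (rule lin_cbilinear_right[OF cbilinear_star])

lemmas star_add_left = clinear_add[OF lin_star_left[OF lin_id]]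
  and star_add_right = clinear_add[OF lin_star_right[OF lin_id]]
  and star_diff_left = clinear_diff[OF lin_star_left[OF lin_id]]
  and star_diff_right = clinear_diff[OF lin_star_right[OF lin_id]]
  and star_scale_left = clinear_scaleC[OF lin_star_left[OF lin_id]]
  and star_scale_right = clinear_scaleC[OF lin_star_right[OF lin_id]]
  and star_sum_left = clinear_sum[OF lin_star_left[OF lin_id]]
  and star_sum_right = clinear_sum[OF lin_star_right[OF lin_id]]
  and star_zero_left = clinear_zero[OF lin_star_left[OF lin_id]]
  and star_zero_right = clinear_zero[OF lin_star_right[OF lin_id]]

lemmas star_linear = star_add_left star_add_right star_diff_left star_diff_right
  star_scale_left star_scale_right star_zero_left star_zero_right

text \<open>Dual to coassociativity: both products evaluate the same trilinear form \<open>F\<close>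
  on the two bracketings of the iterated coproduct.\<close>

lemma star_assoc: "(f \<star> g) \<star> h = f \<star> (g \<star> h)"
proof (rule dual_eqI)
  fix x
  define F where "F = tensor_lift (\<lambda>a t. f \<bullet> a * tensor_lift (\<lambda>b c. g \<bullet> b * h \<bullet> c) t)"
  have bil: "cbilinear (\<lambda>a t. f \<bullet> a * tensor_lift (\<lambda>b c. g \<bullet> b * h \<bullet> c) t)"
    by (intro cbilinearI lin)
  have linF [lin]: "clinear k \<Longrightarrow> clinear (\<lambda>x. F (k x))" for k :: "'z::complex_vector \<Rightarrow> _"
    unfolding F_def by (intro lin bil)
  have F: "F (a \<otimes> t) = f \<bullet> a * tensor_lift (\<lambda>b c. g \<bullet> b * h \<bullet> c) t" for a t
    unfolding F_def by (rule tensor_lift_tensor_prod[OF bil])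
  have F3: "F (a \<otimes> (b \<otimes> c)) = f \<bullet> a * g \<bullet> b * h \<bullet> c" for a b c
    by (simp add: F tensor_lift_tensor_prod[OF lin_ev2])
  have "F (tensor_assoc (t \<otimes> b)) = tensor_lift (\<lambda>a b. f \<bullet> a * g \<bullet> b) t * h \<bullet> b" for t b
    by (rule clinear_eq_on_tensors[where t = t])
      (auto intro!: lin lin_ev2 simp: F3 tensor_lift_tensor_prod[OF lin_ev2])
  then have L: "F (tensor_assoc (\<Delta> a \<otimes> b)) = (f \<star> g) \<bullet> a * h \<bullet> b" for a b
    by (simp add: star_apply)
  have R: "F (a \<otimes> \<Delta> b) = f \<bullet> a * (g \<star> h) \<bullet> b" for a b
    by (simp add: F star_apply)
  have "((f \<star> g) \<star> h) \<bullet> x = F (tensor_assoc (tensor_map \<Delta> id (\<Delta> x)))"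
    unfolding star_apply[of "f \<star> g"]
    by (rule clinear_eq_on_tensors[where t = "\<Delta> x"])
      (auto intro!: lin lin_ev2 comult_linear simp: id_def L comult_linear lin_id tensor_lift_tensor_prod[OF lin_ev2])
  also have "\<dots> = F (tensor_map id \<Delta> (\<Delta> x))" by (simp add: coassoc)
  also have "\<dots> = (f \<star> (g \<star> h)) \<bullet> x"
    unfolding star_apply[of f]
    by (rule clinear_eq_on_tensors[where t = "\<Delta> x"])
      (auto intro!: lin lin_ev2 comult_linear
        simp: id_def R comult_linear lin_id tensor_lift_tensor_prod[OF lin_ev2])
  finally show "((f \<star> g) \<star> h) \<bullet> x = (f \<star> (g \<star> h)) \<bullet> x" .
qed

lemma one_star [simp]: "\<epsilon> \<star> f = f"
proof (rule dual_eqI)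
  fix x
  have "tensor_lift (\<lambda>a b. \<epsilon> \<bullet> a * f \<bullet> b) t = f \<bullet> tensor_lift (\<lambda>a b. counit H a *\<^sub>C b) t" for t
    by (subst tensor_lift_comp)
      (auto intro!: cbilinearI lin counit_linear simp: clinear_scaleC[OF clinear_dual_apply])
  then show "(\<epsilon> \<star> f) \<bullet> x = f \<bullet> x"
    unfolding star_apply by (simp only: counit_left)
qed

lemma star_one [simp]: "f \<star> \<epsilon> = f"
proof (rule dual_eqI)
  fix x
  have "tensor_lift (\<lambda>a b. f \<bullet> a * \<epsilon> \<bullet> b) t = f \<bullet> tensor_lift (\<lambda>a b. counit H b *\<^sub>C a) t" for t
    by (subst tensor_lift_comp)
      (auto intro!: cbilinearI lin counit_linear
        simp: clinear_scaleC[OF clinear_dual_apply] mult.commute)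
  then show "(f \<star> \<epsilon>) \<bullet> x = f \<bullet> x"
    unfolding star_apply by (simp only: counit_right)
qed

subsection \<open>Finite-dimensionality\<close>

lemma ex_dual_expansion:
  obtains B :: "'a set" and c where "finite B" "\<And>a. a = (\<Sum>b\<in>B. a \<bullet> b *\<^sub>C c b)"
proof -
  obtain B :: "'a set" and c where B: "finite B" "\<And>x. x = (\<Sum>b\<in>B. c b \<bullet> x *\<^sub>C b)"
    using ex_dual_basis[OF finite_dim] by blast
  have "a = (\<Sum>b\<in>B. a \<bullet> b *\<^sub>C c b)" for a
  proof (rule dual_eqI)
    fix x
    have "a \<bullet> x = a \<bullet> (\<Sum>b\<in>B. c b \<bullet> x *\<^sub>C b)" by (rule arg_cong[OF B(2)])
    also have "\<dots> = (\<Sum>b\<in>B. a \<bullet> b *\<^sub>C c b) \<bullet> x"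
      by (simp add: clinear_sum[OF clinear_dual_apply] clinear_scaleC[OF clinear_dual_apply]
          dual_apply_sum scaleC_dual.rep_eq mult.commute)
    finally show "a \<bullet> x = (\<Sum>b\<in>B. a \<bullet> b *\<^sub>C c b) \<bullet> x" .
  qed
  with B(1) show thesis by (rule that)
qed

lemma represent_functional:
  assumes "clinear \<phi>"
  obtains x where "\<And>a. a \<bullet> x = \<phi> a"
proof -
  obtain B :: "'a set" and c where "\<And>a. a = (\<Sum>b\<in>B. a \<bullet> b *\<^sub>C c b)"
    using ex_dual_expansion by blast
  then have \<phi>: "\<phi> a = \<phi> (\<Sum>b\<in>B. a \<bullet> b *\<^sub>C c b)" for a by (rule arg_cong)
  have "a \<bullet> (\<Sum>b\<in>B. \<phi> (c b) *\<^sub>C b) = \<phi> a" for a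
    by (subst \<phi>) (simp add: clinear_sum[OF assms] clinear_scaleC[OF assms]
        clinear_sum[OF clinear_dual_apply] clinear_scaleC[OF clinear_dual_apply] mult.commute)
  then show thesis by (rule that)
qed

text \<open>Finite dimension enters here: a functional on the dual that separates \<open>w\<close>
  from \<open>N\<close> is evaluation at a vector of \<open>H\<close>.\<close>

lemma double_annihilator:
  assumes "csubspace N" "\<And>x. (\<And>n. n \<in> N \<Longrightarrow> n \<bullet> x = 0) \<Longrightarrow> w \<bullet> x = 0"
  shows "w \<in> N"
proof (rule ccontr)
  assume "w \<notin> N"
  then obtain \<phi> where \<phi>: "\<And>n. n \<in> N \<Longrightarrow> dual_apply \<phi> n = 0" "dual_apply \<phi> w = 1"
    using clinear_separate[OF assms(1)] by blast
  obtain x where "\<And>a. a \<bullet> x = dual_apply \<phi> a"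
    using represent_functional[OF clinear_dual_apply] by blast
  with assms(2)[of x] \<phi> show False by simp
qed

definition slice :: "'a dual \<Rightarrow> 'v::complex_vector \<otimes> 'a \<Rightarrow> 'v"
  where "slice a = tensor_lift (\<lambda>v x. (a \<bullet> x) *\<^sub>C v)"

lemma slice_bil: "cbilinear (\<lambda>v x. (a \<bullet> x) *\<^sub>C v)"
  by (intro cbilinearI lin)

lemma slice_prod [simp]: "slice a (v \<otimes> x) = (a \<bullet> x) *\<^sub>C v"
  unfolding slice_def by (rule tensor_lift_tensor_prod[OF slice_bil])

lemma lin_slice [lin]: "clinear f \<Longrightarrow> clinear (\<lambda>x. slice a (f x))"
  unfolding slice_def by (intro lin slice_bil)

lemma lin_slice_fun [lin]: "clinear f \<Longrightarrow> clinear (\<lambda>x. slice (f x) t)"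
  unfolding slice_def by (intro lin slice_bil)

lemma tensor_eq_sum_slices:
  obtains B :: "'a set" and c
  where "finite B" "\<And>t :: 'v::complex_vector \<otimes> 'a. t = (\<Sum>b\<in>B. slice (c b) t \<otimes> b)"
proof -
  obtain B :: "'a set" and c where B: "finite B" "\<And>x. x = (\<Sum>b\<in>B. c b \<bullet> x *\<^sub>C b)"
    using ex_dual_basis[OF finite_dim] by blast
  have "t = (\<Sum>b\<in>B. slice (c b) t \<otimes> b)" for t :: "'v \<otimes> 'a"
  proof (rule clinear_eq_on_tensors[where t = t])
    fix v :: 'v and x :: 'a
    have "v \<otimes> x = v \<otimes> (\<Sum>b\<in>B. c b \<bullet> x *\<^sub>C b)" by (rule arg_cong[OF B(2)])
    also have "\<dots> = (\<Sum>b\<in>B. slice (c b) (v \<otimes> x) \<otimes> b)"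
      by (simp add: clinear_sum[OF clinear_tensor_prod_right]
          clinear_scaleC[OF clinear_tensor_prod_right] clinear_scaleC[OF clinear_tensor_prod_left])
    finally show "v \<otimes> x = (\<Sum>b\<in>B. slice (c b) (v \<otimes> x) \<otimes> b)" .
  qed (intro lin)+
  with B(1) show thesis by (rule that)
qed

lemma tensor_eqI:
  fixes s t :: "'v::complex_vector \<otimes> 'a"
  assumes "\<And>a. slice a s = slice a t"
  shows "s = t"
proof -
  obtain B :: "'a set" and c where B: "\<And>t :: 'v \<otimes> 'a. t = (\<Sum>b\<in>B. slice (c b) t \<otimes> b)"
    using tensor_eq_sum_slices by blast
  show ?thesis by (subst B[of s], subst B[of t]) (simp add: assms)
qed

text \<open>Grouplike and skew primitive elements are found later as vectors representing
  functionals on the dual. Their coproducts are then read off from the behaviour of these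
  functionals on products.\<close>

lemma comult_eqI:
  assumes "\<And>a b. (a \<star> b) \<bullet> x = tensor_lift (\<lambda>u v. a \<bullet> u * b \<bullet> v) t"
  shows "\<Delta> x = t"
proof (rule tensor_eqI, rule dual_separates)
  fix a b
  have "tensor_lift (\<lambda>u v. a \<bullet> u * b \<bullet> v) s = a \<bullet> slice b s" for s
    unfolding slice_def
    by (subst tensor_lift_comp)
      (auto intro!: slice_bil clinear_dual_apply
        simp: clinear_scaleC[OF clinear_dual_apply] mult.commute)
  then show "a \<bullet> slice b (\<Delta> x) = a \<bullet> slice b t"
    using assms[of a b] by (simp add: star_apply)
qed

subsection \<open>Slices of tensors over the dual\<close>

definition sl1 :: "'a \<Rightarrow> 'a dual \<otimes> 'a dual \<Rightarrow> 'a dual"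
  where "sl1 x = tensor_lift (\<lambda>f g. (f \<bullet> x) *\<^sub>C g)"

definition sl2 :: "'a \<Rightarrow> 'a dual \<otimes> 'a dual \<Rightarrow> 'a dual"
  where "sl2 x = tensor_lift (\<lambda>f g. (g \<bullet> x) *\<^sub>C f)"

lemma sl_bil: "cbilinear (\<lambda>f g. (f \<bullet> x) *\<^sub>C (g :: 'a dual))"
    "cbilinear (\<lambda>f g. (g \<bullet> x) *\<^sub>C (f :: 'a dual))"
  by (intro cbilinearI lin)+

lemma sl1_prod [simp]: "sl1 x (f \<otimes> g) = (f \<bullet> x) *\<^sub>C g"
  unfolding sl1_def by (rule tensor_lift_tensor_prod[OF sl_bil(1)])

lemma sl2_prod [simp]: "sl2 x (f \<otimes> g) = (g \<bullet> x) *\<^sub>C f"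
  unfolding sl2_def by (rule tensor_lift_tensor_prod[OF sl_bil(2)])

lemma lin_sl1 [lin]: "clinear h \<Longrightarrow> clinear (\<lambda>z. sl1 x (h z))"
  unfolding sl1_def by (intro lin sl_bil)

lemma lin_sl1_arg [lin]: "clinear h \<Longrightarrow> clinear (\<lambda>z. sl1 (h z) t)"
  unfolding sl1_def by (intro lin sl_bil)

lemma lin_sl2 [lin]: "clinear h \<Longrightarrow> clinear (\<lambda>z. sl2 x (h z))"
  unfolding sl2_def by (intro lin sl_bil)

lemma lin_star2_left [lin]: "clinear h \<Longrightarrow> clinear (\<lambda>z. h z \<star>\<star> T)"
  by (rule lin_cbilinear_left[OF cbilinear_tensor_mult[OF cbilinear_star cbilinear_star]])

lemma lin_star2_right [lin]: "clinear h \<Longrightarrow> clinear (\<lambda>z. S \<star>\<star> h z)"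
  by (rule lin_cbilinear_right[OF cbilinear_tensor_mult[OF cbilinear_star cbilinear_star]])

lemma star2_prod [simp]: "(a \<otimes> b) \<star>\<star> (c \<otimes> d) = (a \<star> c) \<otimes> (b \<star> d)"
  by (rule tensor_mult_prod[OF cbilinear_star cbilinear_star])

lemmas star2_add_left = clinear_add[OF lin_star2_left[OF lin_id]]
  and star2_add_right = clinear_add[OF lin_star2_right[OF lin_id]]
  and star2_diff_left = clinear_diff[OF lin_star2_left[OF lin_id]]
  and star2_diff_right = clinear_diff[OF lin_star2_right[OF lin_id]]
  and star2_scale_left = clinear_scaleC[OF lin_star2_left[OF lin_id]]
  and star2_scale_right = clinear_scaleC[OF lin_star2_right[OF lin_id]]

lemma pairing_sl: "dual_pairing2 t x y = sl1 x t \<bullet> y" "dual_pairing2 t x y = sl2 y t \<bullet> x"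
proof -
  have bil: "cbilinear (\<lambda>f g. f \<bullet> x * g \<bullet> y)" by (intro cbilinearI lin)
  show "dual_pairing2 t x y = sl1 x t \<bullet> y"
    unfolding dual_pairing2_def
    by (rule clinear_eq_on_tensors[where t = t])
      (auto intro!: lin bil simp: tensor_lift_tensor_prod[OF bil] scaleC_dual.rep_eq)
  show "dual_pairing2 t x y = sl2 y t \<bullet> x"
    unfolding dual_pairing2_def
    by (rule clinear_eq_on_tensors[where t = t])
      (auto intro!: lin bil simp: tensor_lift_tensor_prod[OF bil] scaleC_dual.rep_eq)
qed

lemma sl1_sl2: "sl1 x t \<bullet> y = sl2 y t \<bullet> x"
  using pairing_sl by metis

lemma sl1_eqI: "(\<And>x. sl1 x s = sl1 x t) \<Longrightarrow> s = t"
proof -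
  assume eq: "\<And>x. sl1 x s = sl1 x t"
  obtain B :: "'a set" where B: "finite_dimensional_vector_space scaleC B"
    using finite_dim ..
  have "cbilinear (\<lambda>x y. dual_pairing2 t x y)"
    unfolding pairing_sl(1) by (intro cbilinearI lin)
  then have "\<exists>!u. \<forall>x y. dual_pairing2 u x y = dual_pairing2 t x y"
    by (rule dual_pairing2_ex1[OF B B])
  moreover have "dual_pairing2 s x y = dual_pairing2 t x y" for x y
    by (simp add: pairing_sl eq)
  ultimately show ?thesis by blast
qed

lemma sl1_comult_dual [simp]: "sl1 x (\<Delta>' f) \<bullet> y = f \<bullet> (x \<odot> y)"
proof -
  obtain B :: "'a set" where B: "finite_dimensional_vector_space scaleC B"
    using finite_dim ..
  have "cbilinear (\<lambda>x y. f \<bullet> (x \<odot> y))"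
    by (intro cbilinearI lin)
  from theI'[OF dual_pairing2_ex1[OF B B this]]
  have "dual_pairing2 (\<Delta>' f) x y = f \<bullet> (x \<odot> y)"
    by (simp add: dual_hopf_def)
  then show ?thesis by (simp add: pairing_sl)
qed

lemma sl2_comult_dual [simp]: "sl2 y (\<Delta>' f) \<bullet> x = f \<bullet> (x \<odot> y)"
  by (simp add: sl1_sl2[symmetric])

lemma clinear_\<Delta>': "clinear \<Delta>'"
proof (rule clinearI)
  show "\<Delta>' (f + g) = \<Delta>' f + \<Delta>' g" for f g
    by (rule sl1_eqI, rule dual_eqI)
      (simp add: clinear_add[OF lin_sl1[OF lin_id]] plus_dual.rep_eq)
  show "\<Delta>' (c *\<^sub>C f) = c *\<^sub>C \<Delta>' f" for c f
    by (rule sl1_eqI, rule dual_eqI)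
      (simp add: clinear_scaleC[OF lin_sl1[OF lin_id]] scaleC_dual.rep_eq)
qed

lemma lin_\<Delta>' [lin]: "clinear h \<Longrightarrow> clinear (\<lambda>z. \<Delta>' (h z))"
  by (rule lin_comp[OF clinear_\<Delta>'])

text \<open>The first legs are multiplied in the dual, so evaluating them at \<open>x\<close> splits
  \<open>x\<close> by its coproduct. Hence slicing at a grouplike element is an algebra map, and
  slicing at a skew primitive one obeys a twisted Leibniz rule.\<close>

lemma sl1_star2: "sl1 x (S \<star>\<star> T) = tensor_lift (\<lambda>u v. sl1 u S \<star> sl1 v T) (\<Delta> x)"
proof -
  have bil [lin]: "cbilinear (\<lambda>u v. sl1 u S \<star> sl1 v T)" for S T
    by (intro cbilinearI lin)
  show ?thesis
  proof (rule clinear_eq_on_tensors2[where s = S and t = T])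
    fix a b c d
    have "tensor_lift (\<lambda>u v. sl1 u (a \<otimes> b) \<star> sl1 v (c \<otimes> d)) t =
        tensor_lift (\<lambda>u v. a \<bullet> u * c \<bullet> v) t *\<^sub>C (b \<star> d)" for t
      by (rule clinear_eq_on_tensors[where t = t])
        (auto intro!: lin lin_ev2 cbilinearI simp: tensor_lift_tensor_prod cbilinear_def lin
          star_linear scaleC_scaleC mult.commute)
    then show "sl1 x ((a \<otimes> b) \<star>\<star> (c \<otimes> d)) =
        tensor_lift (\<lambda>u v. sl1 u (a \<otimes> b) \<star> sl1 v (c \<otimes> d)) (\<Delta> x)"
      by (simp add: star_apply)
  qed (intro lin)+
qed

lemma comult_dual_star: "\<Delta>' (f \<star> g) = \<Delta>' f \<star>\<star> \<Delta>' g"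
proof (rule sl1_eqI, rule dual_eqI)
  fix x y
  have bil [lin]: "cbilinear (\<lambda>u v. sl1 u S \<star> sl1 v T)" for S T
    by (intro cbilinearI lin)
  have lin_m2 [lin]: "clinear h \<Longrightarrow> clinear (\<lambda>z. mult2 H (h z) t)"
      "clinear h \<Longrightarrow> clinear (\<lambda>z. mult2 H t (h z))" for t and h :: "'z::complex_vector \<Rightarrow> _"
    by (rule lin_cbilinear_left[OF cbilinear_tensor_mult[OF mult_bilinear mult_bilinear]],
        assumption)
      (rule lin_cbilinear_right[OF cbilinear_tensor_mult[OF mult_bilinear mult_bilinear]])
  have "tensor_lift (\<lambda>u v. sl1 u (\<Delta>' f) \<star> sl1 v (\<Delta>' g)) s \<bullet> y =
      tensor_lift (\<lambda>a b. f \<bullet> a * g \<bullet> b) (mult2 H s (\<Delta> y))" for s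
  proof (rule clinear_eq_on_tensors[where t = s])
    fix u v
    have "tensor_lift (\<lambda>a b. sl1 u (\<Delta>' f) \<bullet> a * sl1 v (\<Delta>' g) \<bullet> b) t =
        tensor_lift (\<lambda>a b. f \<bullet> a * g \<bullet> b) (mult2 H (u \<otimes> v) t)" for t
      by (rule clinear_eq_on_tensors[where t = t])
        (auto intro!: lin lin_ev2 simp: tensor_lift_tensor_prod cbilinear_def lin
          tensor_mult_prod[OF mult_bilinear mult_bilinear])
    then show "tensor_lift (\<lambda>u v. sl1 u (\<Delta>' f) \<star> sl1 v (\<Delta>' g)) (u \<otimes> v) \<bullet> y =
        tensor_lift (\<lambda>a b. f \<bullet> a * g \<bullet> b) (mult2 H (u \<otimes> v) (\<Delta> y))"
      by (simp add: tensor_lift_tensor_prod[OF bil] star_apply)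
  qed (intro lin lin_ev2)+
  then show "sl1 x (\<Delta>' (f \<star> g)) \<bullet> y = sl1 x (\<Delta>' f \<star>\<star> \<Delta>' g) \<bullet> y"
    by (simp add: star_apply sl1_star2 comult_mult)
qed

end

lemma clinear_span_mem:
  assumes "clinear f" "csubspace V" "\<And>x. x \<in> S \<Longrightarrow> f x \<in> V" "x \<in> cspan S"
  shows "f x \<in> V"
  using assms(4)
proof (induction rule: complex_vector.span_induct)
  case base
  show ?case
    by (rule complex_vector.subspaceI)
      (auto simp: clinear_zero[OF assms(1)] clinear_add[OF assms(1)] clinear_scaleC[OF assms(1)]
        complex_vector.subspace_0[OF assms(2)] complex_vector.subspace_add[OF assms(2)]
        complex_vector.subspace_scale[OF assms(2)])
qed (use assms(3) in auto)

text \<open>A functional vanishing on \<open>V\<close> but not at \<open>f t\<close> would be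
  nonzero on the span of the pure tensors while vanishing on each of them.\<close>

lemma clinear_mem_on_tensors:
  assumes "clinear f" "csubspace V" "\<And>a b. f (a \<otimes> b) \<in> V"
  shows "f t \<in> V"
proof (rule ccontr)
  assume "f t \<notin> V"
  then obtain \<phi> where \<phi>: "\<And>v. v \<in> V \<Longrightarrow> dual_apply \<phi> v = 0" "dual_apply \<phi> (f t) = 1"
    using clinear_separate[OF assms(2)] by blast
  have "dual_apply \<phi> (f t) = 0"
    by (rule clinear_eq_on_tensors[where t = t])
      (auto intro!: lin assms(1) lin_comp[OF clinear_dual_apply] simp: \<phi> assms(3))
  with \<phi>(2) show False by simp
qed

context fd_hopf_algebra
begin

section \<open>Grouplike elements and their annihilator\<close>

definition G :: "'a set" where "G = {g. grouplike H g}"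

lemma \<Delta>_G: "g \<in> G \<Longrightarrow> \<Delta> g = g \<otimes> g"
  by (simp add: G_def grouplike_def)

lemma star_G: "g \<in> G \<Longrightarrow> (a \<star> b) \<bullet> g = a \<bullet> g * b \<bullet> g"
  by (simp add: star_apply \<Delta>_G tensor_lift_tensor_prod[OF lin_ev2])

lemma counit_G: "g \<in> G \<Longrightarrow> counit H g = 1"
proof -
  assume g: "g \<in> G"
  have "tensor_lift (\<lambda>a b. counit H a *\<^sub>C b) (g \<otimes> g) = g"
    using counit_left[of g] \<Delta>_G[OF g] by simp
  then have "counit H g *\<^sub>C g = g"
    by (subst (asm) tensor_lift_tensor_prod) (auto intro!: cbilinearI lin counit_linear)
  then have "(counit H g - 1) *\<^sub>C g = 0"
    by (simp add: complex_vector.scale_left_diff_distrib)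
  then show ?thesis using g by (simp add: G_def grouplike_def)
qed

lemma times_G: "g \<in> G \<Longrightarrow> h \<in> G \<Longrightarrow> g \<odot> h \<in> G"
proof -
  assume gh: "g \<in> G" "h \<in> G"
  have "counit H (g \<odot> h) = 1" using gh by (simp add: counit_mult counit_G)
  then have "g \<odot> h \<noteq> 0" using clinear_zero[OF counit_linear] by auto
  then show ?thesis
    using gh by (simp add: G_def grouplike_def comult_mult
        tensor_mult_prod[OF mult_bilinear mult_bilinear])
qed

lemma unit_G: "unit H \<in> G"
  using counit_unit clinear_zero[OF counit_linear] by (auto simp: G_def grouplike_def comult_unit)

text \<open>Evaluation at a grouplike element is multiplicative, so functionals that separate
  \<open>g\<close> from one element at a time can be multiplied, as in Lagrange
  interpolation.\<close>

lemma separating_functional: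
  assumes "finite F" "F \<subseteq> G" "g \<in> G" "g \<notin> F"
  shows "\<exists>a. a \<bullet> g = 1 \<and> (\<forall>h\<in>F. a \<bullet> h = 0)"
  using assms
proof (induction F)
  case empty
  then show ?case by (intro exI[of _ \<epsilon>]) (simp add: counit_G)
next
  case (insert h F)
  then obtain a where a: "a \<bullet> g = 1" "\<forall>k\<in>F. a \<bullet> k = 0" by auto
  obtain f where f: "f \<bullet> g \<noteq> f \<bullet> h" using insert.prems dual_separates[of g h] by auto
  define b where "b = (1 / (f \<bullet> g - f \<bullet> h)) *\<^sub>C (f - (f \<bullet> h) *\<^sub>C \<epsilon>)"
  have "b \<bullet> g = 1" "b \<bullet> h = 0"
    using f insert.prems by (auto simp: b_def scaleC_dual.rep_eq minus_dual.rep_eq counit_G)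
  with a insert.prems have "(a \<star> b) \<bullet> g = 1 \<and> (\<forall>k\<in>insert h F. (a \<star> b) \<bullet> k = 0)"
    by (auto simp: star_G subset_iff)
  then show ?case ..
qed

lemma finite_G: "finite G"
proof -
  obtain B :: "'a set" and c where B: "finite B" "\<And>x. x = (\<Sum>b\<in>B. c b \<bullet> x *\<^sub>C b)"
    using ex_dual_basis[OF finite_dim] by blast
  have "x \<in> cspan B" for x
    by (subst B(2)) (intro complex_vector.span_sum complex_vector.span_scale complex_vector.span_base)
  then have span: "G \<subseteq> cspan B" by blast
  have "\<not> complex_vector.dependent G"
    unfolding complex_vector.independent_explicit_finite_subsets
  proof (intro allI impI ballI)
    fix S u g assume S: "S \<subseteq> G" "finite S" "(\<Sum>v\<in>S. u v *\<^sub>C v) = 0" "g \<in> S"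
    then obtain a where a: "a \<bullet> g = 1" "\<forall>h\<in>S - {g}. a \<bullet> h = 0"
      using separating_functional[of "S - {g}" g] by blast
    have "0 = a \<bullet> (\<Sum>v\<in>S. u v *\<^sub>C v)" by (simp add: S clinear_zero[OF clinear_dual_apply])
    also have "\<dots> = (\<Sum>v\<in>S. u v * a \<bullet> v)"
      by (simp add: clinear_sum[OF clinear_dual_apply] clinear_scaleC[OF clinear_dual_apply])
    also have "\<dots> = (\<Sum>v\<in>{g}. u v * a \<bullet> v)"
      using S a by (intro sum.mono_neutral_right) auto
    finally show "u g = 0" using a by simp
  qed
  with B(1) span show ?thesis using complex_vector.independent_span_bound by blast
qed

text \<open>Lifts to the dual the primitive idempotents of its quotient by \<open>J\<close>, the
  algebra of functions on \<open>G\<close>. The lift is arbitrary, so the idempotent relations hold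
  only modulo \<open>J\<close>.\<close>

definition e :: "'a \<Rightarrow> 'a dual"
  where "e g = (SOME a. \<forall>h\<in>G. a \<bullet> h = (if h = g then 1 else 0))"

lemma e_apply [simp]: "g \<in> G \<Longrightarrow> h \<in> G \<Longrightarrow> e g \<bullet> h = (if h = g then 1 else 0)"
proof -
  assume g: "g \<in> G"
  then obtain a where "a \<bullet> g = 1" "\<forall>h\<in>G - {g}. a \<bullet> h = 0"
    using separating_functional[of "G - {g}" g] finite_G by auto
  then have "\<exists>a. \<forall>h\<in>G. a \<bullet> h = (if h = g then 1 else 0)" by auto
  then have "\<forall>h\<in>G. e g \<bullet> h = (if h = g then 1 else 0)"
    unfolding e_def by (rule someI_ex)
  then show "h \<in> G \<Longrightarrow> e g \<bullet> h = (if h = g then 1 else 0)" by blast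
qed

definition J :: "'a dual set" where "J = {a. \<forall>g\<in>G. a \<bullet> g = 0}"

primrec Jp :: "nat \<Rightarrow> 'a dual set"
  where "Jp 0 = UNIV"
  | "Jp (Suc n) = cspan {a \<star> b | a b. a \<in> J \<and> b \<in> Jp n}"

lemma subspace_Jp: "csubspace (Jp n)"
  by (cases n) (simp_all add: complex_vector.subspace_UNIV complex_vector.subspace_span)

lemma Jp_SucI: "a \<in> J \<Longrightarrow> b \<in> Jp n \<Longrightarrow> a \<star> b \<in> Jp (Suc n)"
  by (auto intro!: complex_vector.span_base)

lemmas Jp_0 [simp] = complex_vector.subspace_0[OF subspace_Jp]
  and Jp_add = complex_vector.subspace_add[OF subspace_Jp]
  and Jp_diff = complex_vector.subspace_diff[OF subspace_Jp]
  and Jp_scale = complex_vector.subspace_scale[OF subspace_Jp]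
  and Jp_sum = complex_vector.subspace_sum[OF subspace_Jp]

lemma subspace_J: "csubspace J"
  by (rule complex_vector.subspaceI)
    (auto simp: J_def plus_dual.rep_eq scaleC_dual.rep_eq zero_dual.rep_eq)

lemma J_star_left: "a \<in> J \<Longrightarrow> a \<star> b \<in> J" and J_star_right: "b \<in> J \<Longrightarrow> a \<star> b \<in> J"
  by (simp_all add: J_def star_G)

lemma Jp_1: "Jp (Suc 0) = J"
proof
  show "Jp (Suc 0) \<subseteq> J"
    unfolding Jp.simps by (rule complex_vector.span_minimal[OF _ subspace_J]) (auto intro: J_star_left)
  show "J \<subseteq> Jp (Suc 0)"
    using Jp_SucI[of _ \<epsilon> 0] by auto
qed

lemma Jp_Suc_mem:
  assumes "clinear f" "csubspace V" "\<And>c d. c \<in> J \<Longrightarrow> d \<in> Jp n \<Longrightarrow> f (c \<star> d) \<in> V"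
    and "a \<in> Jp (Suc n)"
  shows "f a \<in> V"
  using assms(4) unfolding Jp.simps
  by (rule clinear_span_mem[OF assms(1,2), rotated]) (use assms(3) in auto)

declare Jp.simps(2) [simp del]

lemma Jp_star_left: "b \<in> Jp n \<Longrightarrow> a \<star> b \<in> Jp n"
proof (cases n)
  case (Suc m)
  assume "b \<in> Jp n"
  then show ?thesis unfolding Suc
    by (rule Jp_Suc_mem[where f = "\<lambda>b. a \<star> b", rotated -1])
      (auto intro!: lin subspace_Jp Jp_SucI J_star_right simp: star_assoc[symmetric])
qed simp

lemma Jp_star: "a \<in> Jp m \<Longrightarrow> b \<in> Jp n \<Longrightarrow> a \<star> b \<in> Jp (m + n)"
proof (induction m arbitrary: a)
  case 0
  then show ?case by (simp add: Jp_star_left)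
next
  case (Suc m)
  show ?case unfolding add_Suc
    by (rule Jp_Suc_mem[where f = "\<lambda>a. a \<star> b", OF _ _ _ Suc.prems(1)])
      (auto intro!: lin subspace_Jp Jp_SucI Suc simp: star_assoc)
qed

lemma Jp_Suc_subset: "a \<in> Jp (Suc n) \<Longrightarrow> a \<in> Jp n"
  by (rule Jp_Suc_mem[where f = "\<lambda>a. a", rotated -1]) (auto intro!: lin subspace_Jp Jp_star_left)

lemma Jp_antimono: "m \<le> n \<Longrightarrow> a \<in> Jp n \<Longrightarrow> a \<in> Jp m"
  by (induction n rule: dec_induct) (auto dest: Jp_Suc_subset)

text \<open>\<open>Jp\<close> splits off a factor from \<open>J\<close> on the left. Nilpotency
  needs it on the right, because in \<open>(c \<star> d) \<bullet> x\<close> the right factor acts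
  on \<open>x\<close> first.\<close>

lemma Jp_Suc_right:
  assumes "clinear f" "csubspace V" "\<And>c d. c \<in> Jp n \<Longrightarrow> d \<in> J \<Longrightarrow> f (c \<star> d) \<in> V"
    and "a \<in> Jp (Suc n)"
  shows "f a \<in> V"
proof -
  have "a \<in> cspan {c \<star> d | c d. c \<in> Jp n \<and> d \<in> J}"
    using assms(4)
  proof (induction n arbitrary: a)
    case 0
    then have "\<epsilon> \<star> a \<in> cspan {c \<star> d | c d. c \<in> Jp 0 \<and> d \<in> J}"
      unfolding Jp_1 by (intro complex_vector.span_base) (auto simp del: one_star)
    then show ?case by simp
  next
    case (Suc n)
    show ?case
    proof (rule Jp_Suc_mem[where f = "\<lambda>a. a", OF _ _ _ Suc.prems])
      fix c b assume c: "c \<in> J" and b: "b \<in> Jp (Suc n)"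
      show "c \<star> b \<in> cspan {c \<star> d | c d. c \<in> Jp (Suc n) \<and> d \<in> J}"
      proof (rule clinear_span_mem[OF _ _ _ Suc.IH[OF b], where f = "\<lambda>b. c \<star> b"])
        fix x assume "x \<in> {c \<star> d | c d. c \<in> Jp n \<and> d \<in> J}"
        then obtain p q where x: "x = p \<star> q" "p \<in> Jp n" "q \<in> J" by auto
        have "c \<star> p \<in> Jp (Suc n)" using c x by (intro Jp_SucI)
        then show "c \<star> x \<in> cspan {c \<star> d | c d. c \<in> Jp (Suc n) \<and> d \<in> J}"
          using x by (auto intro!: complex_vector.span_base simp: star_assoc[symmetric])
      qed (auto intro!: lin complex_vector.subspace_span)
    qed (auto intro!: lin complex_vector.subspace_span)
  qed
  then show ?thesis
    by (rule clinear_span_mem[OF assms(1,2), rotated]) (use assms(3) in auto)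
qed

subsection \<open>Congruences modulo powers of the annihilator\<close>

text \<open>Stands in for equality in the associated graded algebra: two elements of
  \<open>Jp n\<close> have the same class in degree \<open>n\<close> when they are congruent modulo
  \<open>Jp (Suc n)\<close>.\<close>

definition cong :: "'a dual \<Rightarrow> nat \<Rightarrow> 'a dual \<Rightarrow> bool"  (\<open>_ \<approx>\<^bsub>_\<^esub> _\<close> [51, 0, 51] 50)
  where "a \<approx>\<^bsub>n\<^esub> b \<longleftrightarrow> a - b \<in> Jp n"

lemma cong_refl [simp]: "a \<approx>\<^bsub>n\<^esub> a"
  by (simp add: cong_def)

lemma cong_sym: "a \<approx>\<^bsub>n\<^esub> b \<Longrightarrow> b \<approx>\<^bsub>n\<^esub> a"
  unfolding cong_def using Jp_scale[of "a - b" n "-1"] by (simp add: complex_vector.scale_minus_left)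

lemma cong_trans [trans]: "a \<approx>\<^bsub>n\<^esub> b \<Longrightarrow> b \<approx>\<^bsub>n\<^esub> c \<Longrightarrow> a \<approx>\<^bsub>n\<^esub> c"
  unfolding cong_def using Jp_add[of "a - b" n "b - c"] by simp

lemma cong_eq_trans [trans]: "a \<approx>\<^bsub>n\<^esub> b \<Longrightarrow> b = c \<Longrightarrow> a \<approx>\<^bsub>n\<^esub> c" "a = b \<Longrightarrow> b \<approx>\<^bsub>n\<^esub> c \<Longrightarrow> a \<approx>\<^bsub>n\<^esub> c"
  by simp_all

lemma cong_add: "a \<approx>\<^bsub>n\<^esub> b \<Longrightarrow> c \<approx>\<^bsub>n\<^esub> d \<Longrightarrow> a + c \<approx>\<^bsub>n\<^esub> b + d"
  unfolding cong_def using Jp_add[of "a - b" n "c - d"] by (simp add: algebra_simps)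

lemma cong_scale: "a \<approx>\<^bsub>n\<^esub> b \<Longrightarrow> c *\<^sub>C a \<approx>\<^bsub>n\<^esub> c *\<^sub>C b"
  unfolding cong_def using Jp_scale[of "a - b" n c]
  by (simp add: complex_vector.scale_right_diff_distrib)

lemma cong_sum: "(\<And>i. i \<in> I \<Longrightarrow> f i \<approx>\<^bsub>n\<^esub> g i) \<Longrightarrow> (\<Sum>i\<in>I. f i) \<approx>\<^bsub>n\<^esub> (\<Sum>i\<in>I. g i)"
  unfolding cong_def by (simp add: sum_subtractf[symmetric] Jp_sum)

lemma cong_star_left: "a \<approx>\<^bsub>n\<^esub> b \<Longrightarrow> c \<in> Jp m \<Longrightarrow> c \<star> a \<approx>\<^bsub>m + n\<^esub> c \<star> b"
  unfolding cong_def star_diff_right[symmetric] by (rule Jp_star)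

lemma cong_star_right: "a \<approx>\<^bsub>n\<^esub> b \<Longrightarrow> c \<in> Jp m \<Longrightarrow> a \<star> c \<approx>\<^bsub>n + m\<^esub> b \<star> c"
  unfolding cong_def star_diff_left[symmetric] by (rule Jp_star)

lemma cong_star_left0: "a \<approx>\<^bsub>n\<^esub> b \<Longrightarrow> c \<star> a \<approx>\<^bsub>n\<^esub> c \<star> b"
  using cong_star_left[of a n b c 0] by simp

lemma cong_star_right0: "a \<approx>\<^bsub>n\<^esub> b \<Longrightarrow> a \<star> c \<approx>\<^bsub>n\<^esub> b \<star> c"
  using cong_star_right[of a n b c 0] by simp

lemma cong_Jp: "a \<approx>\<^bsub>n\<^esub> b \<Longrightarrow> b \<in> Jp n \<Longrightarrow> a \<in> Jp n"
  unfolding cong_def using Jp_add[of "a - b" n b] by simp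

lemma cong_J_iff: "a \<approx>\<^bsub>Suc 0\<^esub> b \<longleftrightarrow> (\<forall>g\<in>G. a \<bullet> g = b \<bullet> g)"
  by (simp add: cong_def Jp_1 J_def minus_dual.rep_eq)

lemma cong_sum_e: "a \<approx>\<^bsub>1\<^esub> (\<Sum>g\<in>G. a \<bullet> g *\<^sub>C e g)"
  unfolding One_nat_def cong_J_iff
  by (auto simp: dual_apply_sum scaleC_dual.rep_eq if_distrib sum.If_cases finite_G
      cong: if_cong)

lemma star_e_cong: "g \<in> G \<Longrightarrow> a \<star> e g \<approx>\<^bsub>1\<^esub> a \<bullet> g *\<^sub>C e g"
  and e_star_cong: "g \<in> G \<Longrightarrow> e g \<star> a \<approx>\<^bsub>1\<^esub> a \<bullet> g *\<^sub>C e g"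
  by (auto simp: cong_J_iff star_G scaleC_dual.rep_eq)

subsection \<open>Translations and skew derivations\<close>

text \<open>The transposes of left and right multiplication: \<open>Lt x f\<close> is
  \<open>f (x _)\<close> and \<open>Rt x f\<close> is \<open>f (_ x)\<close>. For skew primitive
  \<open>v\<close> the operator \<open>Lt v\<close> plays the role of a partial derivative.\<close>

abbreviation Lt :: "'a \<Rightarrow> 'a dual \<Rightarrow> 'a dual" where "Lt x f \<equiv> sl1 x (\<Delta>' f)"

abbreviation Rt :: "'a \<Rightarrow> 'a dual \<Rightarrow> 'a dual" where "Rt x f \<equiv> sl2 x (\<Delta>' f)"

lemma sl1_star2_G: "g \<in> G \<Longrightarrow> sl1 g (S \<star>\<star> T) = sl1 g S \<star> sl1 g T"
  by (rule clinear_eq_on_tensors2[where s = S and t = T])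
    (auto intro!: lin simp: star_G star_linear scaleC_scaleC mult.commute)

lemma sl2_star2_G: "g \<in> G \<Longrightarrow> sl2 g (S \<star>\<star> T) = sl2 g S \<star> sl2 g T"
  by (rule clinear_eq_on_tensors2[where s = S and t = T])
    (auto intro!: lin simp: star_G star_linear scaleC_scaleC mult.commute)

lemma Lt_star: "g \<in> G \<Longrightarrow> Lt g (a \<star> b) = Lt g a \<star> Lt g b"
  and Rt_star: "g \<in> G \<Longrightarrow> Rt g (a \<star> b) = Rt g a \<star> Rt g b"
  by (simp_all add: comult_dual_star sl1_star2_G sl2_star2_G)

lemma Lt_unit [simp]: "Lt (unit H) a = a" and Rt_unit [simp]: "Rt (unit H) a = a"
  by (rule dual_eqI, simp add: mult_unit_left mult_unit_right)+

lemma Lt_skew: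
  assumes "\<Delta> v = v \<otimes> unit H + p \<otimes> v"
  shows "Lt v (a \<star> b) = Lt v a \<star> b + Lt p a \<star> Lt v b"
proof -
  have bil: "cbilinear (\<lambda>u v. sl1 u (\<Delta>' a) \<star> sl1 v (\<Delta>' b))"
    by (intro cbilinearI lin)
  show ?thesis
    by (simp add: comult_dual_star sl1_star2 assms clinear_add[OF clinear_tensor_lift[OF bil]]
        tensor_lift_tensor_prod[OF bil])
qed

lemma Lt_J: "g \<in> G \<Longrightarrow> a \<in> J \<Longrightarrow> Lt g a \<in> J" and Rt_J: "g \<in> G \<Longrightarrow> a \<in> J \<Longrightarrow> Rt g a \<in> J"
  by (simp_all add: J_def times_G)

lemma Lt_Jp: "g \<in> G \<Longrightarrow> a \<in> Jp n \<Longrightarrow> Lt g a \<in> Jp n"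
proof (induction n arbitrary: a)
  case (Suc n)
  show ?case
    by (rule Jp_Suc_mem[where f = "\<lambda>a. Lt g a", OF _ _ _ Suc.prems(2)])
      (use Suc in \<open>auto intro!: lin subspace_Jp Jp_SucI Lt_J simp: Lt_star\<close>)
qed simp

lemma Rt_Jp: "g \<in> G \<Longrightarrow> a \<in> Jp n \<Longrightarrow> Rt g a \<in> Jp n"
proof (induction n arbitrary: a)
  case (Suc n)
  show ?case
    by (rule Jp_Suc_mem[where f = "\<lambda>a. Rt g a", OF _ _ _ Suc.prems(2)])
      (use Suc in \<open>auto intro!: lin subspace_Jp Jp_SucI Rt_J simp: Rt_star\<close>)
qed simp

lemmas Lt_diff = clinear_diff[OF lin_sl1[OF lin_\<Delta>'[OF lin_id]]]
  and Rt_diff = clinear_diff[OF lin_sl2[OF lin_\<Delta>'[OF lin_id]]]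
  and Rt_scale = clinear_scaleC[OF lin_sl2[OF lin_\<Delta>'[OF lin_id]]]
  and Lt_sum = clinear_sum[OF lin_sl1[OF lin_\<Delta>'[OF lin_id]]]
  and Rt_sum = clinear_sum[OF lin_sl2[OF lin_\<Delta>'[OF lin_id]]]

lemma Lt_cong: "g \<in> G \<Longrightarrow> a \<approx>\<^bsub>n\<^esub> b \<Longrightarrow> Lt g a \<approx>\<^bsub>n\<^esub> Lt g b"
  and Rt_cong: "g \<in> G \<Longrightarrow> a \<approx>\<^bsub>n\<^esub> b \<Longrightarrow> Rt g a \<approx>\<^bsub>n\<^esub> Rt g b"
  unfolding cong_def Lt_diff[symmetric] Rt_diff[symmetric] by (simp_all add: Lt_Jp Rt_Jp)

text \<open>By the twisted Leibniz rule only one factor is differentiated, which costs one factor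
  from \<open>J\<close>; the others are at most translated by \<open>p\<close>, and \<open>J\<close>
  is stable under that.\<close>

lemma Lt_skew_Jp:
  assumes v: "\<Delta> v = v \<otimes> unit H + p \<otimes> v" and p: "p \<in> G" and a: "a \<in> Jp (Suc n)"
  shows "Lt v a \<in> Jp n"
  using a
proof (induction n arbitrary: a)
  case (Suc n)
  show ?case
  proof (rule Jp_Suc_mem[where f = "\<lambda>a. Lt v a", OF _ _ _ Suc.prems])
    fix c d assume c: "c \<in> J" and d: "d \<in> Jp (Suc n)"
    have "Lt p c \<star> Lt v d \<in> Jp (1 + n)"
      using c d p by (intro Jp_star Suc.IH) (simp_all add: Jp_1 Lt_J)
    moreover have "Lt v c \<star> d \<in> Jp (0 + Suc n)" using d by (intro Jp_star) auto
    ultimately show "Lt v (c \<star> d) \<in> Jp (Suc n)"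
      unfolding Lt_skew[OF v] by (intro Jp_add) simp_all
  qed (intro lin subspace_Jp)+
qed simp

section \<open>Filtration on the tensor square\<close>

definition F :: "nat \<Rightarrow> ('a dual \<otimes> 'a dual) set"
  where "F n = cspan {a \<otimes> b | a b i j. a \<in> Jp i \<and> b \<in> Jp j \<and> i + j = n}"

lemma subspace_F: "csubspace (F n)"
  by (simp add: F_def complex_vector.subspace_span)

lemmas F_0 [simp] = complex_vector.subspace_0[OF subspace_F]
  and F_add = complex_vector.subspace_add[OF subspace_F]
  and F_diff = complex_vector.subspace_diff[OF subspace_F]
  and F_scale = complex_vector.subspace_scale[OF subspace_F]
  and F_sum = complex_vector.subspace_sum[OF subspace_F]

lemma F_prod: "a \<in> Jp i \<Longrightarrow> b \<in> Jp j \<Longrightarrow> i + j = n \<Longrightarrow> a \<otimes> b \<in> F n"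
  unfolding F_def by (intro complex_vector.span_base) auto

lemma F_mem:
  assumes "clinear f" "csubspace V"
    and "\<And>a b i j. a \<in> Jp i \<Longrightarrow> b \<in> Jp j \<Longrightarrow> i + j = n \<Longrightarrow> f (a \<otimes> b) \<in> V"
    and "t \<in> F n"
  shows "f t \<in> V"
  using assms(4) unfolding F_def
  by (rule clinear_span_mem[OF assms(1,2), rotated]) (use assms(3) in auto)

lemma F_Suc_subset: "t \<in> F (Suc n) \<Longrightarrow> t \<in> F n"
proof (rule F_mem[where f = "\<lambda>t. t", rotated -1])
  fix a b i j assume "a \<in> Jp i" "b \<in> Jp j" "i + j = Suc n"
  then show "a \<otimes> b \<in> F n"
    by (cases i) (auto intro: F_prod Jp_Suc_subset F_prod[of a 0])
qed (auto intro: lin subspace_F)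

lemma F_antimono: "m \<le> n \<Longrightarrow> t \<in> F n \<Longrightarrow> t \<in> F m"
  by (induction n rule: dec_induct) (auto dest: F_Suc_subset)

lemma F_star2: "s \<in> F m \<Longrightarrow> t \<in> F n \<Longrightarrow> s \<star>\<star> t \<in> F (m + n)"
proof -
  assume s: "s \<in> F m" and t: "t \<in> F n"
  show ?thesis
  proof (rule F_mem[where f = "\<lambda>s. s \<star>\<star> t", OF _ _ _ s])
    fix a b i j assume ab: "a \<in> Jp i" "b \<in> Jp j" "i + j = m"
    show "(a \<otimes> b) \<star>\<star> t \<in> F (m + n)"
    proof (rule F_mem[where f = "\<lambda>t. (a \<otimes> b) \<star>\<star> t", OF _ _ _ t])
      fix c d k l assume cd: "c \<in> Jp k" "d \<in> Jp l" "k + l = n"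
      show "(a \<otimes> b) \<star>\<star> (c \<otimes> d) \<in> F (m + n)"
        using ab cd by (auto intro!: F_prod[OF Jp_star Jp_star])
    qed (intro lin subspace_F)+
  qed (intro lin subspace_F)+
qed

text \<open>The alternating sum is \<open>tensor_map pr pr t\<close>, where \<open>pr\<close>
  projects onto \<open>J\<close> along the span of the \<open>e g\<close>. Its value therefore lies
  in the tensor square of \<open>J\<close>.\<close>

lemma tensor_diff_F2:
  "t - (\<Sum>g\<in>G. e g \<otimes> sl1 g t) - (\<Sum>g\<in>G. sl2 g t \<otimes> e g)
    + (\<Sum>g\<in>G. \<Sum>h\<in>G. (sl1 g t \<bullet> h) *\<^sub>C (e g \<otimes> e h)) \<in> F 2"
proof -
  define pr where "pr a = a - (\<Sum>g\<in>G. a \<bullet> g *\<^sub>C e g)" for a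
  have pr_lin [lin]: "clinear h \<Longrightarrow> clinear (\<lambda>z. pr (h z))" for h :: "'z::complex_vector \<Rightarrow> _"
    unfolding pr_def by (intro lin)
  have pr: "pr a \<in> Jp 1" for a
    unfolding pr_def using cong_sum_e[of a] unfolding cong_def .
  define \<Phi> where "\<Phi> t = t - (\<Sum>g\<in>G. e g \<otimes> sl1 g t) - (\<Sum>g\<in>G. sl2 g t \<otimes> e g)
      + (\<Sum>g\<in>G. \<Sum>h\<in>G. (sl1 g t \<bullet> h) *\<^sub>C (e g \<otimes> e h))" for t
  have "tensor_map pr pr t = \<Phi> t"
  proof (rule clinear_eq_on_tensors[where t = t])
    fix a b
    define E where "E a = (\<Sum>g\<in>G. a \<bullet> g *\<^sub>C e g)" for a
    note tens = clinear_sum[OF clinear_tensor_prod_left] clinear_sum[OF clinear_tensor_prod_right]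
      clinear_scaleC[OF clinear_tensor_prod_left] clinear_scaleC[OF clinear_tensor_prod_right]
    have "(\<Sum>g\<in>G. e g \<otimes> sl1 g (a \<otimes> b)) = E a \<otimes> b"
      and "(\<Sum>g\<in>G. sl2 g (a \<otimes> b) \<otimes> e g) = a \<otimes> E b"
      by (simp_all add: E_def tens)
    moreover have "(\<Sum>g\<in>G. \<Sum>h\<in>G. (sl1 g (a \<otimes> b) \<bullet> h) *\<^sub>C (e g \<otimes> e h)) = E a \<otimes> E b"
      by (simp only: E_def tens sl1_prod scaleC_dual.rep_eq complex_vector.scale_sum_right
          scaleC_scaleC, subst sum.swap, simp only: mult.commute)
    moreover have "tensor_map pr pr (a \<otimes> b) = (a - E a) \<otimes> (b - E b)"
      by (simp add: pr_lin lin_id) (simp add: pr_def E_def)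
    ultimately show "tensor_map pr pr (a \<otimes> b) = \<Phi> (a \<otimes> b)"
      unfolding \<Phi>_def
      by (simp add: clinear_diff[OF clinear_tensor_prod_left] clinear_diff[OF clinear_tensor_prod_right])
  qed (unfold \<Phi>_def, (intro lin)+)
  moreover have "tensor_map pr pr t \<in> F 2"
  proof (rule clinear_mem_on_tensors[where f = "tensor_map pr pr"])
    show "tensor_map pr pr (a \<otimes> b) \<in> F 2" for a b
      using F_prod[OF pr[of a] pr[of b], of 2] by (simp add: pr_lin lin_id)
  qed (intro lin subspace_F)+
  ultimately show ?thesis by (simp add: \<Phi>_def)
qed

lemma mem_F0: "t \<in> F 0"
  by (rule clinear_mem_on_tensors[where f = "\<lambda>t. t"]) (auto intro!: lin subspace_F F_prod)

text \<open>The double sum of \<open>tensor_diff_F2\<close> drops out because products of grouplike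
  elements are grouplike. What remains are the two coactions, of functions on \<open>G\<close>, on
  the part of degree one.\<close>

lemma comult_dual_J:
  assumes "a \<in> J"
  shows "\<Delta>' a - (\<Sum>g\<in>G. e g \<otimes> Lt g a) - (\<Sum>g\<in>G. Rt g a \<otimes> e g) \<in> F 2"
proof -
  have "(\<Sum>g\<in>G. \<Sum>h\<in>G. (Lt g a \<bullet> h) *\<^sub>C (e g \<otimes> e h)) = 0"
    using assms by (intro sum.neutral ballI) (simp add: J_def times_G)
  then show ?thesis using tensor_diff_F2[of "\<Delta>' a"] by simp
qed

lemma comult_dual_J_F: "a \<in> J \<Longrightarrow> \<Delta>' a \<in> F (Suc 0)"
proof -
  assume a: "a \<in> J"
  let ?L = "\<Sum>g\<in>G. e g \<otimes> Lt g a" and ?R = "\<Sum>g\<in>G. Rt g a \<otimes> e g"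
  have "?L \<in> F (Suc 0)"
    using a by (auto intro!: F_sum F_prod[of _ 0 _ "Suc 0"] simp: Jp_1 Lt_J)
  moreover have "?R \<in> F (Suc 0)"
    using a by (auto intro!: F_sum F_prod[of _ "Suc 0" _ 0] simp: Jp_1 Rt_J)
  moreover have "\<Delta>' a - ?L - ?R \<in> F (Suc 0)"
    by (rule F_antimono[OF _ comult_dual_J[OF a]]) simp
  ultimately have "(\<Delta>' a - ?L - ?R) + ?L + ?R \<in> F (Suc 0)" by (intro F_add)
  then show ?thesis by simp
qed

lemma comult_dual_Jp: "a \<in> Jp n \<Longrightarrow> \<Delta>' a \<in> F n"
proof (induction n arbitrary: a)
  case 0
  then show ?case by (simp add: mem_F0)
next
  case (Suc n)
  show ?case
    by (rule Jp_Suc_mem[where f = "\<Delta>'", OF clinear_\<Delta>' subspace_F _ Suc.prems])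
      (use F_star2[OF comult_dual_J_F Suc.IH] in \<open>simp add: comult_dual_star\<close>)
qed

lemma ex_star_inverse:
  assumes "\<forall>g\<in>G. c \<bullet> g \<noteq> 0"
  shows "\<exists>d. c \<star> d \<approx>\<^bsub>Suc 0\<^esub> \<epsilon>"
proof
  have *: "(\<Sum>g\<in>G. (1 / c \<bullet> g) *\<^sub>C e g) \<bullet> h = 1 / c \<bullet> h" if "h \<in> G" for h
  proof -
    have "(\<Sum>g\<in>G. (1 / c \<bullet> g) *\<^sub>C e g) \<bullet> h = (\<Sum>g\<in>G. if g = h then 1 / c \<bullet> h else 0)"
      unfolding dual_apply_sum scaleC_dual.rep_eq using that by (intro sum.cong) auto
    also have "\<dots> = 1 / c \<bullet> h" using that finite_G by simp
    finally show ?thesis .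
  qed
  show "c \<star> (\<Sum>g\<in>G. (1 / c \<bullet> g) *\<^sub>C e g) \<approx>\<^bsub>Suc 0\<^esub> \<epsilon>"
    unfolding cong_J_iff using assms by (simp add: star_G * counit_G)
qed

section \<open>Primitive elements of the associated graded algebra\<close>

text \<open>
  The part \<open>J\<^bsup>d+1\<^esup> \<otimes> A\<close> is invisible to slices at vectors annihilated by \<open>J\<^bsup>d+1\<^esup>\<close>.
\<close>

definition E :: "nat \<Rightarrow> nat \<Rightarrow> ('a dual \<otimes> 'a dual) set"
  where "E d n = cspan {a \<otimes> b | a b i j. a \<in> Jp i \<and> b \<in> Jp j \<and> (i = Suc d \<or> i + j = n)}"

lemma subspace_E: "csubspace (E d n)"
  by (simp add: E_def complex_vector.subspace_span)

lemmas E_add = complex_vector.subspace_add[OF subspace_E]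
  and E_diff = complex_vector.subspace_diff[OF subspace_E]
  and E_scale = complex_vector.subspace_scale[OF subspace_E]

lemma E_prod: "a \<in> Jp (Suc d) \<Longrightarrow> a \<otimes> b \<in> E d n"
  unfolding E_def by (intro complex_vector.span_base CollectI exI[of _ a] exI[of _ b]
      exI[of _ "Suc d"] exI[of _ 0]) simp

lemma E_prod': "a \<in> Jp i \<Longrightarrow> b \<in> Jp j \<Longrightarrow> i + j = n \<Longrightarrow> a \<otimes> b \<in> E d n"
  unfolding E_def by (intro complex_vector.span_base) blast

lemma F_subset_E: "t \<in> F n \<Longrightarrow> t \<in> E d n"
  by (rule F_mem[where f = "\<lambda>t. t"])
    (auto intro: lin subspace_E E_prod')

lemma E_mem:
  assumes "clinear f" "csubspace V" "\<And>a b. a \<in> Jp (Suc d) \<Longrightarrow> f (a \<otimes> b) \<in> V"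
    and "\<And>a b i j. a \<in> Jp i \<Longrightarrow> b \<in> Jp j \<Longrightarrow> i + j = n \<Longrightarrow> f (a \<otimes> b) \<in> V"
    and "t \<in> E d n"
  shows "f t \<in> V"
  using assms(5) unfolding E_def
  by (rule clinear_span_mem[OF assms(1,2), rotated]) (use assms(3,4) in auto)

lemma E_star2: "t \<in> E d n \<Longrightarrow> s \<in> F m \<Longrightarrow> t \<star>\<star> s \<in> E d (n + m)"
proof -
  assume t: "t \<in> E d n" and s: "s \<in> F m"
  show ?thesis
  proof (rule E_mem[where f = "\<lambda>t. t \<star>\<star> s", OF _ _ _ _ t])
    fix a b assume a: "a \<in> Jp (Suc d)"
    show "(a \<otimes> b) \<star>\<star> s \<in> E d (n + m)"
      by (rule clinear_mem_on_tensors[where f = "\<lambda>s. (a \<otimes> b) \<star>\<star> s"])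
        (auto intro!: lin subspace_E E_prod Jp_star[OF a, of _ 0, simplified])
  next
    fix a b i j assume "a \<in> Jp i" "b \<in> Jp j" "i + j = n"
    then show "(a \<otimes> b) \<star>\<star> s \<in> E d (n + m)"
      by (intro F_subset_E F_star2 s F_prod)
  qed (intro lin subspace_E)+
qed

text \<open>A summand with \<open>i \<le> d\<close> has its second leg in degree at least
  \<open>n - d\<close>; one with larger \<open>i\<close> is killed by evaluation at
  \<open>x\<close>.\<close>

lemma E_slice:
  assumes t: "t \<in> E d n" and x: "\<And>a. a \<in> Jp (Suc d) \<Longrightarrow> a \<bullet> x = 0"
  shows "sl1 x t \<in> Jp (n - d)"
proof (rule E_mem[where f = "sl1 x", OF _ _ _ _ t])
  fix a b i j assume ab: "a \<in> Jp i" "b \<in> Jp j" "i + j = n"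
  show "sl1 x (a \<otimes> b) \<in> Jp (n - d)"
  proof (cases "Suc d \<le> i")
    case True
    then show ?thesis using x Jp_antimono ab(1) by simp
  next
    case False
    then have "b \<in> Jp (n - d)" using ab by (intro Jp_antimono[OF _ ab(2)]) simp
    then show ?thesis by (simp add: Jp_scale)
  qed
qed (auto intro!: lin subspace_Jp simp: x)

section \<open>Powers of an element that is primitive up to higher degree\<close>

primrec pw :: "'a dual \<Rightarrow> nat \<Rightarrow> 'a dual"
  where "pw u 0 = \<epsilon>" | "pw u (Suc k) = pw u k \<star> u"

lemma pw_Jp: "u \<in> Jp d \<Longrightarrow> pw u k \<in> Jp (k * d)"
proof (induction k)
  case (Suc k)
  then show ?case using Jp_star[of "pw u k" "k * d" u d] by (simp add: add.commute)
qed simp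

lemma pw_G: "g \<in> G \<Longrightarrow> pw c k \<bullet> g = (c \<bullet> g) ^ k"
  by (induction k) (simp_all add: counit_G star_G)

lemma pw_commute: "c \<star> u \<approx>\<^bsub>n\<^esub> u \<star> c \<Longrightarrow> pw c k \<star> u \<approx>\<^bsub>n\<^esub> u \<star> pw c k"
proof (induction k)
  case (Suc k)
  have "pw c (Suc k) \<star> u \<approx>\<^bsub>n\<^esub> pw c k \<star> (u \<star> c)"
    by (simp add: star_assoc cong_star_left0 Suc.prems)
  also have "pw c k \<star> (u \<star> c) = (pw c k \<star> u) \<star> c" by (simp add: star_assoc)
  also have "\<dots> \<approx>\<^bsub>n\<^esub> (u \<star> pw c k) \<star> c" by (intro cong_star_right0 Suc)
  also have "\<dots> = u \<star> pw c (Suc k)" by (simp add: star_assoc)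
  finally show ?case .
qed simp

lemmas tensor_linear = clinear_add[OF clinear_tensor_prod_left] clinear_add[OF clinear_tensor_prod_right]
  clinear_diff[OF clinear_tensor_prod_left] clinear_diff[OF clinear_tensor_prod_right]
  clinear_scaleC[OF clinear_tensor_prod_left] clinear_scaleC[OF clinear_tensor_prod_right]
  clinear_sum[OF clinear_tensor_prod_left] clinear_sum[OF clinear_tensor_prod_right]

lemmas star2_linear = star2_add_left star2_add_right star2_diff_left star2_diff_right
  star2_scale_left star2_scale_right

text \<open>Expand the power \<open>k + 1\<close> of
  \<open>u \<otimes> \<epsilon> + c \<otimes> u\<close>, ignoring first legs of degree above
  \<open>d\<close>. Only terms with at most one \<open>u\<close> in the first leg survive, and those
  with exactly one coincide after moving \<open>u\<close> to the front. Since \<open>c\<close> and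
  \<open>u\<close> commute at this precision, their coefficient is the integer \<open>k + 1\<close>
  and not a q-number.\<close>

lemma comult_dual_pw:
  assumes u: "u \<in> Jp d" and d: "d \<ge> 1"
    and \<Delta>u: "\<Delta>' u - u \<otimes> \<epsilon> - c \<otimes> u \<in> F (Suc d)"
    and comm: "c \<star> u \<approx>\<^bsub>Suc d\<^esub> u \<star> c"
  shows "\<Delta>' (pw u (Suc k)) - pw c (Suc k) \<otimes> pw u (Suc k)
    - of_nat (Suc k) *\<^sub>C ((u \<star> pw c k) \<otimes> pw u k) \<in> E d (Suc (Suc k * d))"
proof (induction k)
  case 0
  then show ?case
    using F_subset_E[OF \<Delta>u, of d] by (simp add: complex_vector.scale_one algebra_simps)
next
  case (Suc k)
  let ?n = "of_nat (Suc k) :: complex"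
  define M1 where "M1 = pw c (Suc k) \<otimes> pw u (Suc k)"
  define M2 where "M2 = ?n *\<^sub>C ((u \<star> pw c k) \<otimes> pw u k)"
  define err where "err = \<Delta>' (pw u (Suc k)) - M1 - M2"
  define f where "f = \<Delta>' u - u \<otimes> \<epsilon> - c \<otimes> u"
  let ?N = "Suc (Suc (Suc k) * d)"
  have err: "err \<in> E d (Suc (Suc k * d))" using Suc by (simp only: err_def M1_def M2_def)
  have "M1 \<in> F (Suc k * d)"
    unfolding M1_def by (rule F_prod[of _ 0, OF _ pw_Jp[OF u]]) simp_all
  moreover have "M2 \<in> F (Suc k * d)"
    unfolding M2_def
    by (intro F_scale F_prod[OF _ pw_Jp[OF u]]) (auto intro: Jp_star[OF u, of _ 0, simplified])
  ultimately have M: "(M1 + M2) \<star>\<star> f \<in> F (Suc k * d + Suc d)"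
    using \<Delta>u unfolding f_def by (intro F_star2 F_add)
  have p1: "err \<star>\<star> \<Delta>' u \<in> E d ?N"
    using E_star2[OF err comult_dual_Jp[OF u]] by (simp add: algebra_simps)
  have p2: "(M1 + M2) \<star>\<star> f \<in> E d ?N"
    using F_subset_E[OF M, of d] by (simp add: algebra_simps)
  have p3: "(pw c (Suc k) \<star> u - u \<star> pw c (Suc k)) \<otimes> pw u (Suc k) \<in> E d ?N"
    using pw_commute[OF comm] unfolding cong_def by (intro E_prod)
  \<comment> \<open>Two occurrences of \<open>u\<close> in the first leg give degree
    \<open>2 * d\<close>, which exceeds \<open>d\<close> because \<open>d \<ge> 1\<close>.\<close>
  have "u \<star> pw c k \<star> u \<in> Jp (d + 0 + d)" using u by (intro Jp_star) simp_all
  then have p4: "?n *\<^sub>C ((u \<star> pw c k \<star> u) \<otimes> pw u k) \<in> E d ?N"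
    using d by (intro E_scale E_prod) (auto elim: Jp_antimono[rotated])
  have \<Delta>: "\<Delta>' (pw u (Suc (Suc k))) = err \<star>\<star> \<Delta>' u + (M1 + M2) \<star>\<star> f
      + (M1 + M2) \<star>\<star> (u \<otimes> \<epsilon> + c \<otimes> u)"
    unfolding pw.simps(2)[of u "Suc k"] comult_dual_star
    by (simp add: err_def f_def star2_linear algebra_simps del: pw.simps)
  have "(M1 + M2) \<star>\<star> (u \<otimes> \<epsilon> + c \<otimes> u) =
      (pw c (Suc k) \<star> u) \<otimes> pw u (Suc k) + pw c (Suc (Suc k)) \<otimes> pw u (Suc (Suc k))
      + ?n *\<^sub>C ((u \<star> pw c k \<star> u) \<otimes> pw u k)
      + ?n *\<^sub>C ((u \<star> pw c (Suc k)) \<otimes> pw u (Suc k))"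
    unfolding M1_def M2_def by (simp add: star2_linear star_assoc scaleC_add_right)
  then have "\<Delta>' (pw u (Suc (Suc k))) - pw c (Suc (Suc k)) \<otimes> pw u (Suc (Suc k))
      - of_nat (Suc (Suc k)) *\<^sub>C ((u \<star> pw c (Suc k)) \<otimes> pw u (Suc k)) =
      err \<star>\<star> \<Delta>' u + (M1 + M2) \<star>\<star> f + (pw c (Suc k) \<star> u - u \<star> pw c (Suc k)) \<otimes> pw u (Suc k)
      + ?n *\<^sub>C ((u \<star> pw c k \<star> u) \<otimes> pw u k)"
    unfolding \<Delta> of_nat_Suc[of "Suc k"]
    by (simp del: pw.simps of_nat_Suc
        add: tensor_linear scaleC_add_left complex_vector.scale_one algebra_simps)
  then show ?case using p1 p2 p3 p4 by (simp only: E_add)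
qed

text \<open>
  Otherwise, slicing \<open>\<Delta> (u\<^bsup>k+1\<^esup>)\<close> at a vector on which \<open>u c\<^sup>k\<close> does not vanish would show that no
  power of \<open>u\<close> vanishes in the associated graded algebra.
\<close>

lemma no_primitive:
  assumes u: "u \<in> Jp d" and d: "d \<ge> 1"
    and \<Delta>u: "\<Delta>' u - u \<otimes> \<epsilon> - c \<otimes> u \<in> F (Suc d)"
    and comm: "c \<star> u \<approx>\<^bsub>Suc d\<^esub> u \<star> c" and c: "\<forall>g\<in>G. c \<bullet> g \<noteq> 0"
    and nil: "Jp N \<subseteq> {0}"
  shows "u \<in> Jp (Suc d)"
proof (rule ccontr)
  assume nu: "u \<notin> Jp (Suc d)"
  have "pw u k \<notin> Jp (Suc (k * d))" for k
  proof (induction k)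
    case 0
    have "\<epsilon> \<bullet> unit H = 1" by (simp add: counit_unit)
    then show ?case using bexI[OF _ unit_G] by (auto simp: Jp_1 J_def counit_unit)
  next
    case (Suc k)
    show ?case
    proof
      assume uk: "pw u (Suc k) \<in> Jp (Suc (Suc k * d))"
      define w where "w = u \<star> pw c k"
      \<comment> \<open>The element \<open>c\<close> is invertible modulo \<open>J\<close>, and
        \<open>u\<close> already has degree \<open>d\<close>, so multiplying by a power of
        \<open>c\<close> cannot raise the degree of \<open>u\<close>.\<close>
      have "w \<notin> Jp (Suc d)"
      proof
        assume w: "w \<in> Jp (Suc d)"
        obtain c' where "pw c k \<star> c' \<approx>\<^bsub>Suc 0\<^esub> \<epsilon>"
          using ex_star_inverse[of "pw c k"] c by (auto simp: pw_G)
        then have "u \<star> (pw c k \<star> c') \<approx>\<^bsub>d + Suc 0\<^esub> u \<star> \<epsilon>" by (rule cong_star_left[OF _ u])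
        then have "u \<approx>\<^bsub>Suc d\<^esub> w \<star> c'" by (simp add: w_def star_assoc cong_sym)
        moreover have "w \<star> c' \<in> Jp (Suc d)" using Jp_star[OF w, of c' 0] by simp
        ultimately show False using nu cong_Jp by blast
      qed
      then obtain x where x: "\<And>a. a \<in> Jp (Suc d) \<Longrightarrow> a \<bullet> x = 0" "w \<bullet> x \<noteq> 0"
        using double_annihilator[OF subspace_Jp] by metis
      let ?n = "of_nat (Suc k) :: complex"
      have "\<Delta>' (pw u (Suc k)) - (\<Delta>' (pw u (Suc k)) - pw c (Suc k) \<otimes> pw u (Suc k) - ?n *\<^sub>C (w \<otimes> pw u k))
          \<in> E d (Suc (Suc k * d))"
        unfolding w_def
        by (intro E_diff[OF F_subset_E[OF comult_dual_Jp[OF uk]] comult_dual_pw[OF u d \<Delta>u comm]])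
      then have "pw c (Suc k) \<otimes> pw u (Suc k) + ?n *\<^sub>C (w \<otimes> pw u k) \<in> E d (Suc (Suc k * d))"
        by (simp add: algebra_simps del: pw.simps of_nat_Suc)
      \<comment> \<open>Slicing costs \<open>d\<close> degrees, and
        \<open>(k + 1) * d + 1 - d = k * d + 1\<close> is exactly the degree in which the induction
        hypothesis denies membership of \<open>pw u k\<close>. The other summand, a multiple of
        \<open>pw u (Suc k)\<close>, lies there anyway.\<close>
      from E_slice[OF this x(1)]
      have "(pw c (Suc k) \<bullet> x) *\<^sub>C pw u (Suc k) + ?n *\<^sub>C (w \<bullet> x) *\<^sub>C pw u k
          \<in> Jp (Suc (Suc k * d) - d)"
        by (simp add: clinear_add[OF lin_sl1[OF lin_id]] clinear_scaleC[OF lin_sl1[OF lin_id]]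
            del: pw.simps of_nat_Suc)
      moreover have "pw u (Suc k) \<in> Jp (Suc (k * d))"
        using uk by (rule Jp_antimono[rotated]) simp
      ultimately have "?n *\<^sub>C (w \<bullet> x) *\<^sub>C pw u k \<in> Jp (Suc (k * d))"
        using Jp_diff[OF _ Jp_scale, of "_ + _" "Suc (k * d)" _ "pw c (Suc k) \<bullet> x"] by fastforce
      then have "(1 / (?n * w \<bullet> x)) *\<^sub>C ?n *\<^sub>C (w \<bullet> x) *\<^sub>C pw u k \<in> Jp (Suc (k * d))"
        by (rule Jp_scale)
      moreover have "?n \<noteq> 0" by (rule of_nat_neq_0)
      ultimately show False
        using Suc.IH x(2) by (simp add: scaleC_scaleC complex_vector.scale_one del: of_nat_Suc)
    qed
  qed
  moreover have "pw u N \<in> Jp (N * d)" by (rule pw_Jp[OF u])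
  then have "pw u N \<in> Jp N" using d by (rule_tac Jp_antimono[of N "N * d"]) auto
  then have "pw u N = 0" using nil by auto
  ultimately show False by (metis Jp_0)
qed

section \<open>The group of grouplike elements\<close>

lemma antipode_G: "g \<in> G \<Longrightarrow> antipode H g \<odot> g = unit H"
proof -
  assume g: "g \<in> G"
  have "cbilinear (\<lambda>a b. antipode H a \<odot> id b)"
    unfolding id_def by (intro cbilinearI lin lin_comp[OF antipode_linear])
  then show ?thesis
    using antipode_left[of g] g
    by (simp add: convolution_def \<Delta>_G tensor_lift_tensor_prod counit_G complex_vector.scale_one)
qed

definition iv :: "'a \<Rightarrow> 'a" where "iv g = antipode H g"

lemma iv_left: "g \<in> G \<Longrightarrow> iv g \<odot> g = unit H"
  by (simp add: iv_def antipode_G)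

text \<open>The antipode provides a left inverse, so left multiplication by \<open>g\<close> is
  injective on the finite set \<open>G\<close>, hence surjective. The preimage of the unit is a
  right inverse inside \<open>G\<close> and must equal \<open>iv g\<close>.\<close>

lemma iv_G: "g \<in> G \<Longrightarrow> iv g \<in> G" and iv_right: "g \<in> G \<Longrightarrow> g \<odot> iv g = unit H"
proof -
  assume g: "g \<in> G"
  have inj: "inj_on (\<lambda>h. g \<odot> h) G"
  proof (rule inj_onI)
    fix x y assume "g \<odot> x = g \<odot> y"
    then have "iv g \<odot> (g \<odot> x) = iv g \<odot> (g \<odot> y)" by simp
    then show "x = y" by (simp add: mult_assoc[symmetric] iv_left[OF g] mult_unit_left)
  qed
  then have "(\<lambda>h. g \<odot> h) ` G = G"
    by (intro endo_inj_surj finite_G) (auto simp: g times_G)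
  then obtain h where h: "h \<in> G" "g \<odot> h = unit H" using unit_G by (metis imageE)
  have "iv g = iv g \<odot> (g \<odot> h)" by (simp add: h mult_unit_right)
  also have "\<dots> = h" by (simp add: mult_assoc[symmetric] iv_left[OF g] mult_unit_left)
  finally show "iv g \<in> G" "g \<odot> iv g = unit H" using h by simp_all
qed

end

text \<open>Pointedness enters this part only through the vanishing of a power of \<open>J\<close>,
  which \<open>J_nilpotent\<close> supplies.\<close>

locale cotriangular_nilpotent = fd_hopf_algebra H for H :: "'a::complex_vector hopf" +
  fixes R :: "'a dual \<otimes> 'a dual" and N :: nat
  assumes R: "triangular_structure (dual_hopf H) R" and nilpotent: "Jp N \<subseteq> {0}"
begin

section \<open>The braiding\<close>

definition r :: "'a \<Rightarrow> 'a \<Rightarrow> complex" where "r g h = sl1 g R \<bullet> h"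

lemma r_sl2: "sl2 h R \<bullet> g = r g h"
  by (simp add: r_def sl1_sl2)

lemma sl2_tensor_swap: "sl2 g (tensor_swap t) = sl1 g t"
  by (rule clinear_eq_on_tensors[where t = t]) (auto intro!: lin)

text \<open>The relation between \<open>R\<close>, the coproduct and the opposite coproduct, sliced
  at \<open>g\<close> in the second leg. This is how the R-matrix ties right translations to left
  ones.\<close>

lemma R_exchange: "g \<in> G \<Longrightarrow> sl2 g R \<star> Rt g a = Lt g a \<star> sl2 g R"
proof -
  assume g: "g \<in> G"
  have "R \<star>\<star> \<Delta>' a = tensor_swap (\<Delta>' a) \<star>\<star> R"
    using R by (simp add: triangular_structure_def universal_R_matrix_def mult_dual_hopf)
  then have "sl2 g (R \<star>\<star> \<Delta>' a) = sl2 g (tensor_swap (\<Delta>' a) \<star>\<star> R)" by simp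
  then show ?thesis using g by (simp add: sl2_star2_G sl2_tensor_swap)
qed

text \<open>The place where triangularity, and not just an R-matrix, is used. It leaves only the
  signs 1 and -1 for \<open>r p p\<close>.\<close>

lemma r_skew: "g \<in> G \<Longrightarrow> h \<in> G \<Longrightarrow> r g h * r h g = 1"
proof -
  assume g: "g \<in> G" and h: "h \<in> G"
  have "tensor_swap R \<star>\<star> R = \<epsilon> \<otimes> \<epsilon>"
    using R by (simp add: triangular_structure_def mult_dual_hopf one_dual_def)
  then have "sl2 h (tensor_swap R \<star>\<star> R) \<bullet> g = sl2 h (\<epsilon> \<otimes> \<epsilon>) \<bullet> g" by simp
  then show ?thesis
    using g h by (simp add: sl2_star2_G star_G sl2_tensor_swap r_sl2 r_def[symmetric]
        scaleC_dual.rep_eq counit_G mult.commute)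
qed

lemma r_nonzero: "g \<in> G \<Longrightarrow> h \<in> G \<Longrightarrow> r g h \<noteq> 0"
  using r_skew[of g h] by auto

text \<open>Evaluating the three legs at \<open>g\<close>, \<open>h\<close>, \<open>k\<close> is an
  algebra map \<open>\<Psi>\<close> because these elements are grouplike. Applied to the hexagon
  identity for \<open>tensor_map id\<close> of the coproduct, it gives the product of two values of
  \<open>r\<close>.\<close>

lemma r_times_right:
  assumes g: "g \<in> G" and h: "h \<in> G" and k: "k \<in> G"
  shows "r g (h \<odot> k) = r g h * r g k"
proof -
  define \<Psi> where "\<Psi> = tensor_lift (\<lambda>a s. a \<bullet> g * (sl2 k s \<bullet> h))"
  have bil: "cbilinear (\<lambda>a s. a \<bullet> g * (sl2 k s \<bullet> h))" by (intro cbilinearI lin)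
  have \<Psi>: "\<Psi> (a \<otimes> s) = a \<bullet> g * (sl2 k s \<bullet> h)" for a s
    unfolding \<Psi>_def by (rule tensor_lift_tensor_prod[OF bil])
  have lin\<Psi> [lin]: "clinear f \<Longrightarrow> clinear (\<lambda>x. \<Psi> (f x))" for f :: "'z::complex_vector \<Rightarrow> _"
    unfolding \<Psi>_def by (intro lin bil)
  note bil2 = cbilinear_tensor_mult[OF cbilinear_star cbilinear_star]
  have [lin]: "clinear f \<Longrightarrow> clinear (\<lambda>x. tensor_mult star (tensor_mult star star) (f x) T)"
      "clinear f \<Longrightarrow> clinear (\<lambda>x. tensor_mult star (tensor_mult star star) T (f x))"
    for f :: "'z::complex_vector \<Rightarrow> _" and T
    by (rule lin_cbilinear_left[OF cbilinear_tensor_mult[OF cbilinear_star bil2]], assumption)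
      (rule lin_cbilinear_right[OF cbilinear_tensor_mult[OF cbilinear_star bil2]])
  have mult: "\<Psi> (tensor_mult star (tensor_mult star star) S T) = \<Psi> S * \<Psi> T" for S T
    by (rule clinear_eq_on_tensors2[where s = S and t = T])
      (auto intro!: lin simp: \<Psi> tensor_mult_prod[OF cbilinear_star bil2] sl2_star2_G star_G g h k)
  have "tensor_map id \<Delta>' R = tensor_mult star (tensor_mult star star)
      (leg13 (dual_hopf H) R) (leg12 (dual_hopf H) R)"
    using R by (simp add: triangular_structure_def universal_R_matrix_def mult_dual_hopf)
  then have "\<Psi> (tensor_map id \<Delta>' R) = \<Psi> (leg13 (dual_hopf H) R) * \<Psi> (leg12 (dual_hopf H) R)"
    by (simp add: mult)
  moreover have "\<Psi> (tensor_map id \<Delta>' t) = sl1 g t \<bullet> (h \<odot> k)" for t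
    unfolding id_def
    by (rule clinear_eq_on_tensors[where t = t])
      (auto intro!: lin simp: \<Psi> lin_id clinear_\<Delta>' scaleC_dual.rep_eq)
  moreover have "\<Psi> (leg13 (dual_hopf H) t) = sl1 g t \<bullet> k"
      "\<Psi> (leg12 (dual_hopf H) t) = sl1 g t \<bullet> h" for t
  proof -
    have b13: "cbilinear (\<lambda>a b. a \<otimes> (\<epsilon> \<otimes> b))" and b12: "cbilinear (\<lambda>a b. a \<otimes> (b \<otimes> \<epsilon>))"
      by (intro cbilinearI lin)+
    show "\<Psi> (leg13 (dual_hopf H) t) = sl1 g t \<bullet> k"
      unfolding leg13_def one_dual_def[symmetric]
      by (rule clinear_eq_on_tensors[where t = t])
        (auto intro!: lin b13 simp: \<Psi> tensor_lift_tensor_prod[OF b13] scaleC_dual.rep_eq counit_G h)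
    show "\<Psi> (leg12 (dual_hopf H) t) = sl1 g t \<bullet> h"
      unfolding leg12_def one_dual_def[symmetric]
      by (rule clinear_eq_on_tensors[where t = t])
        (auto intro!: lin b12 simp: \<Psi> tensor_lift_tensor_prod[OF b12] scaleC_dual.rep_eq counit_G k)
  qed
  ultimately show ?thesis by (simp add: r_def)
qed

text \<open>Obtained from \<open>r_times_right\<close> by inverting values with
  \<open>r_skew\<close>.\<close>

lemma r_times_left: "g \<in> G \<Longrightarrow> h \<in> G \<Longrightarrow> k \<in> G \<Longrightarrow> r (g \<odot> h) k = r g k * r h k"
proof -
  assume *: "g \<in> G" "h \<in> G" "k \<in> G"
  have "r (g \<odot> h) k * (r k g * r k h) = (r g k * r h k) * (r k g * r k h)"
    using r_skew[of "g \<odot> h" k] r_skew[of g k] r_skew[of h k] *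
    by (simp add: r_times_right times_G mult_ac)
  then show ?thesis using * r_nonzero by simp
qed

section \<open>Functionals of degree one\<close>

text \<open>
  Modulo \<open>J\<^sup>2\<close> these are the functionals dual to the skew primitive elements \<open>v\<close> with
  \<open>\<Delta> v = v \<otimes> 1 + p \<otimes> v\<close>.
\<close>

definition of_type :: "'a \<Rightarrow> 'a dual \<Rightarrow> bool"
  where "of_type p f \<longleftrightarrow> f \<in> J \<and> (\<forall>g\<in>G. Rt g f \<approx>\<^bsub>2\<^esub> f) \<and> (\<forall>c. c \<star> f \<approx>\<^bsub>2\<^esub> f \<star> Lt p c)"

lemma of_type_J: "of_type p f \<Longrightarrow> f \<in> J"
  and of_type_Rt: "of_type p f \<Longrightarrow> g \<in> G \<Longrightarrow> Rt g f \<approx>\<^bsub>2\<^esub> f"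
  and of_type_star: "of_type p f \<Longrightarrow> c \<star> f \<approx>\<^bsub>2\<^esub> f \<star> Lt p c"
  by (auto simp: of_type_def)

lemma of_type_Jp: "of_type p f \<Longrightarrow> f \<in> Jp (Suc 0)"
  by (simp add: Jp_1 of_type_J)

lemma cong_J_left: "f \<in> J \<Longrightarrow> a \<approx>\<^bsub>Suc 0\<^esub> b \<Longrightarrow> f \<star> a \<approx>\<^bsub>2\<^esub> f \<star> b"
  using cong_star_left[of a "Suc 0" b f "Suc 0"] by (simp add: Jp_1 numeral_2_eq_2)

lemma cong_J_right: "f \<in> J \<Longrightarrow> a \<approx>\<^bsub>Suc 0\<^esub> b \<Longrightarrow> a \<star> f \<approx>\<^bsub>2\<^esub> b \<star> f"
  using cong_star_right[of a "Suc 0" b f "Suc 0"] by (simp add: Jp_1 numeral_2_eq_2)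

text \<open>Put \<open>\<rho> = sl2 g R\<close>. Modulo \<open>Jp 2\<close>, \<open>Lt g f \<star>
  \<rho> = \<rho> \<star> Rt g f = \<rho> \<star> f = f \<star> Lt p \<rho> = r p g *\<^sub>C (f
  \<star> \<rho>)\<close>: exchange, right invariance, type, bicharacter. Then \<open>\<rho>\<close>
  is cancelled by an inverse modulo \<open>J\<close>, precise enough beside a factor from
  \<open>J\<close>.\<close>

lemma of_type_Lt:
  assumes f: "of_type p f" and p: "p \<in> G" and g: "g \<in> G"
  shows "Lt g f \<approx>\<^bsub>2\<^esub> r p g *\<^sub>C f"
proof -
  let ?\<rho> = "sl2 g R"
  obtain \<rho>' where \<rho>': "?\<rho> \<star> \<rho>' \<approx>\<^bsub>Suc 0\<^esub> \<epsilon>"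
    using ex_star_inverse[of ?\<rho>] r_nonzero g by (auto simp: r_sl2)
  have "Lt p ?\<rho> \<approx>\<^bsub>Suc 0\<^esub> r p g *\<^sub>C ?\<rho>"
    by (simp add: cong_J_iff r_sl2 r_times_left p g scaleC_dual.rep_eq)
  then have 1: "f \<star> Lt p ?\<rho> \<approx>\<^bsub>2\<^esub> f \<star> (r p g *\<^sub>C ?\<rho>)" by (rule cong_J_left[OF of_type_J[OF f]])
  have "Lt g f \<star> ?\<rho> = ?\<rho> \<star> Rt g f" by (simp add: R_exchange[OF g])
  also have "\<dots> \<approx>\<^bsub>2\<^esub> ?\<rho> \<star> f" by (intro cong_star_left0 of_type_Rt[OF f] g)
  also have "\<dots> \<approx>\<^bsub>2\<^esub> f \<star> Lt p ?\<rho>" by (rule of_type_star[OF f])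
  also note 1
  finally have 2: "Lt g f \<star> ?\<rho> \<star> \<rho>' \<approx>\<^bsub>2\<^esub> f \<star> (r p g *\<^sub>C ?\<rho>) \<star> \<rho>'" by (rule cong_star_right0)
  have "Lt g f \<star> \<epsilon> \<approx>\<^bsub>2\<^esub> Lt g f \<star> (?\<rho> \<star> \<rho>')"
    by (intro cong_J_left cong_sym[OF \<rho>'] Lt_J g of_type_J[OF f])
  also have "\<dots> = Lt g f \<star> ?\<rho> \<star> \<rho>'" by (simp only: star_assoc)
  also note 2
  also have "f \<star> (r p g *\<^sub>C ?\<rho>) \<star> \<rho>' = r p g *\<^sub>C (f \<star> (?\<rho> \<star> \<rho>'))"
    by (simp add: star_linear star_assoc)
  also have "\<dots> \<approx>\<^bsub>2\<^esub> r p g *\<^sub>C (f \<star> \<epsilon>)"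
    by (intro cong_scale cong_J_left \<rho>' of_type_J[OF f])
  finally show ?thesis by simp
qed

lemma F2_sum_diff:
  assumes "\<And>g. g \<in> G \<Longrightarrow> a g \<approx>\<^bsub>2\<^esub> b g"
  shows "(\<Sum>g\<in>G. e g \<otimes> a g) - (\<Sum>g\<in>G. e g \<otimes> b g) \<in> F 2"
    and "(\<Sum>g\<in>G. a g \<otimes> e g) - (\<Sum>g\<in>G. b g \<otimes> e g) \<in> F 2"
proof -
  have "a g - b g \<in> Jp 2" if "g \<in> G" for g using assms[OF that] by (simp add: cong_def)
  then have "(\<Sum>g\<in>G. e g \<otimes> (a g - b g)) \<in> F 2" "(\<Sum>g\<in>G. (a g - b g) \<otimes> e g) \<in> F 2"
    by (auto intro!: F_sum intro: F_prod[of _ 0 _ 2] F_prod[of _ 2 _ 0])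
  then show "(\<Sum>g\<in>G. e g \<otimes> a g) - (\<Sum>g\<in>G. e g \<otimes> b g) \<in> F 2"
    and "(\<Sum>g\<in>G. a g \<otimes> e g) - (\<Sum>g\<in>G. b g \<otimes> e g) \<in> F 2"
    by (simp_all add: tensor_linear sum_subtractf)
qed

text \<open>In \<open>comult_dual_J\<close> right invariance collapses one sum to
  \<open>f \<otimes> \<epsilon>\<close>. By \<open>of_type_Lt\<close> the other has coefficients
  \<open>r p g\<close>, the values of \<open>sl1 p R\<close> on \<open>G\<close>.\<close>

lemma of_type_comult:
  assumes f: "of_type p f" and p: "p \<in> G"
  shows "\<Delta>' f - f \<otimes> \<epsilon> - sl1 p R \<otimes> f \<in> F 2"
proof -
  let ?L = "\<Sum>g\<in>G. e g \<otimes> Lt g f" and ?R = "\<Sum>g\<in>G. Rt g f \<otimes> e g"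
  let ?L' = "\<Sum>g\<in>G. e g \<otimes> (r p g *\<^sub>C f)" and ?R' = "\<Sum>g\<in>G. f \<otimes> e g"
  have fJ: "f \<in> Jp (Suc 0)" by (rule of_type_Jp[OF f])
  have 1: "\<Delta>' f - ?L - ?R \<in> F 2" by (rule comult_dual_J[OF of_type_J[OF f]])
  have 2: "?L - ?L' \<in> F 2" by (rule F2_sum_diff(1)) (rule of_type_Lt[OF f p])
  have 3: "?R - ?R' \<in> F 2" by (rule F2_sum_diff(2)) (rule of_type_Rt[OF f])
  have "?L' - sl1 p R \<otimes> f = - ((sl1 p R - (\<Sum>g\<in>G. sl1 p R \<bullet> g *\<^sub>C e g)) \<otimes> f)"
    by (simp add: tensor_linear r_def)
  moreover have "(sl1 p R - (\<Sum>g\<in>G. sl1 p R \<bullet> g *\<^sub>C e g)) \<otimes> f \<in> F 2"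
    using cong_sum_e[of "sl1 p R"] fJ by (intro F_prod) (auto simp: cong_def)
  ultimately have 4: "?L' - sl1 p R \<otimes> f \<in> F 2"
    using complex_vector.subspace_neg[OF subspace_F] by metis
  have "?R' - f \<otimes> \<epsilon> = - (f \<otimes> (\<epsilon> - (\<Sum>g\<in>G. \<epsilon> \<bullet> g *\<^sub>C e g)))"
    by (simp add: tensor_linear counit_G complex_vector.scale_one)
  moreover have "f \<otimes> (\<epsilon> - (\<Sum>g\<in>G. \<epsilon> \<bullet> g *\<^sub>C e g)) \<in> F 2"
    using cong_sum_e[of \<epsilon>] fJ by (intro F_prod) (auto simp: cong_def)
  ultimately have 5: "?R' - f \<otimes> \<epsilon> \<in> F 2"
    using complex_vector.subspace_neg[OF subspace_F] by metis
  have "(\<Delta>' f - ?L - ?R) + (?L - ?L') + (?R - ?R') + (?L' - sl1 p R \<otimes> f) + (?R' - f \<otimes> \<epsilon>) \<in> F 2"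
    by (intro F_add 1 2 3 4 5)
  then show ?thesis by (simp add: algebra_simps)
qed

lemma sl1_R_star:
  assumes f: "of_type p f" and p: "p \<in> G" and q: "q \<in> G"
  shows "sl1 q R \<star> f \<approx>\<^bsub>2\<^esub> r q p *\<^sub>C (f \<star> sl1 q R)"
proof -
  have "Lt p (sl1 q R) \<approx>\<^bsub>Suc 0\<^esub> r q p *\<^sub>C sl1 q R"
    by (simp add: cong_J_iff r_def[symmetric] r_times_right p q scaleC_dual.rep_eq)
  then have "f \<star> Lt p (sl1 q R) \<approx>\<^bsub>2\<^esub> f \<star> (r q p *\<^sub>C sl1 q R)"
    by (rule cong_J_left[OF of_type_J[OF f]])
  with of_type_star[OF f] have "sl1 q R \<star> f \<approx>\<^bsub>2\<^esub> f \<star> (r q p *\<^sub>C sl1 q R)"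
    by (rule cong_trans)
  then show ?thesis by (simp add: star_linear)
qed

text \<open>\<open>r_skew\<close> makes \<open>r p p\<close> a square root of 1. If it were 1, then
  \<open>sl1 p R\<close> would commute with \<open>f\<close> modulo \<open>Jp 2\<close>, and
  \<open>no_primitive\<close> would push \<open>f\<close> into \<open>Jp 2\<close>.\<close>

lemma odd_type:
  assumes f: "of_type p f" and p: "p \<in> G" and "f \<notin> Jp 2"
  shows "r p p = -1"
proof -
  have "r p p \<noteq> 1"
  proof
    assume rp: "r p p = 1"
    have "f \<in> Jp (Suc (Suc 0))"
    proof (rule no_primitive[where c = "sl1 p R", OF _ _ _ _ _ nilpotent])
      show "\<Delta>' f - f \<otimes> \<epsilon> - sl1 p R \<otimes> f \<in> F (Suc (Suc 0))"
        using of_type_comult[OF f p] by (simp add: numeral_2_eq_2)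
      show "sl1 p R \<star> f \<approx>\<^bsub>Suc (Suc 0)\<^esub> f \<star> sl1 p R"
        using sl1_R_star[OF f p p] by (simp add: rp complex_vector.scale_one numeral_2_eq_2)
      show "\<forall>g\<in>G. sl1 p R \<bullet> g \<noteq> 0" using r_nonzero p by (simp add: r_def[symmetric])
    qed (use of_type_Jp[OF f] in simp_all)
    with assms(3) show False by (simp add: numeral_2_eq_2)
  qed
  moreover have "(r p p - 1) * (r p p + 1) = 0"
    using r_skew[OF p p] by (simp add: algebra_simps)
  ultimately show ?thesis by (simp add: eq_neg_iff_add_eq_0)
qed

lemma star_of_type_star:
  assumes f: "of_type p f" and f': "of_type q f'"
  shows "c \<star> (f \<star> f') \<approx>\<^bsub>3\<^esub> (f \<star> f') \<star> Lt q (Lt p c)"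
proof -
  have "(c \<star> f) \<star> f' \<approx>\<^bsub>2 + Suc 0\<^esub> (f \<star> Lt p c) \<star> f'"
    by (rule cong_star_right[OF of_type_star[OF f] of_type_Jp[OF f']])
  moreover have "f \<star> (Lt p c \<star> f') \<approx>\<^bsub>Suc 0 + 2\<^esub> f \<star> (f' \<star> Lt q (Lt p c))"
    by (rule cong_star_left[OF of_type_star[OF f'] of_type_Jp[OF f]])
  ultimately show ?thesis
    using cong_trans by (fastforce simp: star_assoc numeral_3_eq_3 numeral_2_eq_2)
qed

text \<open>The braided commutator of two functionals of degree one is primitive of even type.\<close>

lemma of_type_commute:
  assumes f: "of_type p f" and f': "of_type q f'" and p: "p \<in> G" and q: "q \<in> G"
  shows "f \<star> f' \<approx>\<^bsub>3\<^esub> r p q *\<^sub>C (f' \<star> f)"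
proof (cases "f \<in> Jp 2 \<or> f' \<in> Jp 2")
  case True
  then have "f \<star> f' \<in> Jp 3" "f' \<star> f \<in> Jp 3"
    using Jp_star[of f 2 f' "Suc 0"] Jp_star[of f "Suc 0" f' 2] Jp_star[of f' 2 f "Suc 0"]
      Jp_star[of f' "Suc 0" f 2] of_type_Jp[OF f] of_type_Jp[OF f']
    by (auto simp: numeral_3_eq_3 numeral_2_eq_2)
  then show ?thesis by (auto simp: cong_def intro: Jp_diff Jp_scale)
next
  case False
  have rr: "r p p = -1" "r q q = -1"
    using odd_type f f' p q False by auto
  define \<chi> where "\<chi> = sl1 p R \<star> sl1 q R"
  define u where "u = f \<star> f' - r p q *\<^sub>C (f' \<star> f)"
  have ff: "f \<star> f' \<in> Jp 2" "f' \<star> f \<in> Jp 2"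
    using Jp_star[OF of_type_Jp[OF f] of_type_Jp[OF f']] Jp_star[OF of_type_Jp[OF f'] of_type_Jp[OF f]]
    by (simp_all add: numeral_2_eq_2)
  have "u \<in> Jp (Suc 2)"
  proof (rule no_primitive[where c = \<chi>, OF _ _ _ _ _ nilpotent])
    show "u \<in> Jp 2" unfolding u_def by (intro Jp_diff Jp_scale ff)
    show "\<forall>g\<in>G. \<chi> \<bullet> g \<noteq> 0" using r_nonzero p q by (simp add: \<chi>_def star_G r_def[symmetric])
    \<comment> \<open>Expanding by the bicharacter, translation by the product of \<open>p\<close>
      and \<open>q\<close> multiplies \<open>\<chi>\<close> by
      \<open>r p p * r p q * r q p * r q q\<close>. The middle factors cancel by
      \<open>r_skew\<close> and the outer ones are two signs -1, so \<open>\<chi>\<close> commutes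
      with products of \<open>f\<close> and \<open>f'\<close>.\<close>
    have \<chi>_val: "\<chi> \<bullet> (p \<odot> (q \<odot> g)) = \<chi> \<bullet> g" "\<chi> \<bullet> (q \<odot> (p \<odot> g)) = \<chi> \<bullet> g" if "g \<in> G" for g
      using that p q r_skew[OF p q] rr
      by (simp_all add: \<chi>_def star_G times_G r_def[symmetric] r_times_right mult_ac)
    have "\<chi> \<star> (f \<star> f') \<approx>\<^bsub>3\<^esub> (f \<star> f') \<star> \<chi>"
    proof -
      have "(f \<star> f') \<star> Lt q (Lt p \<chi>) \<approx>\<^bsub>2 + Suc 0\<^esub> (f \<star> f') \<star> \<chi>"
        using \<chi>_val by (intro cong_star_left ff) (simp add: cong_J_iff)
      with star_of_type_star[OF f f'] show ?thesis
        using cong_trans by (simp add: numeral_3_eq_3 numeral_2_eq_2) blast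
    qed
    moreover have "\<chi> \<star> (f' \<star> f) \<approx>\<^bsub>3\<^esub> (f' \<star> f) \<star> \<chi>"
    proof -
      have "(f' \<star> f) \<star> Lt p (Lt q \<chi>) \<approx>\<^bsub>2 + Suc 0\<^esub> (f' \<star> f) \<star> \<chi>"
        using \<chi>_val by (intro cong_star_left ff) (simp add: cong_J_iff)
      with star_of_type_star[OF f' f] show ?thesis
        using cong_trans by (simp add: numeral_3_eq_3 numeral_2_eq_2) blast
    qed
    ultimately show "\<chi> \<star> u \<approx>\<^bsub>Suc 2\<^esub> u \<star> \<chi>"
      using cong_add[OF _ cong_scale[of _ _ _ "- r p q"]]
      by (fastforce simp: u_def star_linear complex_vector.scale_minus_left numeral_3_eq_3 numeral_2_eq_2)
    let ?P = "f \<otimes> \<epsilon> + sl1 p R \<otimes> f" and ?Q = "f' \<otimes> \<epsilon> + sl1 q R \<otimes> f'"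
    have PF: "?P \<in> F (Suc 0)" and QF: "?Q \<in> F (Suc 0)"
      using of_type_Jp[OF f] of_type_Jp[OF f']
      by (auto intro!: F_add intro: F_prod[of _ 0 _ "Suc 0"] F_prod[of _ "Suc 0" _ 0])
    have PQ: "\<Delta>' a \<star>\<star> \<Delta>' b - P \<star>\<star> Q \<in> F 3"
      if "\<Delta>' a - P \<in> F 2" "\<Delta>' b - Q \<in> F 2" "P \<in> F (Suc 0)" "b \<in> J" for a b P Q
    proof -
      have "(\<Delta>' a - P) \<star>\<star> \<Delta>' b + P \<star>\<star> (\<Delta>' b - Q) \<in> F 3"
        using F_star2[OF that(1) comult_dual_J_F[OF that(4)]] F_star2[OF that(3,2)]
        by (intro F_add) (simp_all add: numeral_3_eq_3 numeral_2_eq_2)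
      then show ?thesis by (simp add: star2_linear)
    qed
    have df: "\<Delta>' f - ?P \<in> F 2" and df': "\<Delta>' f' - ?Q \<in> F 2"
      using of_type_comult[OF f p] of_type_comult[OF f' q] by (simp_all add: diff_diff_eq)
    have 1: "\<Delta>' (f \<star> f') - ?P \<star>\<star> ?Q \<in> F 3"
      unfolding comult_dual_star by (rule PQ[OF df df' PF of_type_J[OF f']])
    have 2: "\<Delta>' (f' \<star> f) - ?Q \<star>\<star> ?P \<in> F 3"
      unfolding comult_dual_star by (rule PQ[OF df' df QF of_type_J[OF f]])
    \<comment> \<open>The mixed terms of the coproduct of the braided commutator must vanish.
      Passing \<open>sl1 q R\<close> across \<open>f\<close> produces \<open>r q p\<close>, and this
      cancels the coefficient \<open>r p q\<close> only because the braiding is symmetric.\<close>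
    have a: "f \<star> sl1 q R - r p q *\<^sub>C (sl1 q R \<star> f) \<in> Jp 2"
    proof -
      have "r p q *\<^sub>C (sl1 q R \<star> f) \<approx>\<^bsub>2\<^esub> r p q *\<^sub>C (r q p *\<^sub>C (f \<star> sl1 q R))"
        by (intro cong_scale sl1_R_star[OF f p q])
      then have "r p q *\<^sub>C (sl1 q R \<star> f) \<approx>\<^bsub>2\<^esub> f \<star> sl1 q R"
        by (simp add: scaleC_scaleC r_skew[OF p q] complex_vector.scale_one)
      then show ?thesis by (metis cong_sym cong_def)
    qed
    have b: "sl1 p R \<star> f' - r p q *\<^sub>C (f' \<star> sl1 p R) \<in> Jp 2"
      using sl1_R_star[OF f' q p] by (simp add: cong_def)
    have c: "sl1 p R \<star> sl1 q R - sl1 q R \<star> sl1 p R \<in> Jp (Suc 0)"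
      unfolding cong_def[symmetric] by (simp add: cong_J_iff star_G mult.commute)
    have 3: "(f \<star> sl1 q R - r p q *\<^sub>C (sl1 q R \<star> f)) \<otimes> f' +
        (sl1 p R \<star> f' - r p q *\<^sub>C (f' \<star> sl1 p R)) \<otimes> f +
        r p q *\<^sub>C ((sl1 p R \<star> sl1 q R - sl1 q R \<star> sl1 p R) \<otimes> (f' \<star> f)) \<in> F 3"
      by (intro F_add F_scale F_prod[OF a of_type_Jp[OF f']] F_prod[OF b of_type_Jp[OF f]]
          F_prod[OF c ff(2)]) simp_all
    have "\<Delta>' u - u \<otimes> \<epsilon> - \<chi> \<otimes> u = (\<Delta>' (f \<star> f') - ?P \<star>\<star> ?Q) -
        r p q *\<^sub>C (\<Delta>' (f' \<star> f) - ?Q \<star>\<star> ?P) +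
        ((f \<star> sl1 q R - r p q *\<^sub>C (sl1 q R \<star> f)) \<otimes> f' +
        (sl1 p R \<star> f' - r p q *\<^sub>C (f' \<star> sl1 p R)) \<otimes> f +
        r p q *\<^sub>C ((sl1 p R \<star> sl1 q R - sl1 q R \<star> sl1 p R) \<otimes> (f' \<star> f)))"
      by (simp add: u_def \<chi>_def clinear_diff[OF clinear_\<Delta>'] clinear_scaleC[OF clinear_\<Delta>']
          star2_linear tensor_linear complex_vector.scale_right_diff_distrib scaleC_add_right)
    then show "\<Delta>' u - u \<otimes> \<epsilon> - \<chi> \<otimes> u \<in> F (Suc 2)"
      using F_add[OF F_diff[OF 1 F_scale[OF 2]] 3] by (simp add: numeral_3_eq_3 numeral_2_eq_2)
  qed simp
  then show ?thesis by (simp add: u_def cong_def numeral_3_eq_3 numeral_2_eq_2)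
qed

section \<open>Decomposing degree one into types, with dual skew primitive elements\<close>

lemma times_iv: "x \<odot> iv h \<odot> h = x" "x \<odot> h \<odot> iv h = x" if "h \<in> G"
  using that by (simp_all add: mult_assoc iv_left iv_right mult_unit_right)

lemma iv_times: "g \<in> G \<Longrightarrow> h \<in> G \<Longrightarrow> iv (h \<odot> iv g) = g \<odot> iv h"
proof -
  assume g: "g \<in> G" and h: "h \<in> G"
  have "iv (h \<odot> iv g) = iv (h \<odot> iv g) \<odot> (h \<odot> iv g) \<odot> (g \<odot> iv h)"
    using g h by (simp add: mult_assoc[symmetric] times_iv)
  also have "\<dots> = g \<odot> iv h" using g h by (simp add: iv_left times_G iv_G mult_unit_left)
  finally show ?thesis .
qed

lemma times_eq_iff: "g \<in> G \<Longrightarrow> h \<in> G \<Longrightarrow> k \<in> G \<Longrightarrow> g \<odot> iv h = k \<longleftrightarrow> g = k \<odot> h"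
  using times_iv by metis

lemma bij_times: "h \<in> G \<Longrightarrow> bij_betw (\<lambda>g. g \<odot> h) G G"
  by (rule bij_betw_byWitness[where f' = "\<lambda>g. g \<odot> iv h"]) (auto simp: times_iv times_G iv_G)

lemma Rt_e: "g \<in> G \<Longrightarrow> k \<in> G \<Longrightarrow> Rt (iv g) (e k) \<approx>\<^bsub>Suc 0\<^esub> e (k \<odot> g)"
  by (simp add: cong_J_iff times_G iv_G times_eq_iff)

lemma cong_sandwich: "c \<in> J \<Longrightarrow> a \<approx>\<^bsub>Suc 0\<^esub> a' \<Longrightarrow> b \<approx>\<^bsub>Suc 0\<^esub> b' \<Longrightarrow> a \<star> c \<star> b \<approx>\<^bsub>2\<^esub> a' \<star> c \<star> b'"
  by (rule cong_trans[OF cong_star_right0[OF cong_J_right] cong_J_left]) (auto intro: J_star_right)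

text \<open>\<open>C\<close> represents a basis of \<open>J\<close> modulo \<open>Jp 2\<close>: a
  basis of \<open>Jp 2\<close> is extended to one of \<open>J\<close> and then removed. The
  \<open>x c\<close> are coordinate functionals realised as vectors of \<open>H\<close>; that they
  kill \<open>Jp 2\<close> is what \<open>ex_skew_primitive\<close> requires.\<close>

lemma ex_dual_family:
  obtains C x where "finite C" "C \<subseteq> J" "\<And>c b. c \<in> C \<Longrightarrow> b \<in> Jp 2 \<Longrightarrow> b \<bullet> x c = 0"
    "\<And>a. a \<in> J \<Longrightarrow> (\<Sum>c\<in>C. a \<bullet> x c *\<^sub>C c) \<approx>\<^bsub>2\<^esub> a"
proof -
  obtain C2 where C2: "C2 \<subseteq> Jp 2" "\<not> complex_vector.dependent C2" "Jp 2 \<subseteq> cspan C2"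
    using complex_vector.maximal_independent_subset[of "Jp 2"] by metis
  have "Jp 2 \<subseteq> J" using Jp_Suc_subset by (auto simp: Jp_1[symmetric] numeral_2_eq_2)
  then have "C2 \<subseteq> J" using C2 by blast
  then obtain CJ where CJ: "C2 \<subseteq> CJ" "CJ \<subseteq> J" "\<not> complex_vector.dependent CJ" "J \<subseteq> cspan CJ"
    using complex_vector.maximal_independent_subset_extend[OF _ C2(2)] by metis
  obtain B :: "'a set" and d where B: "finite B" "\<And>a. a = (\<Sum>b\<in>B. a \<bullet> b *\<^sub>C d b)"
    using ex_dual_expansion by blast
  have "a \<in> cspan (d ` B)" for a
    by (subst B(2), intro complex_vector.span_sum complex_vector.span_scale)
      (simp add: complex_vector.span_base)
  then have fin: "finite CJ"
    using complex_vector.independent_span_bound[of "d ` B" CJ] CJ(3) B(1) by blast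
  define Y where "Y = complex_vector.extend_basis CJ"
  have Y: "CJ \<subseteq> Y" "\<not> complex_vector.dependent Y" "cspan Y = UNIV"
    using complex_vector.extend_basis_superset[OF CJ(3)] complex_vector.independent_extend_basis[OF CJ(3)]
      complex_vector.span_extend_basis[OF CJ(3)] by (auto simp: Y_def)
  let ?rep = "complex_vector.representation"
  have "\<exists>x. \<forall>a. a \<bullet> x = ?rep Y a c" for c
  proof -
    have "clinear (\<lambda>a. ?rep Y a c)"
      using Y by (intro clinearI)
        (auto simp: complex_vector.representation_add complex_vector.representation_scale)
    then show ?thesis using represent_functional by metis
  qed
  then obtain x where x: "\<And>a c. a \<bullet> x c = ?rep Y a c" by metis
  have 1: "b \<bullet> x c = 0" if "c \<in> CJ - C2" "b \<in> Jp 2" for c b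
  proof -
    have "?rep Y b = ?rep C2 b"
      using Y CJ C2 that by (intro complex_vector.representation_extend) auto
    then show ?thesis
      using that complex_vector.representation_ne_zero[of C2 b c] by (auto simp: x)
  qed
  have 2: "(\<Sum>c\<in>CJ - C2. a \<bullet> x c *\<^sub>C c) \<approx>\<^bsub>2\<^esub> a" if "a \<in> J" for a
  proof -
    have "?rep Y a = ?rep CJ a"
      using Y CJ that by (intro complex_vector.representation_extend) auto
    then have *: "(\<Sum>c\<in>CJ. a \<bullet> x c *\<^sub>C c) = a"
      using CJ that fin by (simp add: x complex_vector.sum_representation_eq subset_iff)
    define s t where "s = (\<Sum>c\<in>CJ - C2. a \<bullet> x c *\<^sub>C c)" and "t = (\<Sum>c\<in>C2. a \<bullet> x c *\<^sub>C c)"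
    have "a = s + t"
      unfolding s_def t_def using sum.subset_diff[OF CJ(1) fin, of "\<lambda>c. a \<bullet> x c *\<^sub>C c"] by (simp only: *)
    moreover have "t \<in> Jp 2"
      unfolding t_def using C2(1) by (intro Jp_sum Jp_scale) auto
    ultimately have "a - s \<in> Jp 2" by simp
    then show ?thesis unfolding s_def cong_def[symmetric] by (rule cong_sym)
  qed
  show thesis by (rule that[of "CJ - C2" x]) (use fin CJ 1 2 in auto)
qed

text \<open>
  The sum over \<open>h\<close> makes the functional invariant under right translations modulo \<open>J\<^sup>2\<close>.
\<close>

definition typed :: "'a \<Rightarrow> 'a dual \<Rightarrow> 'a dual"
  where "typed p c = (\<Sum>h\<in>G. e (p \<odot> h) \<star> Rt (iv h) c \<star> e h)"

text \<open>Each summand sits between the idempotents \<open>e (p \<odot> h)\<close> and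
  \<open>e h\<close>. So \<open>d\<close> acts from the left, and \<open>Lt p d\<close> from the
  right, by the same scalar, the value of \<open>d\<close> at \<open>p \<odot> h\<close>. Right
  translation by \<open>g\<close> merely permutes the summands, sending \<open>h\<close> to
  \<open>h \<odot> iv g\<close>.\<close>

lemma of_type_typed:
  assumes p: "p \<in> G" and c: "c \<in> J"
  shows "of_type p (typed p c)"
  unfolding of_type_def
proof (intro conjI ballI allI)
  show "typed p c \<in> J"
    unfolding typed_def
    by (rule complex_vector.subspace_sum[OF subspace_J], rule J_star_left, rule J_star_right)
      (simp add: Rt_J iv_G c)
next
  fix g assume g: "g \<in> G"
  define t where "t h = e (p \<odot> h) \<star> Rt (iv h) c \<star> e h" for h
  have "Rt g (t h) \<approx>\<^bsub>2\<^esub> t (h \<odot> iv g)" if h: "h \<in> G" for h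
  proof -
    have "iv (iv g) = g"
      using times_iv(1)[OF g, of "iv (iv g)"] iv_left[OF iv_G[OF g]] by (simp add: mult_unit_left)
    then have shift: "Rt g (e k) \<approx>\<^bsub>Suc 0\<^esub> e (k \<odot> iv g)" if "k \<in> G" for k
      using Rt_e[OF iv_G[OF g] that] by simp
    have "Rt g (Rt (iv h) c) = Rt (iv (h \<odot> iv g)) c"
      using g h by (intro dual_eqI) (simp add: iv_times mult_assoc)
    then have "Rt g (t h) = Rt g (e (p \<odot> h)) \<star> Rt (iv (h \<odot> iv g)) c \<star> Rt g (e h)"
      using g by (simp add: t_def Rt_star)
    also have "\<dots> \<approx>\<^bsub>2\<^esub> e (p \<odot> h \<odot> iv g) \<star> Rt (iv (h \<odot> iv g)) c \<star> e (h \<odot> iv g)"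
      using g h p c by (intro cong_sandwich shift Rt_J iv_G times_G)
    finally show ?thesis by (simp add: t_def mult_assoc)
  qed
  then have "Rt g (typed p c) \<approx>\<^bsub>2\<^esub> (\<Sum>h\<in>G. t (h \<odot> iv g))"
    unfolding typed_def t_def[symmetric] Rt_sum by (intro cong_sum)
  also have "\<dots> = typed p c"
    unfolding typed_def t_def[symmetric]
    by (rule sum.reindex_bij_betw[OF bij_times[OF iv_G[OF g]]])
  finally show "Rt g (typed p c) \<approx>\<^bsub>2\<^esub> typed p c" .
next
  fix d
  have "d \<star> (e (p \<odot> h) \<star> Rt (iv h) c \<star> e h) \<approx>\<^bsub>2\<^esub> e (p \<odot> h) \<star> Rt (iv h) c \<star> e h \<star> Lt p d"
    if h: "h \<in> G" for h
  proof -
    let ?c = "Rt (iv h) c"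
    have c': "?c \<in> J" using h c by (intro Rt_J iv_G)
    have 1: "d \<star> e (p \<odot> h) \<approx>\<^bsub>Suc 0\<^esub> d \<bullet> (p \<odot> h) *\<^sub>C e (p \<odot> h)"
      using star_e_cong[of "p \<odot> h" d] p h by (simp add: times_G)
    have 2: "e h \<star> Lt p d \<approx>\<^bsub>Suc 0\<^esub> d \<bullet> (p \<odot> h) *\<^sub>C e h"
      using e_star_cong[of h "Lt p d"] h by simp
    have "d \<star> (e (p \<odot> h) \<star> ?c \<star> e h) = (d \<star> e (p \<odot> h)) \<star> ?c \<star> e h" by (simp only: star_assoc)
    also have "\<dots> \<approx>\<^bsub>2\<^esub> (d \<bullet> (p \<odot> h) *\<^sub>C e (p \<odot> h)) \<star> ?c \<star> e h"
      by (intro cong_sandwich c' 1 cong_refl)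
    also have "\<dots> = e (p \<odot> h) \<star> ?c \<star> (d \<bullet> (p \<odot> h) *\<^sub>C e h)" by (simp add: star_linear)
    also have "\<dots> \<approx>\<^bsub>2\<^esub> e (p \<odot> h) \<star> ?c \<star> (e h \<star> Lt p d)"
      by (intro cong_sandwich c' cong_sym[OF 2] cong_refl)
    finally show ?thesis by (simp only: star_assoc)
  qed
  then show "d \<star> typed p c \<approx>\<^bsub>2\<^esub> typed p c \<star> Lt p d"
    unfolding typed_def star_sum_left star_sum_right by (intro cong_sum)
qed

text \<open>Subtract from \<open>a\<close> its value at \<open>p\<close> and from \<open>b\<close>
  its value at the unit. Between \<open>e p\<close> and \<open>e (unit H)\<close> their product then
  lies in \<open>Jp 2\<close>, where \<open>y\<close> vanishes, and expanding gives a Leibniz rule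
  with one constant error term. Subtracting the multiple
  \<open>(e p \<star> e (unit H)) \<bullet> y\<close> of \<open>p\<close> from the representing
  vector removes that error.\<close>

lemma ex_skew_primitive:
  assumes p: "p \<in> G" and y: "\<And>b. b \<in> Jp 2 \<Longrightarrow> b \<bullet> y = 0"
  obtains v where "\<Delta> v = v \<otimes> unit H + p \<otimes> v"
    "\<And>a. a \<bullet> v = (e p \<star> a \<star> e (unit H)) \<bullet> y - a \<bullet> p * (e p \<star> e (unit H)) \<bullet> y"
proof -
  let ?e = "e (unit H)"
  have l: "clinear (\<lambda>a. (e p \<star> a \<star> ?e) \<bullet> y - a \<bullet> p * (e p \<star> ?e) \<bullet> y)" by (intro lin)
  obtain v where v: "\<And>a. a \<bullet> v = (e p \<star> a \<star> ?e) \<bullet> y - a \<bullet> p * (e p \<star> ?e) \<bullet> y"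
    using represent_functional[OF l] by blast
  have "\<Delta> v = v \<otimes> unit H + p \<otimes> v"
  proof (rule comult_eqI)
    fix a b
    define a' b' where "a' = a - a \<bullet> p *\<^sub>C \<epsilon>" and "b' = b - b \<bullet> unit H *\<^sub>C \<epsilon>"
    have "e p \<star> a' \<in> J" "b' \<star> ?e \<in> J"
      using p unit_G by (auto simp: J_def a'_def b'_def star_G minus_dual.rep_eq scaleC_dual.rep_eq counit_G)
    then have "(e p \<star> a') \<star> (b' \<star> ?e) \<in> Jp 2"
      using Jp_SucI[of "e p \<star> a'" "b' \<star> ?e" "Suc 0"] by (simp only: Jp_1 numeral_2_eq_2)
    from y[OF this] have "(e p \<star> (a \<star> b) \<star> ?e) \<bullet> y = b \<bullet> unit H * (e p \<star> a \<star> ?e) \<bullet> y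
        + a \<bullet> p * (e p \<star> b \<star> ?e) \<bullet> y - a \<bullet> p * b \<bullet> unit H * (e p \<star> ?e) \<bullet> y"
      by (simp add: a'_def b'_def star_linear star_assoc minus_dual.rep_eq scaleC_dual.rep_eq
          plus_dual.rep_eq algebra_simps)
    then have "(a \<star> b) \<bullet> v = a \<bullet> v * b \<bullet> unit H + a \<bullet> p * b \<bullet> v"
      using p by (simp add: v star_G algebra_simps)
    then show "(a \<star> b) \<bullet> v = tensor_lift (\<lambda>u w. a \<bullet> u * b \<bullet> w) (v \<otimes> unit H + p \<otimes> v)"
      by (simp add: clinear_add[OF clinear_tensor_lift[OF lin_ev2]] tensor_lift_tensor_prod[OF lin_ev2])
  qed
  then show thesis using v by (rule that)
qed

lemma sum_e: "(\<Sum>g\<in>G. e g) \<approx>\<^bsub>Suc 0\<^esub> \<epsilon>"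
  by (rule cong_sym) (use cong_sum_e[of \<epsilon>] in \<open>simp add: counit_G complex_vector.scale_one\<close>)

text \<open>By \<open>sum_e\<close>, \<open>a\<close> is the sum of its components
  \<open>e (p \<odot> h) \<star> a \<star> e h\<close>. Right translation by \<open>h\<close> moves
  such a component to the idempotents of \<open>p\<close> and the unit, where the dual family
  expands it with coefficients read by the \<open>v p c\<close>; translating back yields the
  summands of \<open>typed p c\<close>.\<close>

lemma ex_typed_family:
  obtains I :: "('a dual \<times> 'a) set" and p f v where
    "finite I" "\<And>i. i \<in> I \<Longrightarrow> p i \<in> G" "\<And>i. i \<in> I \<Longrightarrow> of_type (p i) (f i)"
    "\<And>i. i \<in> I \<Longrightarrow> \<Delta> (v i) = v i \<otimes> unit H + p i \<otimes> v i"
    "\<And>a. a \<in> J \<Longrightarrow> (\<Sum>i\<in>I. f i \<star> Lt (v i) a) \<approx>\<^bsub>2\<^esub> a"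
proof -
  obtain C x where C: "finite C" "C \<subseteq> J" and x: "\<And>c b. c \<in> C \<Longrightarrow> b \<in> Jp 2 \<Longrightarrow> b \<bullet> x c = 0"
    and exp: "\<And>a. a \<in> J \<Longrightarrow> (\<Sum>c\<in>C. a \<bullet> x c *\<^sub>C c) \<approx>\<^bsub>2\<^esub> a"
    using ex_dual_family by blast
  let ?e = "e (unit H)"
  have "\<exists>v. \<Delta> v = v \<otimes> unit H + p \<otimes> v \<and>
      (\<forall>a. a \<bullet> v = (e p \<star> a \<star> ?e) \<bullet> x c - a \<bullet> p * (e p \<star> ?e) \<bullet> x c)"
    if "p \<in> G" "c \<in> C" for p c
    using ex_skew_primitive[OF that(1) x[OF that(2)]] by metis
  then obtain v where v: "\<And>p c. p \<in> G \<Longrightarrow> c \<in> C \<Longrightarrow> \<Delta> (v p c) = v p c \<otimes> unit H + p \<otimes> v p c"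
    and v_apply: "\<And>p c a. p \<in> G \<Longrightarrow> c \<in> C \<Longrightarrow>
      a \<bullet> v p c = (e p \<star> a \<star> ?e) \<bullet> x c - a \<bullet> p * (e p \<star> ?e) \<bullet> x c"
    by metis
  have "(\<Sum>c\<in>C. \<Sum>p\<in>G. typed p c \<star> Lt (v p c) a) \<approx>\<^bsub>2\<^esub> a" if a: "a \<in> J" for a
  proof -
    have inner: "(\<Sum>c\<in>C. e (p \<odot> h) \<star> Rt (iv h) c \<star> e h \<star> Lt (v p c) a) \<approx>\<^bsub>2\<^esub> e (p \<odot> h) \<star> a \<star> e h"
      if p: "p \<in> G" and h: "h \<in> G" for p h
    proof -
      let ?b = "e p \<star> Rt h a \<star> ?e"
      have bJ: "?b \<in> J" by (intro J_star_left J_star_right Rt_J h a)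
      have summand: "e (p \<odot> h) \<star> Rt (iv h) c \<star> e h \<star> Lt (v p c) a \<approx>\<^bsub>2\<^esub>
          ?b \<bullet> x c *\<^sub>C (e (p \<odot> h) \<star> Rt (iv h) c \<star> e h)" if c: "c \<in> C" for c
      proof -
        \<comment> \<open>Beside \<open>e h\<close> the functional \<open>Lt (v p c) a\<close>
          counts only through its value at \<open>h\<close>. The correction term of
          \<open>v p c\<close> vanishes there because \<open>Rt h a\<close> lies in
          \<open>J\<close>.\<close>
        have "Lt (v p c) a \<bullet> h = Rt h a \<bullet> v p c" by simp
        also have "\<dots> = ?b \<bullet> x c"
          unfolding v_apply[OF p c] using a p h by (simp add: J_def times_G)
        finally have "e h \<star> Lt (v p c) a \<approx>\<^bsub>Suc 0\<^esub> ?b \<bullet> x c *\<^sub>C e h"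
          using e_star_cong[OF h, of "Lt (v p c) a"] by simp
        then have "e (p \<odot> h) \<star> Rt (iv h) c \<star> (e h \<star> Lt (v p c) a) \<approx>\<^bsub>2\<^esub>
            e (p \<odot> h) \<star> Rt (iv h) c \<star> (?b \<bullet> x c *\<^sub>C e h)"
          using c C h by (intro cong_sandwich Rt_J iv_G cong_refl) auto
        then show ?thesis by (simp add: star_linear star_assoc)
      qed
      have "(\<Sum>c\<in>C. e (p \<odot> h) \<star> Rt (iv h) c \<star> e h \<star> Lt (v p c) a) \<approx>\<^bsub>2\<^esub>
          (\<Sum>c\<in>C. ?b \<bullet> x c *\<^sub>C (e (p \<odot> h) \<star> Rt (iv h) c \<star> e h))"
        by (intro cong_sum summand)
      also have "\<dots> = e (p \<odot> h) \<star> Rt (iv h) (\<Sum>c\<in>C. ?b \<bullet> x c *\<^sub>C c) \<star> e h"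
        by (simp add: Rt_sum Rt_scale star_sum_left star_sum_right star_linear)
      also have "\<dots> \<approx>\<^bsub>2\<^esub> e (p \<odot> h) \<star> Rt (iv h) ?b \<star> e h"
        by (intro cong_star_left0 cong_star_right0 Rt_cong exp bJ iv_G h)
      also have "\<dots> = e (p \<odot> h) \<star> (Rt (iv h) (e p) \<star> a \<star> Rt (iv h) ?e) \<star> e h"
      proof -
        have "Rt (iv h) (Rt h a) = a"
          using h by (intro dual_eqI) (simp add: times_iv)
        then show ?thesis using h by (simp add: Rt_star iv_G)
      qed
      also have "\<dots> = (e (p \<odot> h) \<star> Rt (iv h) (e p)) \<star> a \<star> (Rt (iv h) ?e \<star> e h)"
        by (simp only: star_assoc)
      also have "\<dots> \<approx>\<^bsub>2\<^esub> e (p \<odot> h) \<star> a \<star> e h"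
        using p h unit_G
        by (intro cong_sandwich a) (auto simp: cong_J_iff star_G times_G iv_G times_eq_iff mult_unit_left)
      finally show ?thesis .
    qed
    have "(\<Sum>c\<in>C. \<Sum>p\<in>G. typed p c \<star> Lt (v p c) a) =
        (\<Sum>h\<in>G. \<Sum>p\<in>G. \<Sum>c\<in>C. e (p \<odot> h) \<star> Rt (iv h) c \<star> e h \<star> Lt (v p c) a)"
      unfolding typed_def star_sum_left
      by (subst (3) sum.swap, subst sum.swap, subst (2) sum.swap) (rule refl)
    also have "\<dots> \<approx>\<^bsub>2\<^esub> (\<Sum>h\<in>G. \<Sum>p\<in>G. e (p \<odot> h) \<star> a \<star> e h)"
      by (intro cong_sum inner)
    also have "\<dots> = (\<Sum>h\<in>G. \<Sum>p\<in>G. e p \<star> a \<star> e h)"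
      by (rule sum.cong[OF refl])
        (rule sum.reindex_bij_betw[OF bij_times, of _ "\<lambda>q. e q \<star> a \<star> e _"])
    also have "\<dots> = (\<Sum>p\<in>G. e p) \<star> a \<star> (\<Sum>h\<in>G. e h)"
      by (simp add: star_sum_left star_sum_right)
    also have "\<dots> \<approx>\<^bsub>2\<^esub> \<epsilon> \<star> a \<star> \<epsilon>"
      by (intro cong_sandwich a sum_e)
    finally show ?thesis by simp
  qed
  then have "(\<Sum>i\<in>C \<times> G. typed (snd i) (fst i) \<star> Lt (v (snd i) (fst i)) a) \<approx>\<^bsub>2\<^esub> a" if "a \<in> J" for a
    using that by (simp add: sum.cartesian_product case_prod_beta)
  then show thesis
    using C v of_type_typed finite_G
    by (intro that[of "C \<times> G" snd "\<lambda>i. typed (snd i) (fst i)" "\<lambda>i. v (snd i) (fst i)"]) auto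
qed

section \<open>The Euler derivation\<close>

text \<open>The operator is a derivation only up to the filtration, so the eigenvalue comes by
  induction on the degree. In a product \<open>c \<star> b\<close> with \<open>c\<close> from
  \<open>J\<close>, the part with \<open>\<theta> c\<close> contributes the product once and the
  part with \<open>\<theta> b\<close> the remaining times.\<close>

lemma euler:
  obtains I :: "('a dual \<times> 'a) set" and p f v where
    "finite I" "\<And>i. i \<in> I \<Longrightarrow> p i \<in> G"
    "\<And>i. i \<in> I \<Longrightarrow> \<Delta> (v i) = v i \<otimes> unit H + p i \<otimes> v i"
    "\<And>i. i \<in> I \<Longrightarrow> f i \<in> J"
    "\<And>m a. a \<in> Jp (Suc m) \<Longrightarrow>
      (\<Sum>i\<in>I. f i \<star> Lt (v i) a) \<approx>\<^bsub>Suc (Suc m)\<^esub> of_nat (Suc m) *\<^sub>C a"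
proof -
  obtain I :: "('a dual \<times> 'a) set" and p f v where
    I: "finite I" and p: "\<And>i. i \<in> I \<Longrightarrow> p i \<in> G" and f: "\<And>i. i \<in> I \<Longrightarrow> of_type (p i) (f i)"
    and v: "\<And>i. i \<in> I \<Longrightarrow> \<Delta> (v i) = v i \<otimes> unit H + p i \<otimes> v i"
    and exp: "\<And>a. a \<in> J \<Longrightarrow> (\<Sum>i\<in>I. f i \<star> Lt (v i) a) \<approx>\<^bsub>2\<^esub> a"
    using ex_typed_family by blast
  define \<theta> where "\<theta> a = (\<Sum>i\<in>I. f i \<star> Lt (v i) a)" for a
  \<comment> \<open>To gain the degree missing in \<open>of_type_star\<close>, replace
    \<open>c\<close> by \<open>\<theta> c\<close>, a sum of products \<open>f j \<star> b\<close>.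
    Passing \<open>b\<close> across \<open>f i\<close> costs \<open>Lt (p i) b\<close>; passing
    \<open>f j\<close> costs \<open>r (p j) (p i)\<close>, which by \<open>of_type_Lt\<close> is the
    factor by which \<open>Lt (p i)\<close> scales \<open>f j\<close>.\<close>
  have commute: "c \<star> f i \<approx>\<^bsub>3\<^esub> f i \<star> Lt (p i) c" if c: "c \<in> J" and i: "i \<in> I" for c i
  proof -
    have fJ: "f j \<in> Jp (Suc 0)" if "j \<in> I" for j using of_type_Jp f that by blast
    have summand: "(f j \<star> b) \<star> f i \<approx>\<^bsub>3\<^esub> f i \<star> Lt (p i) (f j \<star> b)" if j: "j \<in> I" for j b
    proof -
      have "f j \<star> (b \<star> f i) \<approx>\<^bsub>Suc 0 + 2\<^esub> f j \<star> (f i \<star> Lt (p i) b)"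
        by (intro cong_star_left fJ j of_type_star f i)
      then have "(f j \<star> b) \<star> f i \<approx>\<^bsub>3\<^esub> (f j \<star> f i) \<star> Lt (p i) b"
        by (simp add: star_assoc numeral_3_eq_3 numeral_2_eq_2)
      also have "\<dots> \<approx>\<^bsub>3\<^esub> (r (p j) (p i) *\<^sub>C (f i \<star> f j)) \<star> Lt (p i) b"
        by (intro cong_star_right0 of_type_commute f p i j)
      also have "\<dots> = f i \<star> ((r (p j) (p i) *\<^sub>C f j) \<star> Lt (p i) b)"
        by (simp add: star_linear star_assoc)
      also have "\<dots> \<approx>\<^bsub>3\<^esub> f i \<star> (Lt (p i) (f j) \<star> Lt (p i) b)"
      proof -
        have "(r (p j) (p i) *\<^sub>C f j) \<star> Lt (p i) b \<approx>\<^bsub>2\<^esub> Lt (p i) (f j) \<star> Lt (p i) b"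
          by (intro cong_star_right0 cong_sym[OF of_type_Lt] f p i j)
        from cong_star_left[OF this fJ[OF i]] show ?thesis
          by (simp add: numeral_3_eq_3 numeral_2_eq_2)
      qed
      also have "\<dots> = f i \<star> Lt (p i) (f j \<star> b)" by (simp add: Lt_star p i)
      finally show ?thesis .
    qed
    have "c \<star> f i \<approx>\<^bsub>2 + Suc 0\<^esub> \<theta> c \<star> f i"
      unfolding \<theta>_def by (intro cong_star_right fJ i cong_sym[OF exp] c)
    then have "c \<star> f i \<approx>\<^bsub>3\<^esub> \<theta> c \<star> f i" by (simp add: numeral_3_eq_3 numeral_2_eq_2)
    also have "\<dots> \<approx>\<^bsub>3\<^esub> f i \<star> Lt (p i) (\<theta> c)"
      unfolding \<theta>_def star_sum_left star_sum_right Lt_sum by (intro cong_sum summand)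
    also have "\<dots> \<approx>\<^bsub>3\<^esub> f i \<star> Lt (p i) c"
    proof -
      have "Lt (p i) (\<theta> c) \<approx>\<^bsub>2\<^esub> Lt (p i) c"
        unfolding \<theta>_def by (intro Lt_cong p i exp c)
      from cong_star_left[OF this fJ[OF i]] show ?thesis
        by (simp add: numeral_3_eq_3 numeral_2_eq_2)
    qed
    finally show ?thesis .
  qed
  have lin\<theta>: "clinear (\<lambda>a. \<theta> a - of_nat m *\<^sub>C a)" for m
    unfolding \<theta>_def by (intro lin)
  have "\<theta> a \<approx>\<^bsub>Suc (Suc m)\<^esub> of_nat (Suc m) *\<^sub>C a" if "a \<in> Jp (Suc m)" for a m
    using that
  proof (induction m arbitrary: a)
    case 0
    then show ?case
      using exp by (simp add: \<theta>_def Jp_1 complex_vector.scale_one numeral_2_eq_2)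
  next
    case (Suc m)
    show ?case
      unfolding cong_def
    proof (rule Jp_Suc_mem[OF lin\<theta> subspace_Jp _ Suc.prems])
      fix c b assume c: "c \<in> J" and b: "b \<in> Jp (Suc m)"
      let ?n = "Suc (Suc (Suc m))"
      \<comment> \<open>The error of \<open>commute\<close> has degree 3 and
        \<open>Lt (v i) b\<close> has degree \<open>m\<close>, which adds up to \<open>?n\<close>.
        With precision 2 the error would have the degree of \<open>c \<star> b\<close>
        itself.\<close>
      have swap: "f i \<star> Lt (p i) c \<star> Lt (v i) b \<approx>\<^bsub>?n\<^esub> c \<star> f i \<star> Lt (v i) b" if i: "i \<in> I" for i
        using cong_star_right[OF cong_sym[OF commute[OF c i]] Lt_skew_Jp[OF v[OF i] p[OF i] b]]
        by (simp add: numeral_3_eq_3)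
      have "\<theta> (c \<star> b) = \<theta> c \<star> b + (\<Sum>i\<in>I. f i \<star> Lt (p i) c \<star> Lt (v i) b)"
        by (simp add: \<theta>_def Lt_skew[OF v] star_add_right star_sum_left sum.distrib star_assoc)
      also have "\<dots> \<approx>\<^bsub>?n\<^esub> \<theta> c \<star> b + (\<Sum>i\<in>I. c \<star> f i \<star> Lt (v i) b)"
        by (intro cong_add cong_refl cong_sum swap)
      also have "\<dots> = \<theta> c \<star> b + c \<star> \<theta> b"
        by (simp add: \<theta>_def star_sum_right star_assoc)
      also have "\<dots> \<approx>\<^bsub>?n\<^esub> c \<star> b + c \<star> (of_nat (Suc m) *\<^sub>C b)"
      proof (rule cong_add)
        show "\<theta> c \<star> b \<approx>\<^bsub>?n\<^esub> c \<star> b"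
          using cong_star_right[OF exp[OF c] b] by (simp add: \<theta>_def numeral_2_eq_2)
        show "c \<star> \<theta> b \<approx>\<^bsub>?n\<^esub> c \<star> (of_nat (Suc m) *\<^sub>C b)"
          using cong_star_left[OF Suc.IH[OF b], of c "Suc 0"] c by (simp add: Jp_1)
      qed
      also have "\<dots> = of_nat (Suc (Suc m)) *\<^sub>C (c \<star> b)"
        by (simp only: star_scale_right of_nat_Suc[of "Suc m"] scaleC_add_left scaleC_one)
      finally show "\<theta> (c \<star> b) - of_nat (Suc (Suc m)) *\<^sub>C (c \<star> b) \<in> Jp ?n"
        by (simp add: cong_def)
    qed
  qed
  then have "(\<Sum>i\<in>I. f i \<star> Lt (v i) a) \<approx>\<^bsub>Suc (Suc m)\<^esub> of_nat (Suc m) *\<^sub>C a"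
    if "a \<in> Jp (Suc m)" for a m
    using that unfolding \<theta>_def by blast
  moreover have "f i \<in> J" if "i \<in> I" for i
    using f[OF that] by (rule of_type_J)
  ultimately show thesis using I p v by (intro that)
qed

section \<open>The annihilator of a subalgebra containing the generators\<close>

lemma subalgebra_generated:
  assumes T: "subalgebra H T" and S: "{x. grouplike H x \<or> skew_primitive H x} \<subseteq> T"
  shows "T = UNIV"
proof -
  obtain I :: "('a dual \<times> 'a) set" and p f v where
    "finite I" and p: "\<And>i. i \<in> I \<Longrightarrow> p i \<in> G"
    and v: "\<And>i. i \<in> I \<Longrightarrow> \<Delta> (v i) = v i \<otimes> unit H + p i \<otimes> v i"
    and f: "\<And>i. i \<in> I \<Longrightarrow> f i \<in> J"
    and eul: "\<And>m a. a \<in> Jp (Suc m) \<Longrightarrow>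
      (\<Sum>i\<in>I. f i \<star> Lt (v i) a) \<approx>\<^bsub>Suc (Suc m)\<^esub> of_nat (Suc m) *\<^sub>C a"
    by (rule euler) (rule that)
  have vT: "v i \<in> T" if "i \<in> I" for i
    using S p[OF that] v[OF that] unit_G unfolding skew_primitive_def G_def by blast
  define K where "K = {a. \<forall>x\<in>T. a \<bullet> x = 0}"
  have K: "K \<subseteq> Jp (Suc m)" for m
  proof (induction m)
    case 0
    then show ?case using S by (auto simp: K_def Jp_1 J_def G_def)
  next
    case (Suc m)
    show ?case
    proof
      fix a assume a: "a \<in> K"
      have "Lt (v i) a \<in> K" if "i \<in> I" for i
        using a T vT[OF that] by (auto simp: K_def subalgebra_def)
      then have "(\<Sum>i\<in>I. f i \<star> Lt (v i) a) \<in> Jp (Suc (Suc m))"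
        using Suc f by (intro Jp_sum Jp_SucI) auto
      moreover have "of_nat (Suc m) *\<^sub>C a \<approx>\<^bsub>Suc (Suc m)\<^esub> (\<Sum>i\<in>I. f i \<star> Lt (v i) a)"
        using a Suc by (intro cong_sym[OF eul]) auto
      ultimately have "of_nat (Suc m) *\<^sub>C a \<in> Jp (Suc (Suc m))"
        using cong_Jp by blast
      \<comment> \<open>Characteristic 0 once more: the Euler eigenvalue of a positive degree is
        invertible.\<close>
      then have "(1 / of_nat (Suc m)) *\<^sub>C of_nat (Suc m) *\<^sub>C a \<in> Jp (Suc (Suc m))"
        by (rule Jp_scale)
      then show "a \<in> Jp (Suc (Suc m))"
        using of_nat_neq_0[of m, where 'a = complex]
        by (simp add: scaleC_scaleC complex_vector.scale_one del: of_nat_Suc)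
    qed
  qed
  have "x \<in> T" for x
  proof (rule ccontr)
    assume "x \<notin> T"
    then obtain a where a: "\<And>y. y \<in> T \<Longrightarrow> a \<bullet> y = 0" "a \<bullet> x = 1"
      using clinear_separate[of T x] T unfolding subalgebra_def by blast
    then have "a \<in> K" by (simp add: K_def)
    then have "a \<in> Jp N" using K[of N] Jp_Suc_subset by blast
    then show False using a(2) nilpotent by (auto simp: zero_dual.rep_eq)
  qed
  then show ?thesis by blast
qed

end

section \<open>Pointedness\<close>

text \<open>\<open>pointed\<close> speaks only of comodules inside
  \<open>nat \<Rightarrow>\<^sub>0 complex\<close>, so the quotient of the space by \<open>S\<close>
  is realised there. \<open>\<tau>\<close> records the coordinates along a complement of
  \<open>S\<close> and \<open>\<sigma>\<close> lifts them back.\<close>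

lemma ex_quotient_map:
  fixes S :: "'a::complex_vector set"
  assumes S: "csubspace S" and fin: "\<exists>B :: 'a set. finite_dimensional_vector_space scaleC B"
  obtains \<tau> :: "'a \<Rightarrow> nat \<Rightarrow>\<^sub>0 complex" and \<sigma>
  where "clinear \<tau>" "clinear \<sigma>" "\<And>x. x - \<sigma> (\<tau> x) \<in> S" "\<And>x. \<tau> x = 0 \<longleftrightarrow> x \<in> S"
proof -
  obtain C where C: "C \<subseteq> S" "\<not> complex_vector.dependent C" "S \<subseteq> cspan C"
    using complex_vector.maximal_independent_subset[of S] by metis
  define Y where "Y = complex_vector.extend_basis C"
  have Y: "C \<subseteq> Y" "\<not> complex_vector.dependent Y" "cspan Y = UNIV"
    using complex_vector.extend_basis_superset[OF C(2)] complex_vector.independent_extend_basis[OF C(2)]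
      complex_vector.span_extend_basis[OF C(2)] by (auto simp: Y_def)
  obtain B :: "'a set" and c where B: "finite B" "\<And>x. x = (\<Sum>b\<in>B. dual_apply (c b) x *\<^sub>C b)"
    using ex_dual_basis[OF fin] by blast
  have "x \<in> cspan B" for x
    by (subst B(2)) (intro complex_vector.span_sum complex_vector.span_scale complex_vector.span_base)
  then have finY: "finite Y"
    using complex_vector.independent_span_bound[OF B(1) Y(2)] by blast
  define D where "D = Y - C"
  have finD: "finite D" using finY by (simp add: D_def)
  then obtain n :: "'a \<Rightarrow> nat" where n: "inj_on n D" using finite_imp_inj_to_nat_seg by blast
  let ?rep = "complex_vector.representation Y"
  have rep_lin [lin]: "clinear (\<lambda>x. ?rep x d)" for d
    using Y by (intro clinearI)
      (auto simp: complex_vector.representation_add complex_vector.representation_scale)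
  define \<tau> where "\<tau> x = (\<Sum>d\<in>D. ?rep x d *\<^sub>C Poly_Mapping.single (n d) (1 :: complex))" for x
  define \<sigma> where "\<sigma> w = (\<Sum>d\<in>D. Poly_Mapping.lookup w (n d) *\<^sub>C d)" for w
  have "clinear (\<lambda>w :: nat \<Rightarrow>\<^sub>0 complex. Poly_Mapping.lookup w k)" for k
    by (rule clinearI) (simp_all add: lookup_add scaleC_poly_mapping.rep_eq)
  then have lin\<sigma>: "clinear \<sigma>" unfolding \<sigma>_def by (intro lin)
  have lin\<tau>: "clinear \<tau>" unfolding \<tau>_def by (intro lin)
  have lookup_sum: "Poly_Mapping.lookup (\<Sum>d\<in>D. f d) k = (\<Sum>d\<in>D. Poly_Mapping.lookup (f d) k)"
    for f :: "'a \<Rightarrow> nat \<Rightarrow>\<^sub>0 complex" and k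
    by (induction D rule: infinite_finite_induct) (simp_all add: lookup_add)
  have \<tau>_lookup: "Poly_Mapping.lookup (\<tau> x) (n d) = ?rep x d" if "d \<in> D" for x d
  proof -
    have "Poly_Mapping.lookup (\<tau> x) (n d) = (\<Sum>d'\<in>D. if d' = d then ?rep x d else 0)"
      unfolding \<tau>_def lookup_sum scaleC_poly_mapping.rep_eq
      using n that by (intro sum.cong) (auto simp: lookup_single when_def inj_on_eq_iff)
    then show ?thesis using finD that by simp
  qed
  have diff: "x - \<sigma> (\<tau> x) \<in> S" for x
  proof -
    define s t where "s = (\<Sum>d\<in>D. ?rep x d *\<^sub>C d)" and "t = (\<Sum>d\<in>C. ?rep x d *\<^sub>C d)"
    have *: "(\<Sum>d\<in>Y. ?rep x d *\<^sub>C d) = x"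
      using Y finY by (simp add: complex_vector.sum_representation_eq)
    have "x = s + t"
      unfolding s_def t_def D_def using sum.subset_diff[OF Y(1) finY, of "\<lambda>d. ?rep x d *\<^sub>C d"]
      by (simp only: *)
    moreover have "t \<in> S"
      unfolding t_def using C(1)
      by (intro complex_vector.subspace_sum[OF S] complex_vector.subspace_scale[OF S]) auto
    moreover have "\<sigma> (\<tau> x) = s"
      unfolding \<sigma>_def s_def by (intro sum.cong) (simp_all add: \<tau>_lookup)
    ultimately show ?thesis by simp
  qed
  have "\<tau> x = 0 \<longleftrightarrow> x \<in> S" for x
  proof
    show "x \<in> S" if "\<tau> x = 0" using diff[of x] that by (simp add: clinear_zero[OF lin\<sigma>])
    assume "x \<in> S"
    then have "?rep x = complex_vector.representation C x"
      using Y C by (intro complex_vector.representation_extend) auto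
    then have "?rep x d = 0" if "d \<in> D" for d
      using that complex_vector.representation_ne_zero[of C x d] by (auto simp: D_def)
    then show "\<tau> x = 0" by (simp add: \<tau>_def)
  qed
  with lin\<tau> lin\<sigma> diff show thesis by (rule that)
qed

context fd_hopf_algebra
begin

text \<open>The left action of the dual on \<open>H\<close> obtained from the right regular
  coaction. Its stable subspaces are the subcomodules of \<open>H\<close>, and the action turns
  comodule questions into module questions.\<close>

definition hit :: "'a dual \<Rightarrow> 'a \<Rightarrow> 'a" where "hit a x = slice a (\<Delta> x)"

lemma lin_hit [lin]: "clinear f \<Longrightarrow> clinear (\<lambda>x. hit a (f x))"
  unfolding hit_def by (intro lin)

lemma lin_hit_fun [lin]: "clinear h \<Longrightarrow> clinear (\<lambda>z. hit (h z) y)"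
  unfolding hit_def by (intro lin)

lemma hit_apply: "b \<bullet> hit a x = (b \<star> a) \<bullet> x"
  unfolding hit_def slice_def star_apply
  by (subst tensor_lift_comp)
    (auto intro!: slice_bil clinear_dual_apply
      simp: clinear_scaleC[OF clinear_dual_apply] mult.commute)

lemma hit_hit: "hit a (hit b x) = hit (a \<star> b) x"
  by (rule dual_separates) (simp add: hit_apply star_assoc)

lemma hit_one: "hit \<epsilon> x = x"
  by (rule dual_separates) (simp add: hit_apply)

text \<open>
  A minimal subcomodule of \<open>H / S\<close>, transported into \<open>nat \<Rightarrow>\<^sub>0 complex\<close>, is simple; by pointedness it
  is spanned by one vector, whose coefficient is a grouplike element.
\<close>

lemma ex_grouplike_mod:
  assumes pointed: "pointed H" and S: "csubspace S" "S \<noteq> UNIV"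
    and stable: "\<And>a x. x \<in> S \<Longrightarrow> hit a x \<in> S"
  obtains x g where "x \<notin> S" "g \<in> G" "\<And>a. hit a x - a \<bullet> g *\<^sub>C x \<in> S"
proof -
  obtain \<tau> :: "'a \<Rightarrow> nat \<Rightarrow>\<^sub>0 complex" and \<sigma>
    where lin\<tau>: "clinear \<tau>" and lin\<sigma>: "clinear \<sigma>"
      and \<sigma>\<tau>: "\<And>x. x - \<sigma> (\<tau> x) \<in> S" and \<tau>0: "\<And>x. \<tau> x = 0 \<longleftrightarrow> x \<in> S"
    using ex_quotient_map[OF S(1) finite_dim] by blast
  note [lin] = lin_comp[OF lin\<tau>] lin_comp[OF lin\<sigma>]
  have \<tau>_cong: "\<tau> x = \<tau> y" if "x - y \<in> S" for x y
    using that \<tau>0[of "x - y"] by (simp add: clinear_diff[OF lin\<tau>])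
  obtain B :: "'a set" where B: "finite_dimensional_vector_space scaleC B"
    using finite_dim ..
  interpret B: finite_dimensional_vector_space scaleC B by fact
  \<comment> \<open>A stable \<open>U\<close> of least dimension strictly above \<open>S\<close>
    gives a minimal nonzero subcomodule of the quotient.\<close>
  define sub where "sub U \<longleftrightarrow> csubspace U \<and> S \<subset> U \<and> (\<forall>a. \<forall>x\<in>U. hit a x \<in> U)" for U
  have "sub UNIV" using S by (auto simp: sub_def complex_vector.subspace_UNIV)
  then obtain U where U: "sub U" and least: "\<And>U'. sub U' \<Longrightarrow> cdim U \<le> cdim U'"
    using ex_has_least_nat[of sub UNIV cdim] by blast
  have minimal: "U' = U" if "sub U'" "U' \<subseteq> U" for U'
    using that least[OF that(1)] U by (intro B.subspace_dim_equal[folded cdim_def csubspace_def]) (auto simp: sub_def)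
  \<comment> \<open>A coaction must be defined on the whole ambient space, whence the detour through
    \<open>\<sigma>\<close>. On the range of \<open>\<tau>\<close> it is the coaction induced on the
    quotient, because changing the lift by an element of \<open>S\<close> changes nothing after
    \<open>\<tau>\<close>.\<close>
  define \<rho> where "\<rho> w = tensor_map \<tau> (\<lambda>h. h) (\<Delta> (\<sigma> w))" for w
  have lin\<rho>: "clinear \<rho>" unfolding \<rho>_def by (intro lin lin\<tau>)
  have slice_\<tau>: "slice a (tensor_map \<tau> (\<lambda>h. h) t) = \<tau> (slice a t)" for a t
    by (rule clinear_eq_on_tensors[where t = t])
      (auto intro!: lin lin\<tau> simp: lin\<tau> lin_id clinear_scaleC[OF lin\<tau>])
  have \<rho>\<tau>: "\<rho> (\<tau> x) = tensor_map \<tau> (\<lambda>h. h) (\<Delta> x)" for x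
  proof (rule tensor_eqI)
    fix a
    have "hit a (x - \<sigma> (\<tau> x)) \<in> S" by (rule stable[OF \<sigma>\<tau>])
    then have "hit a x - hit a (\<sigma> (\<tau> x)) \<in> S" by (simp add: clinear_diff[OF lin_hit[OF lin_id]])
    from \<tau>_cong[OF this] show "slice a (\<rho> (\<tau> x)) = slice a (tensor_map \<tau> (\<lambda>h. h) (\<Delta> x))"
      by (simp add: \<rho>_def slice_\<tau> hit_def)
  qed
  have slice_\<rho>: "slice a (\<rho> (\<tau> x)) = \<tau> (hit a x)" for a x
    by (simp add: \<rho>\<tau> slice_\<tau> hit_def)
  have comodule: "comodule H (\<tau> ` U) \<rho>"
    unfolding comodule_def
  proof (intro conjI ballI)
    show "csubspace (\<tau> ` U)"
      using U complex_vector.subspace_UNIV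
      by (auto simp: sub_def intro!: complex_vector.subspaceI
          intro: image_eqI[of _ _ 0] image_eqI[of _ _ "_ + _"] image_eqI[of _ _ "_ *\<^sub>C _"]
          simp: clinear_zero[OF lin\<tau>] clinear_add[OF lin\<tau>, symmetric]
            clinear_scaleC[OF lin\<tau>, symmetric]
            complex_vector.subspace_0 complex_vector.subspace_add complex_vector.subspace_scale)
    show "clinear \<rho>" by (rule lin\<rho>)
    fix v assume "v \<in> \<tau> ` U"
    then obtain x where x: "x \<in> U" "v = \<tau> x" by blast
    obtain C :: "'a set" and c where C: "\<And>t :: (nat \<Rightarrow>\<^sub>0 complex) \<otimes> 'a. t = (\<Sum>b\<in>C. slice (c b) t \<otimes> b)"
      using tensor_eq_sum_slices by blast
    show "\<rho> v \<in> subspace_tensor (\<tau> ` U) UNIV"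
      unfolding subspace_tensor_def x
      by (subst C, intro complex_vector.span_sum complex_vector.span_base)
        (use U x in \<open>auto simp: slice_\<rho> sub_def\<close>)
    have "tensor_lift (\<lambda>w h. counit H h *\<^sub>C w) t = slice \<epsilon> t" for t :: "(nat \<Rightarrow>\<^sub>0 complex) \<otimes> 'a"
      by (simp add: slice_def)
    then show "tensor_lift (\<lambda>w h. counit H h *\<^sub>C w) (\<rho> v) = v"
      by (simp add: x slice_\<rho> hit_one)
    have assoc: "tensor_assoc (tensor_map \<tau> (\<lambda>h. h) s \<otimes> b) = tensor_map \<tau> (\<lambda>h. h) (tensor_assoc (s \<otimes> b))"
      for s and b :: 'a
      by (rule clinear_eq_on_tensors[where t = s]) (auto intro!: lin lin\<tau> simp: lin\<tau> lin_id)
    have "tensor_assoc (tensor_map \<rho> (\<lambda>h. h) (tensor_map \<tau> (\<lambda>h. h) t)) =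
        tensor_map \<tau> (\<lambda>h. h) (tensor_assoc (tensor_map \<Delta> (\<lambda>h. h) t))" for t :: "'a \<otimes> 'a"
      by (rule clinear_eq_on_tensors[where t = t])
        (auto intro!: lin lin\<tau> lin\<rho> comult_linear simp: lin\<tau> lin\<rho> lin_id comult_linear \<rho>\<tau> assoc)
    moreover have "tensor_map \<tau> (\<lambda>h. h) (tensor_map (\<lambda>h. h) \<Delta> t) =
        tensor_map (\<lambda>h. h) \<Delta> (tensor_map \<tau> (\<lambda>h. h) t)" for t :: "'a \<otimes> 'a"
      by (rule clinear_eq_on_tensors[where t = t])
        (auto intro!: lin lin\<tau> comult_linear simp: lin\<tau> lin_id comult_linear)
    ultimately show "tensor_assoc (tensor_map \<rho> id (\<rho> v)) = tensor_map id \<Delta> (\<rho> v)"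
      using coassoc[of x] by (simp add: x \<rho>\<tau> id_def)
  qed
  have "simple_comodule H (\<tau> ` U) \<rho>"
    unfolding simple_comodule_def
  proof (intro conjI allI impI comodule)
    show "\<tau> ` U \<noteq> {0}" using U \<tau>0 unfolding sub_def by (metis imageI psubsetE singletonD subsetI)
    fix W assume "W \<subseteq> \<tau> ` U \<and> comodule H W \<rho>"
    then have W: "W \<subseteq> \<tau> ` U" "csubspace W"
      and \<rho>W: "\<And>w. w \<in> W \<Longrightarrow> \<rho> w \<in> subspace_tensor W UNIV"
      by (auto simp: comodule_def)
    define U' where "U' = {x \<in> U. \<tau> x \<in> W}"
    have "csubspace U'"
      using U W unfolding U'_def sub_def
      by (intro complex_vector.subspaceI)
        (auto simp: clinear_zero[OF lin\<tau>] clinear_add[OF lin\<tau>] clinear_scaleC[OF lin\<tau>]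
          complex_vector.subspace_0 complex_vector.subspace_add complex_vector.subspace_scale)
    moreover have "S \<subseteq> U'"
      using U \<tau>0[THEN iffD2] complex_vector.subspace_0[OF W(2)] by (auto simp: U'_def sub_def)
    moreover have "hit a x \<in> U'" if x: "x \<in> U'" for a x
    proof -
      have "slice a (\<rho> (\<tau> x)) \<in> W"
      proof (rule clinear_span_mem[where f = "slice a"])
        show "\<rho> (\<tau> x) \<in> cspan {v \<otimes> w | v w. v \<in> W \<and> w \<in> UNIV}"
          using \<rho>W x unfolding U'_def subspace_tensor_def by blast
        show "slice a t \<in> W" if "t \<in> {v \<otimes> w | v w. v \<in> W \<and> w \<in> UNIV}" for t
          using that complex_vector.subspace_scale[OF W(2)] by auto
      qed (intro lin W)+
      then show ?thesis using x U by (simp add: slice_\<rho> U'_def sub_def)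
    qed
    ultimately have "U' = S \<or> U' = U"
      using minimal[of U'] by (auto simp: sub_def U'_def)
    moreover have "W = \<tau> ` U'" using W(1) by (auto simp: U'_def)
    moreover have "\<tau> ` S = {0}" using \<tau>0 complex_vector.subspace_0[OF S(1)] by force
    ultimately show "W = {0} \<or> W = \<tau> ` U" by metis
  qed
  then have dim: "cdim (\<tau> ` U) = 1" using pointed unfolding pointed_def by blast
  obtain b where b: "\<tau> ` U \<subseteq> cspan {b}"
  proof -
    obtain C where C: "\<tau> ` U \<subseteq> cspan C" "card C = cdim (\<tau> ` U)"
      by (rule complex_vector.basis_exists[of "\<tau> ` U"])
    from C(2) dim have "card C = 1" by simp
    then obtain b where "C = {b}" by (rule card_1_singletonE)
    with C(1) that show thesis by simp
  qed
  obtain x where x: "x \<in> U" "x \<notin> S" using U by (auto simp: sub_def)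
  then have \<tau>x: "\<tau> x \<noteq> 0" by (simp add: \<tau>0)
  then obtain n where n: "Poly_Mapping.lookup (\<tau> x) n \<noteq> 0"
    by (metis poly_mapping_eqI lookup_zero)
  \<comment> \<open>On a line every \<open>hit a\<close> acts by a scalar, read off here at a
    coordinate where \<open>\<tau> x\<close> is nonzero. These scalars form a character of the dual,
    and a character is evaluation at a grouplike element.\<close>
  define \<phi> where "\<phi> a = Poly_Mapping.lookup (\<tau> (hit a x)) n / Poly_Mapping.lookup (\<tau> x) n" for a
  have \<phi>: "\<tau> (hit a x) = \<phi> a *\<^sub>C \<tau> x" for a
  proof -
    have "\<tau> x \<in> cspan {b}" "\<tau> (hit a x) \<in> cspan {b}" using b x U by (auto simp: sub_def)
    then obtain k l where kl: "\<tau> x = k *\<^sub>C b" "\<tau> (hit a x) = l *\<^sub>C b"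
      by (auto simp: complex_vector.span_singleton)
    with \<tau>x n have "k \<noteq> 0" "Poly_Mapping.lookup b n \<noteq> 0"
      by (auto simp: scaleC_poly_mapping.rep_eq)
    then show ?thesis by (simp add: \<phi>_def kl scaleC_poly_mapping.rep_eq scaleC_scaleC)
  qed
  have "clinear (\<lambda>w :: nat \<Rightarrow>\<^sub>0 complex. Poly_Mapping.lookup w n / Poly_Mapping.lookup (\<tau> x) n)"
    by (rule clinearI) (simp_all add: lookup_add scaleC_poly_mapping.rep_eq add_divide_distrib)
  from lin_comp[OF this, of "\<lambda>a. \<tau> (hit a x)"] have "clinear \<phi>"
    unfolding \<phi>_def by (simp add: lin lin_id)
  then obtain g where g: "\<And>a. a \<bullet> g = \<phi> a" using represent_functional by metis
  have "\<phi> (a \<star> b) = \<phi> a * \<phi> b" for a b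
  proof -
    have "hit b x - \<phi> b *\<^sub>C x \<in> S"
      using \<phi>[of b] \<tau>0[of "hit b x - \<phi> b *\<^sub>C x"] by (simp add: clinear_diff[OF lin\<tau>] clinear_scaleC[OF lin\<tau>])
    from stable[OF this, of a] have "\<tau> (hit a (hit b x)) = \<phi> b *\<^sub>C \<tau> (hit a x)"
      by (simp add: clinear_diff[OF lin_hit[OF lin_id]] clinear_scaleC[OF lin_hit[OF lin_id]]
          clinear_scaleC[OF lin\<tau>] \<tau>_cong)
    then have "\<phi> (a \<star> b) *\<^sub>C \<tau> x = (\<phi> a * \<phi> b) *\<^sub>C \<tau> x"
      by (simp add: hit_hit \<phi> scaleC_scaleC mult.commute)
    then show ?thesis using \<tau>x by (simp add: complex_vector.scale_cancel_right)
  qed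
  then have "\<Delta> g = g \<otimes> g"
    by (intro comult_eqI) (simp add: g tensor_lift_tensor_prod[OF lin_ev2])
  moreover have "\<phi> \<epsilon> = 1" using n by (simp add: \<phi>_def hit_one)
  then have "g \<noteq> 0" using g[of \<epsilon>] by (auto simp: clinear_zero[OF counit_linear])
  ultimately have "g \<in> G" by (simp add: G_def grouplike_def)
  moreover have "hit a x - a \<bullet> g *\<^sub>C x \<in> S" for a
    using \<phi>[of a] \<tau>0[of "hit a x - a \<bullet> g *\<^sub>C x"]
    by (simp add: g clinear_diff[OF lin\<tau>] clinear_scaleC[OF lin\<tau>])
  ultimately show thesis using x(2) that by blast
qed

text \<open>\<open>P n\<close> is the coradical filtration in dual form, and by dimension it stops
  growing at some \<open>N\<close>. If \<open>P N\<close> were not everything,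
  \<open>ex_grouplike_mod\<close> would give a vector outside it on which the dual acts modulo
  \<open>P N\<close> through a grouplike element. Then \<open>J\<close> maps this vector into
  \<open>P N\<close>, so it lies in \<open>P (Suc N)\<close>, which is \<open>P N\<close>.\<close>

lemma J_nilpotent:
  assumes "pointed H"
  obtains N where "Jp N \<subseteq> {0}"
proof -
  define P where "P n = {x. \<forall>a\<in>Jp n. a \<bullet> x = 0}" for n
  have subP: "csubspace (P n)" for n
    unfolding P_def
    by (rule complex_vector.subspaceI)
      (auto simp: clinear_zero[OF clinear_dual_apply] clinear_add[OF clinear_dual_apply]
        clinear_scaleC[OF clinear_dual_apply])
  obtain B :: "'a set" where B: "finite_dimensional_vector_space scaleC B"
    using finite_dim ..
  interpret B: finite_dimensional_vector_space scaleC B by fact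
  have "cdim (P m) \<le> cdim (UNIV :: 'a set)" for m
    by (rule B.dim_subset[folded cdim_def]) simp
  then have "\<exists>N. \<forall>m. cdim (P m) \<le> cdim (P N)"
    using ex_has_greatest_nat[of "\<lambda>_. True" 0 "\<lambda>n. cdim (P n)" "Suc (cdim UNIV)"]
    by (auto simp: less_Suc_eq_le)
  then obtain N where N: "cdim (P (Suc N)) \<le> cdim (P N)" by blast
  have "P N \<subseteq> P (Suc N)" by (auto simp: P_def dest: Jp_Suc_subset)
  then have PN: "P N = P (Suc N)"
    using subP N by (intro B.subspace_dim_equal[folded cdim_def csubspace_def]) auto
  have "P N = UNIV"
  proof (rule ccontr)
    assume "P N \<noteq> UNIV"
    moreover have "hit a x \<in> P N" if "x \<in> P N" for a x
      using that Jp_star[of _ N a 0] by (simp add: P_def hit_apply)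
    ultimately obtain x g where x: "x \<notin> P N" "g \<in> G" "\<And>a. hit a x - a \<bullet> g *\<^sub>C x \<in> P N"
      using ex_grouplike_mod[OF assms subP] by metis
    have "a \<bullet> x \<in> {0}" if "a \<in> Jp (Suc N)" for a
    proof (rule Jp_Suc_right[where f = "\<lambda>a. a \<bullet> x", OF _ _ _ that])
      fix c d assume c: "c \<in> Jp N" and d: "d \<in> J"
      have "hit d x \<in> P N" using x(3)[of d] d x(2) by (simp add: J_def)
      then show "(c \<star> d) \<bullet> x \<in> {0}" using c by (simp add: P_def hit_apply)
    qed (auto intro: lin complex_vector.subspace_single_0)
    then have "x \<in> P (Suc N)" by (simp add: P_def)
    with x(1) PN show False by simp
  qed
  then have "a \<bullet> x = 0" if "a \<in> Jp N" for a x
    using that unfolding P_def by blast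
  then have "Jp N \<subseteq> {0}"
    by (auto simp: zero_dual.rep_eq intro!: dual_eqI)
  then show thesis by (rule that)
qed

end

theorem theorem6p1:
  fixes H :: "'a::complex_vector hopf"
  assumes "hopf_algebra H"
    and "\<exists>B :: 'a set. finite_dimensional_vector_space scaleC B"
    and "cotriangular H"
    and "pointed H"
  shows "subalgebra H hull {x. grouplike H x \<or> skew_primitive H x} = UNIV"
proof -
  interpret hopf_algebra H by fact
  interpret fd_hopf_algebra H by unfold_locales fact
  obtain N where N: "Jp N \<subseteq> {0}" using J_nilpotent[OF assms(4)] .
  obtain R where R: "triangular_structure (dual_hopf H) R"
    using assms(3) by (auto simp: cotriangular_def)
  interpret cotriangular_nilpotent H R N by unfold_locales fact+
  show ?thesis unfolding hull_def using subalgebra_generated by blast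
qed

end
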